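(* Fix integers $1\le t\le k$ and positive integers $d_1,\dots,d_t$. Let $q$ be a prime power, and independently for each $i\in[t]$ let $f_i$ be uniform on $\mathbb{F}_q[X_1,\dots,X_k]_{\le d_i}$. Then \[\mathbb{P}\big(\dim V(f_1,\dots,f_t)>k-t\big)\le C_t\, q^{-\min(d_1,\dots,d_t)}\] for a constant $C_t=C_t(d_1,\dots,d_t)>0$ independent of $q$ (one may take $C_t$ depending only on $k$ and the $d_i$). In particular, when $t=k$, \[\mathbb{P}\Big(\big|V(f_1,\dots,f_k)\cap\mathbb{F}_q^k\big|>\prod_{i=1}^k d_i\Big)\le C\,q^{-\min(d_1,\dots,d_k)}\] for a constant $C=C(d_1,\dots,d_k)>0$ independent of $q$.
   Context: $\mathbb{F}_q[X_1,\dots,X_k]_{\le d}$ is the set of $k$-variate polynomials over $\mathbb{F}_q$ of total degree at most $d$, sampled uniformly by choosing all coefficients independently and uniformly. For polynomials $f_1,\dots,f_t$, $V(f_1,\dots,f_t)=\{x\in\overline{\mathbb{F}}_q^{\,k}: f_1(x)=\cdots=f_t(x)=0\}$ is the affine variety over the algebraic closure $\overline{\mathbb{F}}_q$, and $\dim$ is its (Krull) dimension. *)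

theory Defs
  imports Complex_Main "HOL-Algebra.Algebraic_Closure" "HOL-Library.Extended_Nat"
begin

text \<open>Multivariate polynomials in the variables X_0, ..., X_(k-1) over a (HOL-Algebra) ring S
  are represented by their coefficient functions: a monomial is an exponent vector
  alpha :: nat => nat (alpha i = exponent of X_i), a polynomial maps monomials to coefficients.\<close>

definition monoms :: "nat \<Rightarrow> nat \<Rightarrow> (nat \<Rightarrow> nat) set" where
  "monoms k d = {\<alpha>. (\<forall>i. k \<le> i \<longrightarrow> \<alpha> i = 0) \<and> (\<Sum>i<k. \<alpha> i) \<le> d}"

text \<open>Sample space of F_q[X_1..X_k]_{<= d}: all choices of coefficients for the monomials of
  total degree at most d (uniform measure = counting measure normalised).\<close>
definition poly_space :: "('a, 'm) ring_scheme \<Rightarrow> nat \<Rightarrow> nat \<Rightarrow> ((nat \<Rightarrow> nat) \<Rightarrow> 'a) set" where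
  "poly_space R k d = monoms k d \<rightarrow>\<^sub>E carrier R"

definition mpolys :: "('b, 'm) ring_scheme \<Rightarrow> nat \<Rightarrow> ((nat \<Rightarrow> nat) \<Rightarrow> 'b) set" where
  "mpolys S k = {p. (\<forall>\<alpha>. p \<alpha> \<in> carrier S) \<and> finite {\<alpha>. p \<alpha> \<noteq> \<zero>\<^bsub>S\<^esub>}
                   \<and> (\<forall>\<alpha>. p \<alpha> \<noteq> \<zero>\<^bsub>S\<^esub> \<longrightarrow> (\<forall>i. k \<le> i \<longrightarrow> \<alpha> i = 0))}"

definition mpoly_eval :: "('b, 'm) ring_scheme \<Rightarrow> nat \<Rightarrow> ((nat \<Rightarrow> nat) \<Rightarrow> 'b) \<Rightarrow> (nat \<Rightarrow> 'b) \<Rightarrow> 'b" where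
  "mpoly_eval S k p x =
     finsum S (\<lambda>\<alpha>. p \<alpha> \<otimes>\<^bsub>S\<^esub> finprod S (\<lambda>i. x i [^]\<^bsub>S\<^esub> (\<alpha> i)) {..<k}) {\<alpha>. p \<alpha> \<noteq> \<zero>\<^bsub>S\<^esub>}"

definition lift_poly :: "('b, 'm) ring_scheme \<Rightarrow> ('a \<Rightarrow> 'b) \<Rightarrow> nat \<Rightarrow> nat \<Rightarrow> ((nat \<Rightarrow> nat) \<Rightarrow> 'a) \<Rightarrow> ((nat \<Rightarrow> nat) \<Rightarrow> 'b)" where
  "lift_poly S h k d c = (\<lambda>\<alpha>. if \<alpha> \<in> monoms k d then h (c \<alpha>) else \<zero>\<^bsub>S\<^esub>)"

definition aff :: "('b, 'm) ring_scheme \<Rightarrow> nat \<Rightarrow> (nat \<Rightarrow> 'b) set" where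
  "aff S k = {..<k} \<rightarrow>\<^sub>E carrier S"

definition zero_set :: "('b, 'm) ring_scheme \<Rightarrow> nat \<Rightarrow> ((nat \<Rightarrow> nat) \<Rightarrow> 'b) set \<Rightarrow> (nat \<Rightarrow> 'b) set" where
  "zero_set S k P = {x \<in> aff S k. \<forall>p\<in>P. mpoly_eval S k p x = \<zero>\<^bsub>S\<^esub>}"

definition zar_closed :: "('b, 'm) ring_scheme \<Rightarrow> nat \<Rightarrow> (nat \<Rightarrow> 'b) set \<Rightarrow> bool" where
  "zar_closed S k Z \<longleftrightarrow> (\<exists>P. P \<subseteq> mpolys S k \<and> Z = zero_set S k P)"

definition zar_irreducible :: "('b, 'm) ring_scheme \<Rightarrow> nat \<Rightarrow> (nat \<Rightarrow> 'b) set \<Rightarrow> bool" where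
  "zar_irreducible S k Z \<longleftrightarrow> zar_closed S k Z \<and> Z \<noteq> {} \<and>
     (\<forall>A B. zar_closed S k A \<and> zar_closed S k B \<and> Z = A \<union> B \<longrightarrow> Z = A \<or> Z = B)"

text \<open>Krull dimension of a Zariski closed set V: supremum of the lengths n of chains
  Z_0 < Z_1 < ... < Z_n of irreducible closed subsets of V.
  (For V empty this gives 0 instead of -1; irrelevant for events "dim > m" with m >= 0.)\<close>
definition zar_dim :: "('b, 'm) ring_scheme \<Rightarrow> nat \<Rightarrow> (nat \<Rightarrow> 'b) set \<Rightarrow> enat" where
  "zar_dim S k V = Sup {enat n | n. \<exists>Z. (\<forall>i\<le>n. zar_irreducible S k (Z i) \<and> Z i \<subseteq> V)
                                        \<and> (\<forall>i<n. Z i \<subset> Z (Suc i))}"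

end

theory Submission
  imports Defs
begin

text \<open>Fix a set \<open>S\<close> of \<open>k - t + 1\<close> variables and one variable \<open>x\<close> in \<open>S\<close>. By counting monomials, the
  \<open>k + 1\<close> polynomials \<open>f\<^sub>1, \<dots>, f\<^sub>t\<close> and \<open>X\<^sub>s\<close> (\<open>s \<in> S\<close>) satisfy a nontrivial relation
  \<open>Q (f, X\<^sub>S) = 0\<close> of degree bounded in terms of \<open>k\<close> and the \<open>d\<^sub>i\<close>. Adding independent uniform
  univariate polynomials \<open>a\<^sub>i (x)\<close> of degree at most \<open>d\<^sub>i\<close> does not change the distribution of \<open>f\<close>, and
  \<open>p = Q (- a (x), X\<^sub>S)\<close> lies in the ideal of the \<open>f\<^sub>i + a\<^sub>i (x)\<close>. Specialise \<open>X\<^sub>S\<close> to a point whose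
  \<open>x\<close>-coordinate has large degree over the finite field: then the \<open>a\<^sub>i\<close> take pairwise different values,
  and the Schwartz-Zippel lemma shows that \<open>p = 0\<close> has probability \<open>O (q\<^bsup>-min d\<^esup>)\<close>. So outside such
  an event every \<open>S\<close> carries an eliminant, a nonzero polynomial in \<open>X\<^sub>S\<close> in the ideal of the \<open>f\<^sub>i\<close>.
  If all eliminants exist, the coordinate functions of degree at most \<open>e\<close> on the variety span a
  space of dimension \<open>O (e\<^bsup>k - t\<^esup>)\<close>, whereas a chain of \<open>k - t + 2\<close> irreducible sets yields
  \<open>k - t + 1\<close> algebraically independent functions. For \<open>t = k\<close> the eliminants make \<open>f\<close> a system of
  parameters at each zero \<open>P\<close>, so the power products of \<open>f\<close> of a given degree are independent modulo
  the maximal ideal at \<open>P\<close>. Hence the products \<open>f\<^sup>\<alpha> h\<^sub>P\<close>, where \<open>h\<^sub>P\<close> separates the zeros, are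
  linearly independent, and comparing their number in degree at most \<open>s\<close> with the number of all
  monomials gives Bezout's inequality as \<open>s\<close> tends to infinity.\<close>

section \<open>Linear algebra over a field acting on a ring\<close>

text \<open>The obvious candidate for an eliminant is \<open>Q (0, X_S)\<close>: it is congruent to
  \<open>Q (f, X_S) = 0\<close> modulo the ideal of \<open>f\<close>, but it may be the zero
  polynomial. The shift removes this obstacle. \<open>Q\<close> depends only on \<open>f\<close>,
  and modulo the ideal of the \<open>f_i + a_i (x)\<close> each \<open>f_i\<close> is congruent to
  \<open>- a_i (x)\<close>; the resulting \<open>Q (- a (x), X_S)\<close> is zero only for
  exceptional \<open>a\<close>. If \<open>x\<close> were specialised to an element of the finite
  field, \<open>a_i\<close> would take at most \<open>q\<close> values there and Schwartz-Zippel
  would yield no more than a factor \<open>1 / q\<close>; at a suitable point outside, all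
  \<open>q^(d_i + 1)\<close> choices of \<open>a_i\<close> have different values. Dimension theory
  and local algebra are replaced by counting. Polynomials are functions on \<open>L^k\<close>,
  ideals are linear spans, and each dependence comes from having more power products than spanning
  elements. Eliminants for every set of \<open>k - t + 1\<close> variables bound the number of
  standard monomials, because each monomial with \<open>k - t + 1\<close> large exponents can be
  reduced.\<close>

locale scalars = L: field L + ring_hom_cring L A \<kappa>
  for L and A (structure) and \<kappa>
begin

text \<open>The \<open>L\<close>-linear span of \<open>G\<close>, with scalars acting through
  \<open>\<kappa>\<close>. The inductive form admits infinite \<open>G\<close> and lets closure
  properties go by induction instead of by manipulating finite sums.\<close>

inductive_set sp :: "'c set \<Rightarrow> 'c set" for G where
  sp_zero: "\<zero> \<in> sp G"
| sp_step: "\<lbrakk>F \<in> sp G; g \<in> G; c \<in> carrier L\<rbrakk> \<Longrightarrow> \<kappa> c \<otimes> g \<oplus> F \<in> sp G"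

lemma sp_closed:
  assumes "G \<subseteq> carrier A" "F \<in> sp G"
  shows "F \<in> carrier A"
  using assms(2) by induction (use assms(1) in auto)

lemma sp_base:
  assumes "G \<subseteq> carrier A" "g \<in> G"
  shows "g \<in> sp G"
proof -
  have "\<kappa> \<one>\<^bsub>L\<^esub> \<otimes> g \<oplus> \<zero> \<in> sp G"
    using assms by (intro sp_step sp_zero) auto
  moreover have "g \<in> carrier A" using assms by auto
  ultimately show ?thesis by simp
qed

lemma sp_mono:
  assumes "G \<subseteq> H"
  shows "sp G \<subseteq> sp H"
proof
  fix F assume "F \<in> sp G"
  then show "F \<in> sp H" by induction (use assms in \<open>auto intro: sp_zero sp_step\<close>)
qed

lemma sp_add:
  assumes G: "G \<subseteq> carrier A" and F: "F \<in> sp G" and F': "F' \<in> sp G"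
  shows "F \<oplus> F' \<in> sp G"
  using F
proof induction
  case sp_zero
  then show ?case using F' sp_closed[OF G F'] by simp
next
  case (sp_step F g c)
  have "\<kappa> c \<otimes> g \<in> carrier A" "F \<in> carrier A" "F' \<in> carrier A"
    using sp_step G F' by (auto intro: sp_closed)
  then have "\<kappa> c \<otimes> g \<oplus> F \<oplus> F' = \<kappa> c \<otimes> g \<oplus> (F \<oplus> F')"
    by (simp add: a_assoc)
  then show ?case using sp_step by (auto intro: sp.sp_step)
qed

lemma sp_smult:
  assumes G: "G \<subseteq> carrier A" and F: "F \<in> sp G" and a: "a \<in> carrier L"
  shows "\<kappa> a \<otimes> F \<in> sp G"
  using F
proof induction
  case sp_zero
  then show ?case using a by (simp add: sp.sp_zero)
next
  case (sp_step F g c)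
  have c: "\<kappa> c \<in> carrier A" "g \<in> carrier A" "F \<in> carrier A" "\<kappa> a \<in> carrier A"
    using sp_step G a by (auto intro: sp_closed)
  have "\<kappa> a \<otimes> (\<kappa> c \<otimes> g \<oplus> F) = \<kappa> (a \<otimes>\<^bsub>L\<^esub> c) \<otimes> g \<oplus> \<kappa> a \<otimes> F"
    using c sp_step a by (simp add: r_distr m_assoc)
  moreover have "\<kappa> (a \<otimes>\<^bsub>L\<^esub> c) \<otimes> g \<oplus> \<kappa> a \<otimes> F \<in> sp G"
    using sp_step a by (intro sp.sp_step) auto
  ultimately show ?case by simp
qed

lemma sp_minus:
  assumes G: "G \<subseteq> carrier A" and F: "F \<in> sp G"
  shows "\<ominus> F \<in> sp G"
proof -
  have "F \<in> carrier A" using sp_closed[OF G F] .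
  then have "\<kappa> (\<ominus>\<^bsub>L\<^esub> \<one>\<^bsub>L\<^esub>) \<otimes> F = \<ominus> F"
    by (simp add: l_minus)
  then show ?thesis using sp_smult[OF G F, of "\<ominus>\<^bsub>L\<^esub> \<one>\<^bsub>L\<^esub>"] by simp
qed

lemma sp_diff:
  assumes G: "G \<subseteq> carrier A" and F: "F \<in> sp G" and F': "F' \<in> sp G"
  shows "F \<ominus> F' \<in> sp G"
  using assms by (auto simp: a_minus_def intro: sp_add sp_minus)

lemma sp_sub:
  assumes H: "H \<subseteq> carrier A" and GH: "G \<subseteq> sp H"
  shows "sp G \<subseteq> sp H"
proof
  fix F assume "F \<in> sp G"
  then show "F \<in> sp H"
    by induction (use GH H in \<open>auto intro: sp_zero sp_add sp_smult\<close>)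
qed

lemma sp_finsum:
  assumes G: "G \<subseteq> carrier A" and F: "\<And>i. i \<in> I \<Longrightarrow> F i \<in> sp G"
  shows "(\<Oplus>i\<in>I. F i) \<in> sp G"
  using F
proof (induction I rule: infinite_finite_induct)
  case (insert i I)
  then have "F \<in> insert i I \<rightarrow> carrier A" using G by (auto intro: sp_closed)
  then have "(\<Oplus>i\<in>insert i I. F i) = F i \<oplus> (\<Oplus>i\<in>I. F i)"
    using insert by (intro finsum_insert) auto
  then show ?case using insert G by (auto intro: sp_add)
qed (auto simp: finsum_infinite sp_zero)

lemma sp_mult:
  assumes U: "U \<subseteq> carrier A" and G: "G \<subseteq> carrier A" and H: "H \<subseteq> carrier A"
    and GH: "\<And>g h. \<lbrakk>g \<in> G; h \<in> H\<rbrakk> \<Longrightarrow> g \<otimes> h \<in> sp U"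
    and F: "F \<in> sp G" and F': "F' \<in> sp H"
  shows "F \<otimes> F' \<in> sp U"
  using F
proof induction
  case sp_zero
  then show ?case using sp_closed[OF H F'] by (simp add: sp.sp_zero)
next
  case (sp_step F g c)
  have g: "g \<in> carrier A" using sp_step G by auto
  have "g \<otimes> F' \<in> sp U" using F'
  proof induction
    case sp_zero
    then show ?case using g by (simp add: sp.sp_zero)
  next
    case (sp_step F' h c)
    have h: "\<kappa> c \<in> carrier A" "h \<in> carrier A" "F' \<in> carrier A"
      using sp_step H by (auto intro: sp_closed)
    have "g \<otimes> (\<kappa> c \<otimes> h \<oplus> F') = \<kappa> c \<otimes> (g \<otimes> h) \<oplus> g \<otimes> F'"
      using g h by (simp add: r_distr m_lcomm)
    then show ?case using sp_step GH \<open>g \<in> G\<close> U by (auto intro!: sp_add sp_smult)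
  qed
  moreover have "(\<kappa> c \<otimes> g \<oplus> F) \<otimes> F' = \<kappa> c \<otimes> (g \<otimes> F') \<oplus> F \<otimes> F'"
    using g sp_closed[OF H F'] sp_closed[OF G sp_step(1)] sp_step(3)
    by (simp add: l_distr m_assoc)
  ultimately show ?case using sp_step U by (auto intro!: sp_add sp_smult)
qed

lemma sp_mult_base:
  assumes U: "U \<subseteq> carrier A" and G: "G \<subseteq> carrier A" and h: "h \<in> carrier A"
    and GH: "\<And>g. g \<in> G \<Longrightarrow> h \<otimes> g \<in> sp U"
    and F: "F \<in> sp G"
  shows "h \<otimes> F \<in> sp U"
  by (rule sp_mult[OF U _ G _ sp_base F, of "{h}"]) (use h GH in auto)

text \<open>A generator may be used many times in the inductive construction; its occurrences are
  collected into one coefficient, as elimination needs.\<close>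

lemma sp_insertD:
  assumes "F \<in> sp (insert g G)" and G: "insert g G \<subseteq> carrier A"
  shows "\<exists>c\<in>carrier L. \<exists>F'\<in>sp G. F = \<kappa> c \<otimes> g \<oplus> F'"
  using assms(1)
proof induction
  case sp_zero
  show ?case using G by (intro bexI[of _ "\<zero>\<^bsub>L\<^esub>"] bexI[of _ "\<zero>"]) (auto intro: sp.sp_zero)
next
  case (sp_step F h c)
  then obtain d F' where d: "d \<in> carrier L" "F' \<in> sp G" "F = \<kappa> d \<otimes> g \<oplus> F'" by blast
  have car: "g \<in> carrier A" "h \<in> carrier A" "F' \<in> carrier A" "\<kappa> c \<in> carrier A" "\<kappa> d \<in> carrier A"
    using G d sp_step by (auto intro: sp_closed)
  show ?case
  proof (cases "h = g")
    case True
    have "\<kappa> c \<otimes> h \<oplus> F = \<kappa> (c \<oplus>\<^bsub>L\<^esub> d) \<otimes> g \<oplus> F'"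
      using True d sp_step car by (simp add: l_distr a_assoc)
    then show ?thesis using d sp_step by blast
  next
    case False
    then have "\<kappa> c \<otimes> h \<oplus> F' \<in> sp G" using sp_step d by (auto intro: sp.sp_step)
    moreover have "\<kappa> c \<otimes> h \<oplus> F = \<kappa> d \<otimes> g \<oplus> (\<kappa> c \<otimes> h \<oplus> F')"
      using d car by (simp add: a_lcomm)
    ultimately show ?thesis using d by blast
  qed
qed

lemma sp_imageD:
  assumes "F \<in> sp (m ` B)" and m: "m ` B \<subseteq> carrier A"
  shows "\<exists>B0 c. finite B0 \<and> B0 \<subseteq> B \<and> c \<in> B0 \<rightarrow> carrier L \<and> F = (\<Oplus>\<beta>\<in>B0. \<kappa> (c \<beta>) \<otimes> m \<beta>)"
  using assms(1)
proof induction
  case sp_zero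
  show ?case by (intro exI[of _ "{}"]) auto
next
  case (sp_step F h d)
  then obtain B0 c \<beta> where B0: "finite B0" "B0 \<subseteq> B" "c \<in> B0 \<rightarrow> carrier L"
    "F = (\<Oplus>\<beta>\<in>B0. \<kappa> (c \<beta>) \<otimes> m \<beta>)" "\<beta> \<in> B" "h = m \<beta>" by blast
  \<comment> \<open>The index \<open>\<beta>\<close> may already occur in \<open>B0\<close>; then
    the new scalar is added to its old coefficient.\<close>
  define c' where "c' = (\<lambda>\<gamma>. (if \<gamma> = \<beta> then d else \<zero>\<^bsub>L\<^esub>) \<oplus>\<^bsub>L\<^esub> (if \<gamma> \<in> B0 then c \<gamma> else \<zero>\<^bsub>L\<^esub>))"
  let ?B = "insert \<beta> B0"
  have mB: "\<And>\<gamma>. \<gamma> \<in> ?B \<Longrightarrow> m \<gamma> \<in> carrier A" using m B0 by auto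
  have c: "\<And>\<gamma>. \<gamma> \<in> B0 \<Longrightarrow> c \<gamma> \<in> carrier L" using B0 by auto
  have c': "c' \<in> ?B \<rightarrow> carrier L" using c sp_step unfolding c'_def by auto
  have "(\<Oplus>\<gamma>\<in>?B. \<kappa> (c' \<gamma>) \<otimes> m \<gamma>) =
      (\<Oplus>\<gamma>\<in>?B. (\<kappa> (if \<gamma> = \<beta> then d else \<zero>\<^bsub>L\<^esub>) \<otimes> m \<gamma>) \<oplus> (\<kappa> (if \<gamma> \<in> B0 then c \<gamma> else \<zero>\<^bsub>L\<^esub>) \<otimes> m \<gamma>))"
    using mB sp_step c unfolding c'_def by (intro finsum_cong') (auto simp: l_distr)
  also have "\<dots> = (\<Oplus>\<gamma>\<in>?B. \<kappa> (if \<gamma> = \<beta> then d else \<zero>\<^bsub>L\<^esub>) \<otimes> m \<gamma>) \<oplus>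
     (\<Oplus>\<gamma>\<in>?B. \<kappa> (if \<gamma> \<in> B0 then c \<gamma> else \<zero>\<^bsub>L\<^esub>) \<otimes> m \<gamma>)"
    using mB sp_step c by (intro finsum_addf) auto
  also have "(\<Oplus>\<gamma>\<in>?B. \<kappa> (if \<gamma> = \<beta> then d else \<zero>\<^bsub>L\<^esub>) \<otimes> m \<gamma>) =
      (\<Oplus>\<gamma>\<in>{\<beta>}. \<kappa> d \<otimes> m \<gamma>)"
    using mB sp_step B0 by (intro add.finprod_mono_neutral_cong_right) auto
  also have "\<dots> = \<kappa> d \<otimes> h"
    using mB sp_step B0 by simp
  also have "(\<Oplus>\<gamma>\<in>?B. \<kappa> (if \<gamma> \<in> B0 then c \<gamma> else \<zero>\<^bsub>L\<^esub>) \<otimes> m \<gamma>) = F"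
    unfolding B0(4) using mB c B0 by (intro add.finprod_mono_neutral_cong_right) auto
  finally show ?case using B0 c' by (intro exI[of _ ?B] exI[of _ c']) auto
qed

lemma sp_finite_imageD:
  assumes "F \<in> sp (m ` B)" and m: "m ` B \<subseteq> carrier A" and "finite B"
  shows "\<exists>c. c \<in> B \<rightarrow> carrier L \<and> F = (\<Oplus>\<beta>\<in>B. \<kappa> (c \<beta>) \<otimes> m \<beta>)"
proof -
  obtain B0 c where B0: "finite B0" "B0 \<subseteq> B" "c \<in> B0 \<rightarrow> carrier L"
    "F = (\<Oplus>\<beta>\<in>B0. \<kappa> (c \<beta>) \<otimes> m \<beta>)" using sp_imageD[OF assms(1,2)] by blast
  define c' where "c' = (\<lambda>\<gamma>. if \<gamma> \<in> B0 then c \<gamma> else \<zero>\<^bsub>L\<^esub>)"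
  have "c' \<in> B \<rightarrow> carrier L" using B0 by (auto simp: c'_def)
  moreover have "F = (\<Oplus>\<beta>\<in>B. \<kappa> (c' \<beta>) \<otimes> m \<beta>)"
    unfolding B0(4) using m B0 assms(3)
    by (intro add.finprod_mono_neutral_cong_left) (auto simp: c'_def Pi_def)
  ultimately show ?thesis by blast
qed

lemma sp_finsumI:
  assumes "m ` B \<subseteq> carrier A" "c \<in> B \<rightarrow> carrier L"
  shows "(\<Oplus>\<beta>\<in>B. \<kappa> (c \<beta>) \<otimes> m \<beta>) \<in> sp (m ` B)"
  using assms by (intro sp_finsum sp_smult sp_base) auto

text \<open>Steinitz-type exchange, by Gaussian elimination on the spanning set \<open>J\<close>.\<close>
lemma exists_dependence:
  assumes U: "U \<subseteq> carrier A" and "finite J" and "J \<subseteq> carrier A" and "finite B" and "card J < card B"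
    and "\<And>b. b \<in> B \<Longrightarrow> F b \<in> sp (J \<union> U)"
  shows "\<exists>c. c \<in> B \<rightarrow> carrier L \<and> (\<exists>b\<in>B. c b \<noteq> \<zero>\<^bsub>L\<^esub>) \<and> (\<Oplus>b\<in>B. \<kappa> (c b) \<otimes> F b) \<in> sp U"
  using assms(2-)
proof (induction J arbitrary: B F rule: finite_induct)
  case empty
  then obtain b0 where "b0 \<in> B" by fastforce
  then show ?case using empty U
    by (intro exI[of _ "\<lambda>b. \<one>\<^bsub>L\<^esub>"] conjI sp_finsum sp_smult) auto
next
  case (insert g J)
  have JU: "J \<union> U \<subseteq> carrier A" and g: "g \<in> carrier A" using insert U by auto
  have "\<exists>m F'. m \<in> carrier L \<and> F' \<in> sp (J \<union> U) \<and> F b = \<kappa> m \<otimes> g \<oplus> F'" if "b \<in> B" for b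
    using sp_insertD[of "F b" g "J \<union> U"] insert.prems(4)[OF that] JU g by auto
  then obtain m F' where mF: "\<And>b. b \<in> B \<Longrightarrow> m b \<in> carrier L \<and> F' b \<in> sp (J \<union> U) \<and> F b = \<kappa> (m b) \<otimes> g \<oplus> F' b"
    by metis
  have F'c: "\<And>b. b \<in> B \<Longrightarrow> F' b \<in> carrier A" using mF sp_closed[OF JU] by blast
  show ?case
  proof (cases "\<forall>b\<in>B. m b = \<zero>\<^bsub>L\<^esub>")
    case True
    have "F b \<in> sp (J \<union> U)" if "b \<in> B" for b
      using mF[OF that] True that g F'c[OF that] by auto
    moreover have "card J < card B" using insert by auto
    ultimately show ?thesis using insert.IH[of B F] insert.prems by auto
  next
    case False
    then obtain b0 where b0: "b0 \<in> B" "m b0 \<noteq> \<zero>\<^bsub>L\<^esub>" by auto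
    let ?B = "B - {b0}"
    \<comment> \<open>Row operation with pivot \<open>b0\<close>: adding the multiple
      \<open>r b\<close> of \<open>F b0\<close> clears the generator \<open>g\<close> from row
      \<open>b\<close>; the reduced row is \<open>F''\<close>.\<close>
    define r where "r b = \<ominus>\<^bsub>L\<^esub> (m b \<otimes>\<^bsub>L\<^esub> inv\<^bsub>L\<^esub> (m b0))" for b
    have inv0: "inv\<^bsub>L\<^esub> (m b0) \<in> carrier L" "inv\<^bsub>L\<^esub> (m b0) \<otimes>\<^bsub>L\<^esub> m b0 = \<one>\<^bsub>L\<^esub>"
      using b0 mF[OF b0(1)] L.field_Units by auto
    have r: "\<And>b. b \<in> B \<Longrightarrow> r b \<in> carrier L" using mF inv0 by (auto simp: r_def)
    have rm: "r b \<otimes>\<^bsub>L\<^esub> m b0 = \<ominus>\<^bsub>L\<^esub> m b" if "b \<in> B" for b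
      using mF[OF that] mF[OF b0(1)] inv0 by (simp add: r_def L.l_minus L.m_assoc)
    define F'' where "F'' b = F b \<oplus> \<kappa> (r b) \<otimes> F b0" for b
    have Fc: "\<And>b. b \<in> B \<Longrightarrow> F b \<in> carrier A" using mF F'c g by auto
    have "F'' b \<in> sp (J \<union> U)" if b: "b \<in> B" for b
    proof -
      have km: "\<kappa> (r b) \<otimes> \<kappa> (m b0) = \<ominus> \<kappa> (m b)"
        using rm[OF b] r[OF b] mF[OF b0(1)] mF[OF b] by (metis hom_a_inv hom_mult)
      have car: "\<kappa> (m b) \<in> carrier A" "\<kappa> (m b0) \<in> carrier A" "\<kappa> (r b) \<in> carrier A"
        "F' b \<in> carrier A" "F' b0 \<in> carrier A" "g \<in> carrier A"
        using mF[OF b] mF[OF b0(1)] r[OF b] F'c b b0 g by auto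
      have "F'' b = (\<kappa> (m b) \<otimes> g \<oplus> F' b) \<oplus> \<kappa> (r b) \<otimes> (\<kappa> (m b0) \<otimes> g \<oplus> F' b0)"
        unfolding F''_def using mF[OF b] mF[OF b0(1)] by simp
      also have "\<dots> = (\<kappa> (m b) \<otimes> g \<oplus> F' b) \<oplus> ((\<kappa> (r b) \<otimes> \<kappa> (m b0)) \<otimes> g \<oplus> \<kappa> (r b) \<otimes> F' b0)"
        using car by (simp add: r_distr m_assoc)
      also have "\<dots> = F' b \<oplus> \<kappa> (r b) \<otimes> F' b0"
        unfolding km using car by algebra
      finally show ?thesis using mF[OF b] mF[OF b0(1)] r[OF b] JU by (auto intro!: sp_add sp_smult)
    qed
    moreover have "card J < card ?B" using insert b0 by auto
    ultimately obtain c where c: "c \<in> ?B \<rightarrow> carrier L" "\<exists>b\<in>?B. c b \<noteq> \<zero>\<^bsub>L\<^esub>"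
        "(\<Oplus>b\<in>?B. \<kappa> (c b) \<otimes> F'' b) \<in> sp U"
      using insert.IH[of ?B F''] insert.prems by auto
    \<comment> \<open>Undoes the row operations: \<open>b0\<close> receives the coefficient that the
      reduced rows collect from \<open>F b0\<close>.\<close>
    define s where "s = (\<Oplus>\<^bsub>L\<^esub>b\<in>?B. c b \<otimes>\<^bsub>L\<^esub> r b)"
    define c' where "c' = c(b0 := s)"
    have sc: "s \<in> carrier L" unfolding s_def using c r by (intro L.finsum_closed) auto
    have c'c: "c' \<in> B \<rightarrow> carrier L" using c sc by (auto simp: c'_def Pi_def)
    have ks: "\<kappa> s = (\<Oplus>b\<in>?B. \<kappa> (c b) \<otimes> \<kappa> (r b))"
      unfolding s_def using c r
      by (subst hom_finsum) (auto intro!: finsum_cong' simp: Pi_def)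
    have cc: "\<And>b. b \<in> ?B \<Longrightarrow> c b \<in> carrier L" using c by auto
    have "(\<Oplus>b\<in>B. \<kappa> (c' b) \<otimes> F b) = (\<Oplus>b\<in>insert b0 ?B. \<kappa> (c' b) \<otimes> F b)"
      using b0 by (simp add: insert_absorb)
    also have "\<dots> = \<kappa> s \<otimes> F b0 \<oplus> (\<Oplus>b\<in>?B. \<kappa> (c' b) \<otimes> F b)"
      using insert.prems Fc c'c sc b0 by (subst finsum_insert) (auto simp: c'_def Pi_def)
    also have "(\<Oplus>b\<in>?B. \<kappa> (c' b) \<otimes> F b) = (\<Oplus>b\<in>?B. \<kappa> (c b) \<otimes> F b)"
      using Fc c by (intro finsum_cong') (auto simp: c'_def)
    also have "\<kappa> s \<otimes> F b0 = (\<Oplus>b\<in>?B. \<kappa> (c b) \<otimes> \<kappa> (r b) \<otimes> F b0)"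
      unfolding ks using insert.prems Fc b0 cc r by (intro finsum_ldistr) (auto simp: Pi_def)
    also have "\<dots> \<oplus> (\<Oplus>b\<in>?B. \<kappa> (c b) \<otimes> F b) =
        (\<Oplus>b\<in>?B. \<kappa> (c b) \<otimes> \<kappa> (r b) \<otimes> F b0 \<oplus> \<kappa> (c b) \<otimes> F b)"
      using Fc b0 cc r by (intro finsum_addf[symmetric]) (auto simp: Pi_def)
    also have "\<dots> = (\<Oplus>b\<in>?B. \<kappa> (c b) \<otimes> F'' b)"
      unfolding F''_def using Fc b0 cc r
      by (intro finsum_cong') (auto simp: Pi_def r_distr m_assoc a_comm)
    finally have "(\<Oplus>b\<in>B. \<kappa> (c' b) \<otimes> F b) \<in> sp U" using c by simp
    moreover have "\<exists>b\<in>B. c' b \<noteq> \<zero>\<^bsub>L\<^esub>" using c by (auto simp: c'_def)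
    ultimately show ?thesis using c'c by blast
  qed
qed

end

section \<open>Monomials and polynomials of bounded exponents\<close>

text \<open>The extensional product \<open>PiE W S\<close> with default value 0 instead of
  \<open>undefined\<close>, so that exponent vectors can be added pointwise.\<close>

definition exps :: "nat set \<Rightarrow> (nat \<Rightarrow> nat set) \<Rightarrow> (nat \<Rightarrow> nat) set" where
  "exps W S = {\<alpha>. \<forall>i. (i \<in> W \<longrightarrow> \<alpha> i \<in> S i) \<and> (i \<notin> W \<longrightarrow> \<alpha> i = 0)}"

text \<open>Bounding every exponent separately, and not the total degree, makes the number of
  monomials the exact power \<open>(E + 1) ^ card W\<close>, which the counting arguments
  compare.\<close>

definition box :: "nat set \<Rightarrow> nat \<Rightarrow> (nat \<Rightarrow> nat) set" where
  "box W E = exps W (\<lambda>_. {..E})"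

lemma box_iff: "\<alpha> \<in> box W E \<longleftrightarrow> (\<forall>i. (i \<in> W \<longrightarrow> \<alpha> i \<le> E) \<and> (i \<notin> W \<longrightarrow> \<alpha> i = 0))"
  by (auto simp: box_def exps_def)

lemma exps_eq_image: "exps W S = (\<lambda>\<alpha> i. if i \<in> W then \<alpha> i else 0) ` PiE W S"
proof (intro equalityI subsetI)
  fix \<alpha> assume a: "\<alpha> \<in> exps W S"
  then have "\<alpha> = (\<lambda>i. if i \<in> W then restrict \<alpha> W i else 0)" "restrict \<alpha> W \<in> PiE W S"
    by (auto simp: exps_def)
  then show "\<alpha> \<in> (\<lambda>\<alpha> i. if i \<in> W then \<alpha> i else 0) ` PiE W S" by (rule image_eqI)
qed (auto simp: exps_def)

lemma finite_exps:
  assumes "finite W" "\<And>i. i \<in> W \<Longrightarrow> finite (S i)"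
  shows "finite (exps W S)"
  using assms by (auto simp: exps_eq_image intro!: finite_PiE)

lemma card_exps:
  assumes "finite W"
  shows "card (exps W S) = (\<Prod>i\<in>W. card (S i))"
proof -
  have "inj_on (\<lambda>\<alpha> i. if i \<in> W then \<alpha> i else 0) (PiE W S)"
  proof (rule inj_onI)
    fix \<alpha> \<beta> assume a: "\<alpha> \<in> PiE W S" "\<beta> \<in> PiE W S"
      and eq: "(\<lambda>i. if i \<in> W then \<alpha> i else 0) = (\<lambda>i. if i \<in> W then \<beta> i else (0::nat))"
    have "\<alpha> i = \<beta> i" if "i \<in> W" for i using fun_cong[OF eq, of i] that by simp
    then show "\<alpha> = \<beta>" using a by (intro PiE_ext)
  qed
  then show ?thesis using assms by (simp add: exps_eq_image card_image card_PiE)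
qed

lemma finite_box: "finite W \<Longrightarrow> finite (box W E)"
  by (simp add: box_def finite_exps)

lemma card_box: "finite W \<Longrightarrow> card (box W E) = (E + 1) ^ card W"
  by (simp add: box_def card_exps)

lemma box_mono: "E \<le> E' \<Longrightarrow> box W E \<subseteq> box W E'"
  by (force simp: box_iff)

lemma box_add: "\<lbrakk>\<alpha> \<in> box W D; \<beta> \<in> box W E\<rbrakk> \<Longrightarrow> (\<lambda>i. \<alpha> i + \<beta> i) \<in> box W (D + E)"
  by (auto simp: box_iff add_mono)

lemma box_insert:
  assumes "i \<notin> W"
  shows "box (insert i W) E = (\<Union>j\<in>{..E}. (\<lambda>\<beta>. \<beta>(i := j)) ` box W E)"
proof (intro equalityI subsetI)
  fix \<alpha> assume a: "\<alpha> \<in> box (insert i W) E"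
  then have "\<alpha> = (\<alpha>(i := 0))(i := \<alpha> i)" "\<alpha>(i := 0) \<in> box W E" "\<alpha> i \<in> {..E}"
    using assms by (auto simp: box_iff)
  then show "\<alpha> \<in> (\<Union>j\<in>{..E}. (\<lambda>\<beta>. \<beta>(i := j)) ` box W E)" by blast
next
  fix \<alpha> assume "\<alpha> \<in> (\<Union>j\<in>{..E}. (\<lambda>\<beta>. \<beta>(i := j)) ` box W E)"
  then obtain j \<beta> where "j \<le> E" "\<beta> \<in> box W E" "\<alpha> = \<beta>(i := j)" by auto
  then show "\<alpha> \<in> box (insert i W) E" by (auto simp: box_iff)
qed

section \<open>Values of monomials and of polynomials with bounded exponents\<close>

definition mpow :: "('c, 'm) ring_scheme \<Rightarrow> nat set \<Rightarrow> (nat \<Rightarrow> 'c) \<Rightarrow> (nat \<Rightarrow> nat) \<Rightarrow> 'c" where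
  "mpow A W x \<alpha> = finprod A (\<lambda>i. x i [^]\<^bsub>A\<^esub> \<alpha> i) W"

text \<open>The polynomial with coefficient function \<open>c\<close> is not itself a ring element;
  only its value at a point \<open>z\<close> with coordinates in the \<open>L\<close>-algebra
  \<open>A\<close> occurs. Coordinates that are functions amount to substitution.\<close>

definition bpol :: "('c, 'm) ring_scheme \<Rightarrow> ('d \<Rightarrow> 'c) \<Rightarrow> nat set \<Rightarrow> (nat \<Rightarrow> 'c) \<Rightarrow> nat \<Rightarrow> ((nat \<Rightarrow> nat) \<Rightarrow> 'd) \<Rightarrow> 'c" where
  "bpol A \<kappa> W z E c = finsum A (\<lambda>\<beta>. \<kappa> (c \<beta>) \<otimes>\<^bsub>A\<^esub> mpow A W z \<beta>) (box W E)"

context cring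
begin

lemma mpow_closed [simp]:
  assumes "x \<in> W \<rightarrow> carrier R"
  shows "mpow R W x \<alpha> \<in> carrier R"
  using assms by (auto simp: mpow_def intro!: finprod_closed)

lemma mpow_image:
  assumes "x \<in> W \<rightarrow> carrier R"
  shows "mpow R W x ` P \<subseteq> carrier R"
  using assms by auto

lemma mpow_add:
  assumes "x \<in> W \<rightarrow> carrier R"
  shows "mpow R W x (\<lambda>i. \<alpha> i + \<beta> i) = mpow R W x \<alpha> \<otimes> mpow R W x \<beta>"
proof -
  have "mpow R W x (\<lambda>i. \<alpha> i + \<beta> i) = finprod R (\<lambda>i. x i [^] \<alpha> i \<otimes> x i [^] \<beta> i) W"
    unfolding mpow_def using assms by (intro finprod_cong') (auto simp: nat_pow_mult Pi_def)
  then show ?thesis unfolding mpow_def using assms by (subst finprod_multf[symmetric]) auto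
qed

lemma mpow_zero: "(\<And>i. i \<in> W \<Longrightarrow> \<alpha> i = 0) \<Longrightarrow> mpow R W x \<alpha> = \<one>"
  unfolding mpow_def by (rule finprod_one_eqI) auto

lemma mpow_cong:
  assumes "\<And>i. i \<in> W \<Longrightarrow> x i = y i" "\<And>i. i \<in> W \<Longrightarrow> \<alpha> i = \<beta> i" "y \<in> W \<rightarrow> carrier R"
  shows "mpow R W x \<alpha> = mpow R W y \<beta>"
  unfolding mpow_def using assms by (intro finprod_cong') auto

lemma mpow_insert:
  assumes "finite W" "i \<notin> W" "x \<in> insert i W \<rightarrow> carrier R"
  shows "mpow R (insert i W) x \<alpha> = x i [^] \<alpha> i \<otimes> mpow R W x \<alpha>"
  unfolding mpow_def using assms by (intro finprod_insert) auto

lemma mpow_subset: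
  assumes "finite W" "V \<subseteq> W" "x \<in> W \<rightarrow> carrier R" "\<And>i. i \<in> W - V \<Longrightarrow> \<alpha> i = 0"
  shows "mpow R W x \<alpha> = mpow R V x \<alpha>"
  unfolding mpow_def using assms by (intro finprod_mono_neutral_cong_right) auto

lemma mpow_single:
  assumes "finite W" "i \<in> W" "x \<in> W \<rightarrow> carrier R"
  shows "mpow R W x (\<lambda>j. if j = i then n else 0) = x i [^] n"
proof -
  have "mpow R W x (\<lambda>j. if j = i then n else 0) = mpow R {i} x (\<lambda>j. if j = i then n else 0)"
    using assms by (intro mpow_subset) auto
  also have "\<dots> = x i [^] n" using assms by (subst mpow_insert) (auto simp: mpow_def Pi_def)
  finally show ?thesis .
qed

end

text \<open>Bridge to the list polynomials of HOL-Algebra and their root count. The top coefficients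
  may vanish, so \<open>E\<close> bounds the degree without being equal to it.\<close>

lemma (in field) card_roots_le:
  fixes a :: "nat \<Rightarrow> 'a"
  assumes a: "a \<in> {..E} \<rightarrow> carrier R" and j0: "j0 \<le> E" "a j0 \<noteq> \<zero>"
  shows "finite {y \<in> carrier R. (\<Oplus>j\<in>{..E}. a j \<otimes> y [^] j) = \<zero>}"
    and "card {y \<in> carrier R. (\<Oplus>j\<in>{..E}. a j \<otimes> y [^] j) = \<zero>} \<le> E"
proof -
  \<comment> \<open>List polynomials start with the leading coefficient, hence
    \<open>rev\<close>.\<close>
  define p where "p n = map a (rev [0..<n])" for n
  have len: "length (p n) = n" for n by (simp add: p_def)
  have pS: "p (Suc n) = a n # p n" for n by (simp add: p_def)
  have ev: "eval (p (Suc n)) y = (\<Oplus>j\<in>{..n}. a j \<otimes> y [^] j)" if "n \<le> E" "y \<in> carrier R" for n y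
    using that
  proof (induction n)
    case 0
    then show ?case using a by (simp add: p_def Pi_def)
  next
    case (Suc n)
    have "eval (p (Suc (Suc n))) y = a (Suc n) \<otimes> y [^] (Suc n) \<oplus> eval (p (Suc n)) y"
      unfolding pS[of "Suc n"] by (simp add: len)
    also have "\<dots> = (\<Oplus>j\<in>{..Suc n}. a j \<otimes> y [^] j)"
      using Suc a by (subst finsum_Suc) (auto simp: Pi_def)
    finally show ?case .
  qed
  \<comment> \<open>\<open>normalize\<close> strips leading zeros; the nonzero \<open>a j0\<close>
    will keep the result from being empty.\<close>
  define q where "q = normalize (p (Suc E))"
  have setp: "set (p (Suc E)) \<subseteq> carrier R" using a by (auto simp: p_def)
  have q: "q \<in> carrier (poly_ring R)"
    unfolding q_def using normalize_gives_polynomial[OF setp] by (simp add: univ_poly_carrier)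
  have evq: "eval q y = (\<Oplus>j\<in>{..E}. a j \<otimes> y [^] j)" if "y \<in> carrier R" for y
    unfolding q_def using ev[OF order_refl that] eval_normalize[OF setp that] by simp
  have "q \<noteq> []"
  proof
    assume "q = []"
    then have "p (Suc E) = replicate (length (p (Suc E)) - length q) \<zero> @ []"
      unfolding q_def using normalize_trick[of "p (Suc E)"] by simp
    then have "set (p (Suc E)) \<subseteq> {\<zero>}" by (metis append_Nil2 set_replicate_conv_if empty_subsetI order_refl)
    moreover have "a j0 \<in> set (p (Suc E))" using j0 by (simp add: p_def) (metis atLeastLessThan_iff image_eqI le_neq_implies_less zero_le)
    ultimately show False using j0 by auto
  qed
  then have sub: "{y \<in> carrier R. (\<Oplus>j\<in>{..E}. a j \<otimes> y [^] j) = \<zero>} \<subseteq> set_mset (roots q)"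
    using roots_mem_iff_is_root[OF q] evq by (auto simp: is_root_def)
  then show "finite {y \<in> carrier R. (\<Oplus>j\<in>{..E}. a j \<otimes> y [^] j) = \<zero>}"
    using finite_subset by blast
  have "card {y \<in> carrier R. (\<Oplus>j\<in>{..E}. a j \<otimes> y [^] j) = \<zero>} \<le> card (set_mset (roots q))"
    using sub by (intro card_mono) auto
  also have "\<dots> \<le> size (roots q)" 
    by (metis size_multiset_overloaded_eq count_greater_eq_one_iff sum_mono card_eq_sum of_nat_id One_nat_def)
  also have "\<dots> \<le> degree q" using size_roots_le_degree[OF q] .
  also have "\<dots> \<le> E" unfolding q_def using normalize_length_le[of "p (Suc E)"] len[of "Suc E"] by simp
  finally show "card {y \<in> carrier R. (\<Oplus>j\<in>{..E}. a j \<otimes> y [^] j) = \<zero>} \<le> E" .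
qed

context scalars
begin

lemma bpol_closed [simp]:
  assumes "z \<in> W \<rightarrow> carrier A" "c \<in> box W E \<rightarrow> carrier L"
  shows "bpol A \<kappa> W z E c \<in> carrier A"
  using assms by (auto simp: bpol_def Pi_def intro!: finsum_closed)

text \<open>Reads the polynomial as univariate in the variable \<open>i\<close> with coefficients in
  the remaining ones: slice \<open>j\<close> of the box collects the terms with exponent
  \<open>j\<close> at \<open>i\<close>.\<close>

lemma bpol_insert:
  assumes W: "finite W" "i \<notin> W" and z: "z \<in> insert i W \<rightarrow> carrier A"
    and c: "c \<in> box (insert i W) E \<rightarrow> carrier L"
  shows "bpol A \<kappa> (insert i W) z E c =
    (\<Oplus>j\<in>{..E}. bpol A \<kappa> W z E (\<lambda>\<beta>. c (\<beta>(i := j))) \<otimes> z i [^] j)"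
proof -
  let ?u = "\<lambda>j \<beta>. \<beta>(i := j)" and ?f = "\<lambda>\<beta>. \<kappa> (c \<beta>) \<otimes> mpow A (insert i W) z \<beta>"
  have in_box: "\<And>j \<beta>. \<lbrakk>j \<le> E; \<beta> \<in> box W E\<rbrakk> \<Longrightarrow> c (?u j \<beta>) \<in> carrier L"
    using c W by (auto simp: box_insert)
  have fin: "finite (box W E)" using W by (simp add: finite_box)
  have inj: "inj_on (?u j) (box W E)" for j
  proof (rule inj_onI)
    fix \<beta> \<gamma> assume "\<beta> \<in> box W E" "\<gamma> \<in> box W E" "?u j \<beta> = ?u j \<gamma>"
    then show "\<beta> = \<gamma>" using W(2) by (auto simp: box_iff fun_eq_iff split: if_splits) metis
  qed
  have zi: "z i \<in> carrier A" and zW: "z \<in> W \<rightarrow> carrier A" using z by auto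
  have "bpol A \<kappa> (insert i W) z E c = (\<Oplus>\<beta>\<in>(\<Union>j\<in>{..E}. ?u j ` box W E). ?f \<beta>)"
    by (simp add: bpol_def box_insert W)
  also have "\<dots> = (\<Oplus>j\<in>{..E}. finsum A ?f (?u j ` box W E))"
  proof (rule add.finprod_UN_disjoint)
    show "pairwise (\<lambda>j j'. disjnt (?u j ` box W E) (?u j' ` box W E)) {..E}"
      by (auto simp: pairwise_def disjnt_def) (metis fun_upd_same)
    show "\<kappa> (c \<beta>) \<otimes> mpow A (insert i W) z \<beta> \<in> carrier A"
      if "j \<in> {..E}" "\<beta> \<in> ?u j ` box W E" for j \<beta>
      using that in_box z by auto
  qed (use fin in auto)
  also have "\<dots> = (\<Oplus>j\<in>{..E}. bpol A \<kappa> W z E (\<lambda>\<beta>. c (?u j \<beta>)) \<otimes> z i [^] j)"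
  proof (rule finsum_cong')
    show "(\<lambda>j. bpol A \<kappa> W z E (\<lambda>\<beta>. c (?u j \<beta>)) \<otimes> z i [^] j) \<in> {..E} \<rightarrow> carrier A"
      using in_box zi zW by auto
    fix j assume j: "j \<in> {..E}"
    have m: "mpow A (insert i W) z (?u j \<beta>) = mpow A W z \<beta> \<otimes> z i [^] j" for \<beta>
    proof -
      have "mpow A (insert i W) z (?u j \<beta>) = z i [^] j \<otimes> mpow A W z (?u j \<beta>)"
        using mpow_insert[OF W z, of "?u j \<beta>"] by simp
      also have "mpow A W z (?u j \<beta>) = mpow A W z \<beta>" using W zW by (intro mpow_cong) auto
      finally show ?thesis using zi zW by (simp add: m_comm fun_upd_def)
    qed
    have "finsum A ?f (?u j ` box W E) = (\<Oplus>\<beta>\<in>box W E. ?f (?u j \<beta>))"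
      using j in_box z inj by (intro finsum_reindex) auto
    also have "\<dots> = (\<Oplus>\<beta>\<in>box W E. \<kappa> (c (?u j \<beta>)) \<otimes> mpow A W z \<beta> \<otimes> z i [^] j)"
      using j in_box zi zW by (intro finsum_cong') (auto simp: m m_assoc)
    also have "\<dots> = bpol A \<kappa> W z E (\<lambda>\<beta>. c (?u j \<beta>)) \<otimes> z i [^] j"
      unfolding bpol_def using j in_box zi zW fin by (intro finsum_ldistr[symmetric]) auto
    finally show "finsum A ?f (?u j ` box W E) = bpol A \<kappa> W z E (\<lambda>\<beta>. c (?u j \<beta>)) \<otimes> z i [^] j" .
  qed auto
  finally show ?thesis .
qed

lemma bpol_cong:
  assumes "\<And>i. i \<in> W \<Longrightarrow> z i = y i" "y \<in> W \<rightarrow> carrier A" "\<And>\<beta>. \<beta> \<in> box W E \<Longrightarrow> c \<beta> = c' \<beta>"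
    "c' \<in> box W E \<rightarrow> carrier L"
  shows "bpol A \<kappa> W z E c = bpol A \<kappa> W y E c'"
  unfolding bpol_def using assms mpow_cong[of W z y _ ]
  by (intro finsum_cong') (auto simp: Pi_def)

lemma sp_mpow:
  assumes "x \<in> W \<rightarrow> carrier A" "p \<in> P"
  shows "mpow A W x p \<in> sp (mpow A W x ` P)"
  using assms by (intro sp_base mpow_image imageI)

lemma sp_mpow_mult:
  assumes x: "x \<in> W \<rightarrow> carrier A" and F: "F \<in> sp (mpow A W x ` P)" and G: "G \<in> sp (mpow A W x ` Q)"
    and PQ: "\<And>p q. \<lbrakk>p \<in> P; q \<in> Q\<rbrakk> \<Longrightarrow> (\<lambda>i. p i + q i) \<in> S"
  shows "F \<otimes> G \<in> sp (mpow A W x ` S)"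
proof (rule sp_mult[OF _ _ _ _ F G])
  fix g h assume "g \<in> mpow A W x ` P" "h \<in> mpow A W x ` Q"
  then obtain p q where "p \<in> P" "q \<in> Q" "g = mpow A W x p" "h = mpow A W x q" by auto
  then show "g \<otimes> h \<in> sp (mpow A W x ` S)"
    using sp_mpow[OF x PQ[of p q]] mpow_add[OF x, of p q] by simp
qed (use x in auto)

text \<open>\<open>P\<close> is a filtration of exponent vectors compatible with addition. It is
  instantiated by boxes, by bounded total degree, by order at least \<open>n\<close> at a point, and
  by the constant family of all exponents, so that degree bounds and vanishing orders share one
  proof.\<close>

lemma sp_mpow_power_products:
  assumes x: "x \<in> W \<rightarrow> carrier A" and P0: "(\<lambda>_. 0) \<in> P 0"
    and PP: "\<And>m n p q. \<lbrakk>p \<in> P m; q \<in> P n\<rbrakk> \<Longrightarrow> (\<lambda>i. p i + q i) \<in> P (m + n)"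
    and V: "finite V" and z: "\<And>i. i \<in> V \<Longrightarrow> z i \<in> sp (mpow A W x ` P (e i))"
  shows "mpow A V z \<beta> \<in> sp (mpow A W x ` P (\<Sum>i\<in>V. \<beta> i * e i))"
proof -
  have one: "\<one> \<in> sp (mpow A W x ` P 0)"
    using sp_mpow[OF x P0] x mpow_zero[of W "\<lambda>_. 0" x] by simp
  have car: "mpow A W x ` Q \<subseteq> carrier A" for Q using x by auto
  have zc: "z i \<in> carrier A" if "i \<in> V" for i using z[OF that] sp_closed[OF car] by auto
  have pow: "z i [^] n \<in> sp (mpow A W x ` P (n * e i))" if "i \<in> V" for i and n :: nat
  proof (induction n)
    case (Suc n)
    then have "z i [^] n \<otimes> z i \<in> sp (mpow A W x ` P (n * e i + e i))"
      using z[OF that] by (rule sp_mpow_mult[OF x]) (rule PP)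
    then show ?case using zc[OF that] by (simp add: add.commute)
  qed (use one in simp)
  from V zc pow show ?thesis
  proof (induction V)
    case empty
    then show ?case using one by (simp add: mpow_def)
  next
    case (insert i V)
    have "z i [^] \<beta> i \<otimes> mpow A V z \<beta> \<in> sp (mpow A W x ` P (\<beta> i * e i + (\<Sum>i\<in>V. \<beta> i * e i)))"
      using insert by (intro sp_mpow_mult[OF x _ _ PP]) auto
    then show ?case using insert by (subst mpow_insert) auto
  qed
qed

text \<open>Pigeonhole by dimension: the \<open>(E + 1) ^ card V\<close> power products of the
  \<open>z i\<close> lie in the span of the monomials with exponents at most
  \<open>card V * E * \<delta>\<close>, and the last hypothesis says that there are fewer of those.
  For \<open>card V > card W\<close> it holds once \<open>E\<close> is large.\<close>

lemma algebraic_dependence: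
  assumes x: "x \<in> W \<rightarrow> carrier A" and W: "finite W" and V: "finite V"
    and z: "\<And>i. i \<in> V \<Longrightarrow> z i \<in> sp (mpow A W x ` box W \<delta>)"
    and E: "(card V * E * \<delta> + 1) ^ card W < (E + 1) ^ card V"
  shows "\<exists>c. c \<in> box V E \<rightarrow> carrier L \<and> (\<exists>\<beta>\<in>box V E. c \<beta> \<noteq> \<zero>\<^bsub>L\<^esub>) \<and> bpol A \<kappa> V z E c = \<zero>"
proof -
  let ?J = "mpow A W x ` box W (card V * E * \<delta>)"
  have J: "?J \<subseteq> carrier A" using x by auto
  have "card ?J \<le> (card V * E * \<delta> + 1) ^ card W"
    using card_image_le[OF finite_box[OF W]] by (metis card_box[OF W])
  then have card: "card ?J < card (box V E)" using E by (simp add: card_box V)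
  have "mpow A V z \<beta> \<in> sp (?J \<union> {})" if "\<beta> \<in> box V E" for \<beta>
  proof -
    have "mpow A V z \<beta> \<in> sp (mpow A W x ` box W (\<Sum>i\<in>V. \<beta> i * \<delta>))"
      using x V z
      by (intro sp_mpow_power_products[where P = "box W" and e = "\<lambda>_. \<delta>"]) (auto simp: box_iff intro: add_mono)
    moreover have "(\<Sum>i\<in>V. \<beta> i * \<delta>) \<le> (\<Sum>i\<in>V. E * \<delta>)"
      using that by (intro sum_mono) (auto simp: box_iff)
    then have "box W (\<Sum>i\<in>V. \<beta> i * \<delta>) \<subseteq> box W (card V * E * \<delta>)" by (intro box_mono) simp
    ultimately show ?thesis using sp_mono[of "mpow A W x ` box W (\<Sum>i\<in>V. \<beta> i * \<delta>)" ?J] by auto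
  qed
  then obtain c where c: "c \<in> box V E \<rightarrow> carrier L" "\<exists>b\<in>box V E. c b \<noteq> \<zero>\<^bsub>L\<^esub>"
     "(\<Oplus>b\<in>box V E. \<kappa> (c b) \<otimes> mpow A V z b) \<in> sp {}"
    using exists_dependence[of "{}" ?J "box V E" "mpow A V z"] J card finite_box[OF W] finite_box[OF V]
    by auto
  have "F = \<zero>" if "F \<in> sp {}" for F using that by induction auto
  then show ?thesis using c by (auto simp: bpol_def)
qed

end

section \<open>Zeros on grids and rings of functions\<close>

lemma (in field) scalars_id: "scalars R R id"
  by (intro scalars.intro ring_hom_cring.intro ring_hom_cring_axioms.intro)
     (auto intro: field_axioms cring_axioms)

text \<open>Schwartz-Zippel on a grid whose sides may differ in length but all have at least
  \<open>M\<close> elements: the proportion of zeros is at most \<open>card W * E / M\<close>,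
  written without division. The degree is bounded per variable, so each variable contributes
  \<open>E\<close>.\<close>

lemma (in field) card_bpol_zeros:
  assumes "finite W" "c \<in> box W E \<rightarrow> carrier R" "\<exists>\<beta>\<in>box W E. c \<beta> \<noteq> \<zero>"
    and "\<And>i. i \<in> W \<Longrightarrow> finite (S i) \<and> S i \<subseteq> carrier R \<and> M \<le> card (S i)"
  shows "card {z \<in> PiE W S. bpol R id W z E c = \<zero>} * M \<le> card W * E * (\<Prod>i\<in>W. card (S i))"
  using assms
proof (induction W arbitrary: c rule: finite_induct)
  case empty
  have "box {} E = {\<lambda>_. 0}" by (auto simp: box_iff)
  then have "bpol R id {} z E c \<noteq> \<zero>" for z
    using empty by (auto simp: bpol_def mpow_def Pi_def)
  then have "{z \<in> PiE {} S. bpol R id {} z E c = \<zero>} = {}" by blast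
  then show ?case by (simp only: card.empty)
next
  case (insert i W)
  interpret s: scalars R R id by (rule scalars_id)
  obtain \<beta>0 where b0: "\<beta>0 \<in> box (insert i W) E" "c \<beta>0 \<noteq> \<zero>" using insert by auto
  define cj where "cj j \<beta> = c (\<beta>(i := j))" for j \<beta>
  \<comment> \<open>A slice with a nonzero coefficient. It takes the place of the leading
    coefficient: any nonzero slice is enough for the root bound.\<close>
  define j0 where "j0 = \<beta>0 i"
  have j0: "j0 \<le> E" using b0 by (auto simp: j0_def box_iff)
  have cj: "cj j \<in> box W E \<rightarrow> carrier R" if "j \<le> E" for j
    unfolding cj_def
    using that insert(2) by (intro funcsetI funcset_mem[OF insert.prems(1)]) (auto simp: box_iff)
  have "\<beta>0(i := 0) \<in> box W E" using b0 insert(2) by (auto simp: box_iff)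
  moreover have "cj j0 (\<beta>0(i := 0)) \<noteq> \<zero>" using b0 by (simp add: cj_def j0_def)
  ultimately have nz: "\<exists>\<beta>\<in>box W E. cj j0 \<beta> \<noteq> \<zero>" by blast
  define Z0 where "Z0 = {z \<in> PiE W S. bpol R id W z E (cj j0) = \<zero>}"
  have IH: "card Z0 * M \<le> card W * E * (\<Prod>i\<in>W. card (S i))"
    unfolding Z0_def using insert.prems cj[OF j0] nz by (intro insert.IH) auto
  define rt where "rt z = {y \<in> S i. (\<Oplus>j\<in>{..E}. bpol R id W z E (cj j) \<otimes> y [^] j) = \<zero>}" for z
  define Z where "Z = {z \<in> PiE (insert i W) S. bpol R id (insert i W) z E c = \<zero>}"
  have finW: "finite (PiE W S)" using insert by (intro finite_PiE) auto
  have Si: "finite (S i)" "S i \<subseteq> carrier R" "M \<le> card (S i)" using insert by auto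
  have rt: "card (rt z) \<le> E" if "z \<in> PiE W S - Z0" for z
  proof -
    have z: "z \<in> W \<rightarrow> carrier R" using that insert.prems by auto
    have "rt z \<subseteq> {y \<in> carrier R. (\<Oplus>j\<in>{..E}. bpol R id W z E (cj j) \<otimes> y [^] j) = \<zero>}"
      using Si by (auto simp: rt_def)
    moreover have *: "(\<lambda>j. bpol R id W z E (cj j)) \<in> {..E} \<rightarrow> carrier R"
      using z cj by auto
    moreover have "bpol R id W z E (cj j0) \<noteq> \<zero>" using that by (auto simp: Z0_def)
    ultimately show ?thesis
      using card_roots_le[OF * j0] by (meson card_mono order_trans)
  qed
  have fr: "finite (rt z)" for z using Si by (auto simp: rt_def)
  have fZ0: "finite Z0" using finW by (auto simp: Z0_def)
  define T where "T = S i \<times> Z0 \<union> (\<lambda>(z, y). (y, z)) ` Sigma (PiE W S - Z0) rt"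
  have "Z \<subseteq> (\<lambda>(y, z). z(i := y)) ` T"
  proof
    fix z assume "z \<in> Z"
    then have z: "z \<in> PiE (insert i W) S" "bpol R id (insert i W) z E c = \<zero>" by (auto simp: Z_def)
    then obtain y z' where yz: "y \<in> S i" "z' \<in> PiE W S" "z = z'(i := y)"
      by (auto simp: PiE_insert_eq)
    have zc: "z \<in> insert i W \<rightarrow> carrier R" using z insert.prems by auto
    have z'c: "z' \<in> W \<rightarrow> carrier R" using yz insert.prems by auto
    have "\<zero> = (\<Oplus>j\<in>{..E}. bpol R id W z E (cj j) \<otimes> z i [^] j)"
      using s.bpol_insert[OF insert(1,2) zc insert.prems(1)] z unfolding cj_def by (simp add: fun_upd_def)
    also have "\<dots> = (\<Oplus>j\<in>{..E}. bpol R id W z' E (cj j) \<otimes> y [^] j)"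
    proof (rule finsum_cong')
      show "(\<lambda>j. bpol R id W z' E (cj j) \<otimes> y [^] j) \<in> {..E} \<rightarrow> carrier R"
        using z'c cj yz Si by auto
      fix j assume j: "j \<in> {..E}"
      have "bpol R id W z E (cj j) = bpol R id W z' E (cj j)"
        using yz insert(2) z'c cj[of j] j by (intro s.bpol_cong) auto
      then show "bpol R id W z E (cj j) \<otimes> z i [^] j = bpol R id W z' E (cj j) \<otimes> y [^] j"
        using yz by simp
    qed simp
    finally have "y \<in> rt z'" using yz by (simp add: rt_def)
    then have "(y, z') \<in> T" using yz by (cases "z' \<in> Z0") (auto simp: T_def image_iff)
    then show "z \<in> (\<lambda>(y, z). z(i := y)) ` T" using yz by force
  qed
  moreover have finT: "finite T" unfolding T_def using Si fZ0 finW fr by auto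
  ultimately have "card Z \<le> card T" by (meson surj_card_le)
  also have "\<dots> \<le> card (S i \<times> Z0) + card ((\<lambda>(z, y). (y, z)) ` Sigma (PiE W S - Z0) rt)"
    unfolding T_def by (rule card_Un_le)
  also have "card ((\<lambda>(z, y). (y, z)) ` Sigma (PiE W S - Z0) rt) \<le> card (Sigma (PiE W S - Z0) rt)"
    using finW fr by (intro card_image_le) auto
  also have "\<dots> = (\<Sum>z\<in>PiE W S - Z0. card (rt z))" using finW fr by (intro card_SigmaI) auto
  also have "\<dots> \<le> (\<Sum>z\<in>PiE W S - Z0. E)" using rt by (intro sum_mono) auto
  also have "\<dots> \<le> card (PiE W S) * E" using finW by (auto intro!: card_mono)
  also have "card (PiE W S) = (\<Prod>i\<in>W. card (S i))" using insert(1) by (rule card_PiE)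
  finally have le: "card Z \<le> card (S i) * card Z0 + (\<Prod>i\<in>W. card (S i)) * E"
    by (simp add: card_cartesian_product)
  have "card Z * M \<le> (card (S i) * card Z0 + (\<Prod>i\<in>W. card (S i)) * E) * M"
    using le by simp
  also have "\<dots> = card (S i) * (card Z0 * M) + (\<Prod>i\<in>W. card (S i)) * E * M"
    by (simp add: algebra_simps)
  also have "\<dots> \<le> card (S i) * (card W * E * (\<Prod>i\<in>W. card (S i))) + (\<Prod>i\<in>W. card (S i)) * E * card (S i)"
    using mult_le_mono2[OF IH, of "card (S i)"] mult_le_mono2[OF Si(3), of "(\<Prod>i\<in>W. card (S i)) * E"] by linarith
  also have "\<dots> = card (insert i W) * E * (\<Prod>i\<in>insert i W. card (S i))"
    using insert(1,2) by (simp add: algebra_simps)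
  finally show ?case unfolding Z_def .
qed

text \<open>Sides with \<open>card W * E + 1\<close> elements make the Schwartz-Zippel bound smaller
  than the whole grid.\<close>

lemma (in field) exists_nonzero_point:
  assumes W: "finite W" and c: "c \<in> box W E \<rightarrow> carrier R" "\<exists>\<beta>\<in>box W E. c \<beta> \<noteq> \<zero>"
    and T: "\<And>i. i \<in> W \<Longrightarrow> infinite (T i) \<and> T i \<subseteq> carrier R"
  shows "\<exists>z\<in>PiE W T. bpol R id W z E c \<noteq> \<zero>"
proof (rule ccontr)
  assume neg: "\<not> ?thesis"
  have "\<exists>S\<subseteq>T i. finite S \<and> card S = card W * E + 1" if "i \<in> W" for i
    using T[OF that] by (metis infinite_arbitrarily_large)
  then obtain S where S: "\<And>i. i \<in> W \<Longrightarrow> S i \<subseteq> T i \<and> finite (S i) \<and> card (S i) = card W * E + 1"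
    by metis
  have "{z \<in> PiE W S. bpol R id W z E c = \<zero>} = PiE W S"
    using neg S PiE_mono[of W S T] by blast
  then have "card (PiE W S) * (card W * E + 1) \<le> card W * E * (\<Prod>i\<in>W. card (S i))"
    using card_bpol_zeros[OF W c, of S "card W * E + 1"] S T by force
  moreover have "card (PiE W S) = (\<Prod>i\<in>W. card (S i))" using W by (rule card_PiE)
  moreover have "(\<Prod>i\<in>W. card (S i)) > 0" using S by (intro prod_pos) auto
  ultimately show False by simp
qed

section \<open>Rings of functions\<close>

definition fun_ring :: "('b, 'm) ring_scheme \<Rightarrow> 'x set \<Rightarrow> ('x \<Rightarrow> 'b) ring" where
  "fun_ring L D = \<lparr>carrier = D \<rightarrow>\<^sub>E carrier L,
     monoid.mult = (\<lambda>f g. \<lambda>x\<in>D. f x \<otimes>\<^bsub>L\<^esub> g x), one = (\<lambda>x\<in>D. \<one>\<^bsub>L\<^esub>),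
     zero = (\<lambda>x\<in>D. \<zero>\<^bsub>L\<^esub>), add = (\<lambda>f g. \<lambda>x\<in>D. f x \<oplus>\<^bsub>L\<^esub> g x)\<rparr>"

lemma fun_ring_simps:
  "carrier (fun_ring L D) = D \<rightarrow>\<^sub>E carrier L"
  "f \<otimes>\<^bsub>fun_ring L D\<^esub> g = (\<lambda>x\<in>D. f x \<otimes>\<^bsub>L\<^esub> g x)"
  "f \<oplus>\<^bsub>fun_ring L D\<^esub> g = (\<lambda>x\<in>D. f x \<oplus>\<^bsub>L\<^esub> g x)"
  "\<one>\<^bsub>fun_ring L D\<^esub> = (\<lambda>x\<in>D. \<one>\<^bsub>L\<^esub>)" "\<zero>\<^bsub>fun_ring L D\<^esub> = (\<lambda>x\<in>D. \<zero>\<^bsub>L\<^esub>)"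
  by (simp_all add: fun_ring_def)

lemma (in cring) cring_fun_ring: "cring (fun_ring R D)"
proof (rule cringI)
  have "\<exists>g\<in>D \<rightarrow>\<^sub>E carrier R. (\<lambda>x\<in>D. g x \<oplus> f x) = (\<lambda>x\<in>D. \<zero>)" if "f \<in> D \<rightarrow>\<^sub>E carrier R" for f
    using that by (intro bexI[of _ "\<lambda>x\<in>D. \<ominus> f x"]) (auto intro!: restrict_ext l_neg dest: PiE_mem)
  then show "abelian_group (fun_ring R D)"
    by (intro abelian_groupI)
       (auto simp: fun_ring_simps PiE_iff extensional_def a_ac fun_eq_iff)
  show "comm_monoid (fun_ring R D)"
    by (intro comm_monoidI) (auto simp: fun_ring_simps PiE_iff extensional_def m_ac fun_eq_iff)
  show "(x \<oplus>\<^bsub>fun_ring R D\<^esub> y) \<otimes>\<^bsub>fun_ring R D\<^esub> z =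
      x \<otimes>\<^bsub>fun_ring R D\<^esub> z \<oplus>\<^bsub>fun_ring R D\<^esub> y \<otimes>\<^bsub>fun_ring R D\<^esub> z"
    if "x \<in> carrier (fun_ring R D)" "y \<in> carrier (fun_ring R D)" "z \<in> carrier (fun_ring R D)" for x y z
    using that by (auto simp: fun_ring_simps PiE_iff l_distr fun_eq_iff)
qed

definition cst :: "'x set \<Rightarrow> 'b \<Rightarrow> 'x \<Rightarrow> 'b" where
  "cst D c = (\<lambda>x\<in>D. c)"

lemma (in field) scalars_fun_ring: "scalars R (fun_ring R D) (cst D)"
proof (intro scalars.intro ring_hom_cring.intro ring_hom_cring_axioms.intro)
  show "cst D \<in> ring_hom R (fun_ring R D)"
    by (intro ring_hom_memI) (auto simp: fun_ring_simps cst_def fun_eq_iff)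
qed (auto intro: field_axioms cring_axioms cring_fun_ring)

lemma (in cring) eval_hom:
  assumes "x \<in> D"
  shows "ring_hom_cring (fun_ring R D) R (\<lambda>F. F x)"
proof (intro ring_hom_cring.intro ring_hom_cring_axioms.intro)
  show "(\<lambda>F. F x) \<in> ring_hom (fun_ring R D) R"
    using assms by (intro ring_hom_memI) (auto simp: fun_ring_simps)
qed (auto intro: cring_axioms cring_fun_ring)

lemma (in ring_hom_cring) hom_mpow:
  assumes "x \<in> W \<rightarrow> carrier R"
  shows "h (mpow R W x \<alpha>) = mpow S W (\<lambda>i. h (x i)) \<alpha>"
proof -
  have "h (mpow R W x \<alpha>) = finprod S (h \<circ> (\<lambda>i. x i [^] \<alpha> i)) W"
    unfolding mpow_def using assms by (intro hom_finprod) auto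
  also have "\<dots> = mpow S W (\<lambda>i. h (x i)) \<alpha>"
    unfolding mpow_def using assms by (intro S.finprod_cong') (auto simp: Pi_def)
  finally show ?thesis .
qed

lemma (in field) eval_bpol:
  assumes z: "z \<in> W \<rightarrow> carrier (fun_ring R D)" and c: "c \<in> box W E \<rightarrow> carrier R" and x: "x \<in> D"
  shows "bpol (fun_ring R D) (cst D) W z E c x = bpol R id W (\<lambda>i. z i x) E c"
proof -
  interpret h: ring_hom_cring "fun_ring R D" R "\<lambda>F. F x" using x by (rule eval_hom)
  interpret s: scalars R "fun_ring R D" "cst D" by (rule scalars_fun_ring)
  have "(\<lambda>\<beta>. cst D (c \<beta>) \<otimes>\<^bsub>fun_ring R D\<^esub> mpow (fun_ring R D) W z \<beta>) \<in> box W E \<rightarrow> carrier (fun_ring R D)"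
    using z c by (auto simp: Pi_def)
  then have "bpol (fun_ring R D) (cst D) W z E c x =
     (\<Oplus>\<beta>\<in>box W E. ((\<lambda>F. F x) \<circ> (\<lambda>\<beta>. cst D (c \<beta>) \<otimes>\<^bsub>fun_ring R D\<^esub> mpow (fun_ring R D) W z \<beta>)) \<beta>)"
    unfolding bpol_def by (rule h.hom_finsum)
  also have "\<dots> = bpol R id W (\<lambda>i. z i x) E c"
    unfolding bpol_def
  proof (rule finsum_cong')
    have zx: "(\<lambda>i. z i x) \<in> W \<rightarrow> carrier R" using z x by (auto simp: fun_ring_simps PiE_iff)
    then show "(\<lambda>\<beta>. id (c \<beta>) \<otimes> mpow R W (\<lambda>i. z i x) \<beta>) \<in> box W E \<rightarrow> carrier R"
      using c by auto
    fix \<beta> assume "\<beta> \<in> box W E"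
    then have "c \<beta> \<in> carrier R" using c by auto
    then show "((\<lambda>F. F x) \<circ> (\<lambda>\<beta>. cst D (c \<beta>) \<otimes>\<^bsub>fun_ring R D\<^esub> mpow (fun_ring R D) W z \<beta>)) \<beta> =
        id (c \<beta>) \<otimes> mpow R W (\<lambda>i. z i x) \<beta>"
      using z x h.hom_mpow[OF z, of \<beta>] by (simp add: fun_ring_simps cst_def)
  qed simp
  finally show ?thesis .
qed

text \<open>In a field with \<open>n\<close> elements every \<open>a\<close> satisfies
  \<open>a^n = a\<close>, so \<open>X^n - X + 1\<close> has no root there.\<close>

lemma (in algebraically_closed) infinite_carrier: "infinite (carrier L)"
proof
  assume fin: "finite (carrier L)"
  define n where "n = card (carrier L)"
  have "card {\<zero>, \<one>} \<le> n" unfolding n_def using fin by (intro card_mono) auto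
  then have n2: "n \<ge> 2" by simp
  have pow: "a [^] n = a" if a: "a \<in> carrier L" for a
  proof (cases "a = \<zero>")
    case True
    then show ?thesis using n2 by (simp add: nat_pow_zero)
  next
    case False
    then have "a \<in> Units L" using a field_Units by auto
    moreover have "card (Units L) = n - 1" unfolding field_Units n_def using fin by simp
    ultimately have "a [^] (n - 1) = \<one>" using units_power_order_eq_one[of a] fin field_Units by simp
    then have "a [^] (Suc (n - 1)) = a" using a by simp
    then show ?thesis using n2 by simp
  qed
  define p where "p = \<one> # replicate (n - 2) \<zero> @ [\<ominus> \<one>, \<one>]"
  have "p \<in> carrier (poly_ring L)"
    by (auto simp: p_def univ_poly_carrier[symmetric] polynomial_def)
  then have sz: "size (roots p) = degree p" using roots_over_carrier unfolding splitted_def by blast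
  have deg: "degree p = n" using n2 by (simp add: p_def)
  then have "roots p \<noteq> {#}" using sz n2 by auto
  then obtain a where "a \<in># roots p" by blast
  then have a: "a \<in> carrier L" "eval p a = \<zero>"
    using roots_mem_iff_is_root[OF \<open>p \<in> carrier (poly_ring L)\<close>] by (auto simp: is_root_def)
  have "eval p a = \<one> \<otimes> a [^] n \<oplus> eval (replicate (n - 2) \<zero> @ [\<ominus> \<one>, \<one>]) a"
    using deg unfolding p_def by simp
  also have "\<dots> = a \<oplus> (\<ominus> a \<oplus> \<one>)"
    using a pow[OF a(1)] by (subst eval_replicate) (auto simp: l_minus)
  also have "\<dots> = \<one>" using a by algebra
  finally show False using a by simp
qed

definition crd :: "(nat \<Rightarrow> 'b) set \<Rightarrow> nat \<Rightarrow> (nat \<Rightarrow> 'b) \<Rightarrow> 'b" where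
  "crd D i = (\<lambda>x\<in>D. x i)"

lemma crd_closed: "i < k \<Longrightarrow> crd (aff L k) i \<in> carrier (fun_ring L (aff L k))"
  by (auto simp: crd_def fun_ring_simps aff_def)

section \<open>Congruences modulo an ideal\<close>

context scalars
begin

text \<open>\<open>sp M\<close> is a subalgebra and \<open>sp G\<close> is closed under
  multiplication by it; both are known through their generators only. The induction rests on
  \<open>a^(n+1) - b^(n+1) = a (a^n - b^n) + b^n (a - b)\<close>.\<close>

lemma pow_cong:
  assumes M: "M \<subseteq> carrier A" "\<one> \<in> sp M" "\<And>g h. \<lbrakk>g \<in> M; h \<in> M\<rbrakk> \<Longrightarrow> g \<otimes> h \<in> sp M"
    and G: "G \<subseteq> carrier A" "\<And>m g. \<lbrakk>m \<in> M; g \<in> G\<rbrakk> \<Longrightarrow> m \<otimes> g \<in> sp G"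
    and ab: "a \<in> sp M" "b \<in> sp M" "a \<ominus> b \<in> sp G"
  shows "a [^] n \<in> sp M" "b [^] n \<in> sp M" "a [^] (n::nat) \<ominus> b [^] n \<in> sp G"
proof -
  have car: "a \<in> carrier A" "b \<in> carrier A" using ab M sp_closed by auto
  have MM: "\<And>u v. \<lbrakk>u \<in> sp M; v \<in> sp M\<rbrakk> \<Longrightarrow> u \<otimes> v \<in> sp M"
    using sp_mult[OF M(1) M(1) M(1) M(3)] by blast
  have MG: "\<And>u v. \<lbrakk>u \<in> sp M; v \<in> sp G\<rbrakk> \<Longrightarrow> u \<otimes> v \<in> sp G"
    using sp_mult[OF G(1) M(1) G(1) G(2)] by blast
  have *: "a [^] n \<in> sp M \<and> b [^] n \<in> sp M \<and> a [^] n \<ominus> b [^] n \<in> sp G" for n :: nat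
  proof (induction n)
    case 0
    then show ?case using M by (simp add: sp_zero a_minus_def r_neg)
  next
    case (Suc n)
    have "a [^] Suc n \<ominus> b [^] Suc n = a \<otimes> (a [^] n \<ominus> b [^] n) \<oplus> b [^] n \<otimes> (a \<ominus> b)"
    proof -
      have c: "a [^] n \<in> carrier A" "b [^] n \<in> carrier A" using car by auto
      have "a [^] n \<otimes> a \<ominus> b [^] n \<otimes> b = a \<otimes> (a [^] n \<ominus> b [^] n) \<oplus> b [^] n \<otimes> (a \<ominus> b)"
        using c car by algebra
      then show ?thesis by simp
    qed
    then show ?case using Suc MM MG ab G by (auto intro!: sp_add)
  qed
  then show "a [^] n \<in> sp M" "b [^] n \<in> sp M" "a [^] n \<ominus> b [^] n \<in> sp G" by auto
qed

lemma mpow_cong_mod: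
  assumes M: "M \<subseteq> carrier A" "\<one> \<in> sp M" "\<And>g h. \<lbrakk>g \<in> M; h \<in> M\<rbrakk> \<Longrightarrow> g \<otimes> h \<in> sp M"
    and G: "G \<subseteq> carrier A" "\<And>m g. \<lbrakk>m \<in> M; g \<in> G\<rbrakk> \<Longrightarrow> m \<otimes> g \<in> sp G"
    and V: "finite V"
    and ab: "\<And>i. i \<in> V \<Longrightarrow> a i \<in> sp M \<and> b i \<in> sp M \<and> a i \<ominus> b i \<in> sp G"
  shows "mpow A V a \<beta> \<in> sp M \<and> mpow A V b \<beta> \<in> sp M \<and> mpow A V a \<beta> \<ominus> mpow A V b \<beta> \<in> sp G"
  using V ab
proof (induction V rule: finite_induct)
  case empty
  then show ?case using M by (simp add: mpow_def sp_zero a_minus_def r_neg)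
next
  case (insert i V)
  have MM: "\<And>u v. \<lbrakk>u \<in> sp M; v \<in> sp M\<rbrakk> \<Longrightarrow> u \<otimes> v \<in> sp M"
    using sp_mult[OF M(1) M(1) M(1) M(3)] by blast
  have MG: "\<And>u v. \<lbrakk>u \<in> sp M; v \<in> sp G\<rbrakk> \<Longrightarrow> u \<otimes> v \<in> sp G"
    using sp_mult[OF G(1) M(1) G(1) G(2)] by blast
  have p: "a i [^] \<beta> i \<in> sp M" "b i [^] \<beta> i \<in> sp M" "a i [^] \<beta> i \<ominus> b i [^] \<beta> i \<in> sp G"
    using pow_cong[OF M G, of "a i" "b i" "\<beta> i"] insert.prems by auto
  have q: "mpow A V a \<beta> \<in> sp M" "mpow A V b \<beta> \<in> sp M" "mpow A V a \<beta> \<ominus> mpow A V b \<beta> \<in> sp G"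
    using insert by auto
  have car: "a i [^] \<beta> i \<in> carrier A" "b i [^] \<beta> i \<in> carrier A"
    "mpow A V a \<beta> \<in> carrier A" "mpow A V b \<beta> \<in> carrier A"
    using p q M sp_closed by auto
  have abc: "a \<in> insert i V \<rightarrow> carrier A" "b \<in> insert i V \<rightarrow> carrier A"
    using insert.prems M sp_closed by auto
  have "a i [^] \<beta> i \<otimes> mpow A V a \<beta> \<ominus> b i [^] \<beta> i \<otimes> mpow A V b \<beta> =
     a i [^] \<beta> i \<otimes> (mpow A V a \<beta> \<ominus> mpow A V b \<beta>) \<oplus> mpow A V b \<beta> \<otimes> (a i [^] \<beta> i \<ominus> b i [^] \<beta> i)"
    using car by algebra
  then show ?case using p q MM MG G insert(1,2) abc by (auto simp: mpow_insert intro!: sp_add)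
qed

text \<open>Polynomials respect congruences of their arguments. Applied to the ideal of the shifted
  system, this is what places \<open>Q (- a (x), X_S)\<close> in that ideal.\<close>

lemma bpol_cong_mod:
  assumes M: "M \<subseteq> carrier A" "\<one> \<in> sp M" "\<And>g h. \<lbrakk>g \<in> M; h \<in> M\<rbrakk> \<Longrightarrow> g \<otimes> h \<in> sp M"
    and G: "G \<subseteq> carrier A" "\<And>m g. \<lbrakk>m \<in> M; g \<in> G\<rbrakk> \<Longrightarrow> m \<otimes> g \<in> sp G"
    and V: "finite V" and c: "c \<in> box V E \<rightarrow> carrier L"
    and ab: "\<And>i. i \<in> V \<Longrightarrow> a i \<in> sp M \<and> b i \<in> sp M \<and> a i \<ominus> b i \<in> sp G"
  shows "bpol A \<kappa> V a E c \<ominus> bpol A \<kappa> V b E c \<in> sp G"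
proof -
  have car: "a \<in> V \<rightarrow> carrier A" "b \<in> V \<rightarrow> carrier A" using ab M sp_closed by auto
  have cc: "\<And>\<beta>. \<beta> \<in> box V E \<Longrightarrow> c \<beta> \<in> carrier L" using c by auto
  have eq: "x \<otimes> u = x \<otimes> v \<oplus> x \<otimes> (u \<ominus> v)" if "x \<in> carrier A" "u \<in> carrier A" "v \<in> carrier A" for x u v
    using that by algebra
  have "bpol A \<kappa> V a E c = (\<Oplus>\<beta>\<in>box V E. \<kappa> (c \<beta>) \<otimes> mpow A V b \<beta> \<oplus>
     \<kappa> (c \<beta>) \<otimes> (mpow A V a \<beta> \<ominus> mpow A V b \<beta>))"
    unfolding bpol_def using car cc by (intro finsum_cong' eq) auto
  also have "\<dots> = bpol A \<kappa> V b E c \<oplus>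
     (\<Oplus>\<beta>\<in>box V E. \<kappa> (c \<beta>) \<otimes> (mpow A V a \<beta> \<ominus> mpow A V b \<beta>))"
    unfolding bpol_def using car cc by (intro finsum_addf) auto
  finally have "bpol A \<kappa> V a E c = bpol A \<kappa> V b E c \<oplus>
     (\<Oplus>\<beta>\<in>box V E. \<kappa> (c \<beta>) \<otimes> (mpow A V a \<beta> \<ominus> mpow A V b \<beta>))" .
  moreover have "(\<Oplus>\<beta>\<in>box V E. \<kappa> (c \<beta>) \<otimes> (mpow A V a \<beta> \<ominus> mpow A V b \<beta>)) \<in> sp G"
    using mpow_cong_mod[OF M G V ab] cc by (intro sp_finsum[OF G(1)] sp_smult[OF G(1)]) auto
  moreover have "(\<Oplus>\<beta>\<in>box V E. \<kappa> (c \<beta>) \<otimes> (mpow A V a \<beta> \<ominus> mpow A V b \<beta>)) \<in> carrier A"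
    using calculation(2) sp_closed[OF G(1)] by blast
  moreover have "bpol A \<kappa> V b E c \<in> carrier A" using car c by simp
  moreover have "x \<oplus> y \<ominus> x = y" if "x \<in> carrier A" "y \<in> carrier A" for x y using that by algebra
  ultimately show ?thesis by simp
qed

end

text \<open>Polynomials in \<open>k\<close> variables are handled as functions on
  \<open>L^k\<close>. As \<open>L\<close> is infinite this loses nothing, which
  \<open>monomials_independent\<close> makes precise; products, spans and evaluation then need no
  separate ring of multivariate polynomials.\<close>

locale affine_space = field L for L (structure) + fixes k :: nat
  assumes inf: "infinite (carrier L)"
begin

abbreviation "D \<equiv> aff L k"
abbreviation "A \<equiv> fun_ring L D"
abbreviation "\<kappa> \<equiv> cst D"
abbreviation "xs \<equiv> crd D"

sublocale s: scalars L A \<kappa>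
  by (rule scalars_fun_ring)

lemma xs_closed: "i < k \<Longrightarrow> xs i \<in> carrier A"
  by (rule crd_closed)

lemma xs_Pi: "V \<subseteq> {..<k} \<Longrightarrow> xs \<in> V \<rightarrow> carrier A"
  by (auto intro!: xs_closed)

lemma carrier_A_eqI: "\<lbrakk>F \<in> carrier A; G \<in> carrier A; \<And>x. x \<in> D \<Longrightarrow> F x = G x\<rbrakk> \<Longrightarrow> F = G"
  by (auto simp: fun_ring_simps intro: PiE_ext)

lemma A_apply: "\<lbrakk>F \<in> carrier A; x \<in> D\<rbrakk> \<Longrightarrow> F x \<in> carrier L"
  by (auto simp: fun_ring_simps)

lemma xs_apply: "x \<in> D \<Longrightarrow> xs i x = x i"
  by (simp add: crd_def)

lemma D_apply: "\<lbrakk>x \<in> D; i < k\<rbrakk> \<Longrightarrow> x i \<in> carrier L"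
  by (auto simp: aff_def)

lemma kappa_apply: "x \<in> D \<Longrightarrow> \<kappa> c x = c"
  by (simp add: cst_def)

lemma monomials_independent:
  assumes B: "finite B" "\<And>\<beta> i. \<lbrakk>\<beta> \<in> B; k \<le> i\<rbrakk> \<Longrightarrow> \<beta> i = 0" and c: "c \<in> B \<rightarrow> carrier L"
    and zero: "(\<Oplus>\<^bsub>A\<^esub>\<beta>\<in>B. \<kappa> (c \<beta>) \<otimes>\<^bsub>A\<^esub> mpow A {..<k} xs \<beta>) = \<zero>\<^bsub>A\<^esub>" and b: "\<beta> \<in> B"
  shows "c \<beta> = \<zero>"
proof (rule ccontr)
  assume nz: "c \<beta> \<noteq> \<zero>"
  define E where "E = Max (\<Union>\<beta>\<in>B. \<beta> ` {..<k} \<union> {0})"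
  have "\<gamma> i \<le> E" if "\<gamma> \<in> B" "i < k" for \<gamma> i unfolding E_def using that B by (intro Max_ge) auto
  then have BE: "B \<subseteq> box {..<k} E" using B by (auto simp: box_iff)
  define c' where "c' \<gamma> = (if \<gamma> \<in> B then c \<gamma> else \<zero>)" for \<gamma>
  have c': "c' \<in> box {..<k} E \<rightarrow> carrier L" using c by (auto simp: c'_def)
  have "\<exists>z\<in>PiE {..<k} (\<lambda>_. carrier L). bpol L id {..<k} z E c' \<noteq> \<zero>"
    using nz b BE inf by (intro exists_nonzero_point c') (auto simp: c'_def)
  then obtain z where z: "z \<in> D" "bpol L id {..<k} z E c' \<noteq> \<zero>" by (auto simp: aff_def)
  have "bpol A \<kappa> {..<k} xs E c' = (\<Oplus>\<^bsub>A\<^esub>\<beta>\<in>B. \<kappa> (c \<beta>) \<otimes>\<^bsub>A\<^esub> mpow A {..<k} xs \<beta>)"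
    unfolding bpol_def using BE c' xs_Pi[OF order_refl] finite_box[of "{..<k}" E]
    by (intro s.add.finprod_mono_neutral_cong_right) (auto simp: c'_def Pi_def)
  moreover have "bpol A \<kappa> {..<k} xs E c' z = bpol L id {..<k} (\<lambda>i. xs i z) E c'"
    using z c' xs_Pi[OF order_refl] by (intro eval_bpol) auto
  moreover have "(\<lambda>i. xs i z) = z" using z by (simp add: xs_apply)
  ultimately have "bpol L id {..<k} z E c' = \<zero>\<^bsub>A\<^esub> z" using zero by simp
  then show False using z by (simp add: fun_ring_simps)
qed

end

text \<open>Specialising the variables in \<open>V\<close> to \<open>w\<close> leaves a polynomial
  in the first \<open>t\<close> variables with the same exponent bound. Its coefficients are read
  off in the ring of functions on \<open>R^t\<close>, where a specialised monomial is a constant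
  times a coordinate monomial.\<close>

lemma (in field) bpol_partial:
  assumes t: "V \<inter> {..<t} = {}" "finite V" and c: "c \<in> box ({..<t} \<union> V) E \<rightarrow> carrier R"
    and w: "w \<in> V \<rightarrow> carrier R"
  shows "\<exists>c'. c' \<in> box {..<t} E \<rightarrow> carrier R \<and> (\<forall>y \<in> {..<t} \<rightarrow> carrier R.
     bpol R id ({..<t} \<union> V) (\<lambda>i. if i < t then y i else w i) E c = bpol R id {..<t} y E c')"
proof -
  define P where "P = aff R t"
  interpret s: scalars R "fun_ring R P" "cst P" by (rule scalars_fun_ring)
  let ?A = "fun_ring R P" and ?U = "{..<t} \<union> V"
  define z where "z i = (if i < t then crd P i else cst P (w i))" for i
  have crd: "crd P \<in> {..<t} \<rightarrow> carrier ?A" unfolding P_def by (intro funcsetI crd_closed) simp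
  have wc: "\<And>i. i \<in> V \<Longrightarrow> w i \<in> carrier R" using w by auto
  have Vt: "\<not> i < t" if "i \<in> V" for i using that t by auto
  have z1: "z \<in> {..<t} \<rightarrow> carrier ?A" using crd by (auto simp: z_def)
  have z2: "z \<in> V \<rightarrow> carrier ?A"
    using wc Vt by (auto simp: z_def)
  have z: "z \<in> ?U \<rightarrow> carrier ?A" using z1 z2 by auto
  have m: "mpow ?A ?U z \<beta> \<in> s.sp (mpow ?A {..<t} (crd P) ` box {..<t} E)" if b: "\<beta> \<in> box ?U E" for \<beta>
  proof -
    let ?b = "\<lambda>i. if i < t then \<beta> i else 0"
    have "mpow ?A ?U z \<beta> = mpow ?A {..<t} z \<beta> \<otimes>\<^bsub>?A\<^esub> mpow ?A V z \<beta>"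
      unfolding mpow_def using z1 z2 t by (intro s.finprod_Un_disjoint) auto
    also have "mpow ?A V z \<beta> = mpow ?A V (\<lambda>i. cst P (w i)) \<beta>"
      using wc t by (intro s.S.mpow_cong) (auto simp: z_def)
    also have "\<dots> = cst P (mpow R V w \<beta>)" using s.hom_mpow[OF w] by simp
    also have "mpow ?A {..<t} z \<beta> = mpow ?A {..<t} (crd P) ?b"
      using crd by (intro s.S.mpow_cong) (auto simp: z_def)
    also have "mpow ?A {..<t} (crd P) ?b \<otimes>\<^bsub>?A\<^esub> cst P (mpow R V w \<beta>) =
        cst P (mpow R V w \<beta>) \<otimes>\<^bsub>?A\<^esub> mpow ?A {..<t} (crd P) ?b"
      using crd w by (intro s.m_comm) auto
    also have "\<dots> \<in> s.sp (mpow ?A {..<t} (crd P) ` box {..<t} E)"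
      using crd w b by (intro s.sp_smult s.sp_mpow s.S.mpow_image) (auto simp: box_iff)
    finally show ?thesis .
  qed
  have "bpol ?A (cst P) ?U z E c \<in> s.sp (mpow ?A {..<t} (crd P) ` box {..<t} E)"
    unfolding bpol_def using c m crd by (intro s.sp_finsum s.sp_smult s.S.mpow_image) auto
  then obtain c' where c': "c' \<in> box {..<t} E \<rightarrow> carrier R"
    "bpol ?A (cst P) ?U z E c = bpol ?A (cst P) {..<t} (crd P) E c'"
    using s.sp_finite_imageD[OF _ s.S.mpow_image[OF crd] finite_box] unfolding bpol_def by blast
  have "bpol R id ?U (\<lambda>i. if i < t then y i else w i) E c = bpol R id {..<t} y E c'"
    if y: "y \<in> {..<t} \<rightarrow> carrier R" for y
  proof -
    interpret i: scalars R R id by (rule scalars_id)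
    let ?y = "restrict y {..<t}"
    have yP: "?y \<in> P" using y by (auto simp: P_def aff_def)
    have yt: "(\<lambda>i. crd P i ?y) = ?y" using yP unfolding crd_def by (simp add: fun_eq_iff)
    have "bpol R id ?U (\<lambda>i. if i < t then y i else w i) E c = bpol R id ?U (\<lambda>i. z i ?y) E c"
      using yP c y w t by (intro i.bpol_cong) (auto simp: z_def crd_def cst_def)
    also have "\<dots> = bpol ?A (cst P) ?U z E c ?y" by (rule eval_bpol[symmetric, OF z c yP])
    also have "\<dots> = bpol R id {..<t} (\<lambda>i. crd P i ?y) E c'"
      unfolding c'(2) by (rule eval_bpol[OF crd c'(1) yP])
    also have "\<dots> = bpol R id {..<t} y E c'"
      unfolding yt using y c' by (intro i.bpol_cong) auto
    finally show ?thesis .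
  qed
  then show ?thesis using c' by blast
qed

definition upol :: "('b, 'm) ring_scheme \<Rightarrow> nat \<Rightarrow> (nat \<Rightarrow> 'b) \<Rightarrow> 'b \<Rightarrow> 'b" where
  "upol L d a y = (\<Oplus>\<^bsub>L\<^esub>j\<in>{..d}. a j \<otimes>\<^bsub>L\<^esub> y [^]\<^bsub>L\<^esub> j)"

text \<open>Two different polynomials over \<open>K\<close> agree at \<open>y\<close> only if
  \<open>y\<close> is a root of their difference, and the finitely many nonzero differences have
  finitely many roots. These points stand in for elements of large degree over a finite field
  \<open>K\<close>; closure under differences keeps the differences inside the finite set
  \<open>?B\<close>.\<close>

lemma (in field) infinite_separating_points:
  assumes inf: "infinite (carrier R)" and K: "finite K" "K \<subseteq> carrier R" "\<And>a b. \<lbrakk>a \<in> K; b \<in> K\<rbrakk> \<Longrightarrow> a \<ominus> b \<in> K"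
    and "finite I"
  shows "infinite {y \<in> carrier R. \<forall>i\<in>I. inj_on (\<lambda>a. upol R (d i) a y) ({..d i} \<rightarrow>\<^sub>E K)}"
proof
  let ?T = "{y \<in> carrier R. \<forall>i\<in>I. inj_on (\<lambda>a. upol R (d i) a y) ({..d i} \<rightarrow>\<^sub>E K)}"
  assume fin: "finite ?T"
  let ?B = "\<lambda>d::nat. {b \<in> {..d} \<rightarrow>\<^sub>E K. \<exists>j\<le>d. b j \<noteq> \<zero>}"
  let ?Z = "\<lambda>(d::nat) b. {y \<in> carrier R. (\<Oplus>j\<in>{..d}. b j \<otimes> y [^] j) = \<zero>}"
  have "carrier R \<subseteq> ?T \<union> (\<Union>i\<in>I. \<Union>b\<in>?B (d i). ?Z (d i) b)"
  proof
    fix y assume y: "y \<in> carrier R"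
    show "y \<in> ?T \<union> (\<Union>i\<in>I. \<Union>b\<in>?B (d i). ?Z (d i) b)"
    proof (cases "y \<in> ?T")
      case False
      then obtain i a a' where i: "i \<in> I" and aa: "a \<in> {..d i} \<rightarrow>\<^sub>E K" "a' \<in> {..d i} \<rightarrow>\<^sub>E K"
        "upol R (d i) a y = upol R (d i) a' y" "a \<noteq> a'" using y by (auto simp: inj_on_def)
      let ?b = "\<lambda>j\<in>{..d i}. a j \<ominus> a' j"
      have ac: "\<And>j. j \<le> d i \<Longrightarrow> a j \<in> carrier R" "\<And>j. j \<le> d i \<Longrightarrow> a' j \<in> carrier R"
        using aa K by auto
      obtain j where j: "j \<le> d i" "a j \<noteq> a' j" using aa(1,2,4) by (metis PiE_ext atMost_iff)
      then have "?b j \<noteq> \<zero>" using ac[OF j(1)] by simp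
      moreover have "?b \<in> {..d i} \<rightarrow>\<^sub>E K"
        using K(3)[OF PiE_mem[OF aa(1)] PiE_mem[OF aa(2)]] by (intro restrict_PiE_iff[THEN iffD2] ballI)
      ultimately have "?b \<in> ?B (d i)" using j by auto
      moreover have "(\<Oplus>j\<in>{..d i}. ?b j \<otimes> y [^] j) = \<zero>"
      proof -
        have "(\<Oplus>j\<in>{..d i}. a j \<otimes> y [^] j) = (\<Oplus>j\<in>{..d i}. ?b j \<otimes> y [^] j \<oplus> a' j \<otimes> y [^] j)"
          using ac y by (intro finsum_cong') (auto simp: l_distr[symmetric] minus_eq a_assoc l_neg)
        also have "\<dots> = (\<Oplus>j\<in>{..d i}. ?b j \<otimes> y [^] j) \<oplus> (\<Oplus>j\<in>{..d i}. a' j \<otimes> y [^] j)"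
          using ac y by (intro finsum_addf) auto
        finally have "(\<Oplus>j\<in>{..d i}. ?b j \<otimes> y [^] j) \<oplus> upol R (d i) a y = upol R (d i) a y"
          using aa(3) unfolding upol_def by simp
        moreover have "(\<Oplus>j\<in>{..d i}. ?b j \<otimes> y [^] j) \<in> carrier R" "upol R (d i) a y \<in> carrier R"
          unfolding upol_def using ac y by (auto intro!: finsum_closed)
        ultimately show ?thesis using add.r_cancel_one by blast
      qed
      ultimately show ?thesis using i y by blast
    qed auto
  qed
  moreover have "finite (?Z (d i) b)" if "b \<in> ?B (d i)" for b i
  proof -
    have b: "b \<in> {..d i} \<rightarrow>\<^sub>E K \<and> (\<exists>j\<le>d i. b j \<noteq> \<zero>)"
      using that by (simp only: mem_Collect_eq)
    then obtain j where "j \<le> d i" "b j \<noteq> \<zero>" by blast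
    moreover have "b \<in> {..d i} \<rightarrow> carrier R" using b K by auto
    ultimately show ?thesis by (intro card_roots_le(1))
  qed
  moreover have "finite (?B d)" for d by (rule finite_subset[of _ "{..d} \<rightarrow>\<^sub>E K"]) (auto intro!: finite_PiE K)
  ultimately have "finite (carrier R)"
    using fin \<open>finite I\<close> by (elim finite_subset) (intro finite_UnI finite_UN_I; assumption)
  then show False using inf by simp
qed

section \<open>Eliminants and their probability\<close>

lemma (in ring_hom_cring) hom_upol:
  assumes "a \<in> {..d} \<rightarrow> carrier R" "y \<in> carrier R"
  shows "h (upol R d a y) = upol S d (\<lambda>j. h (a j)) (h y)"
proof -
  have "h (upol R d a y) = finsum S (h \<circ> (\<lambda>j. a j \<otimes> y [^] j)) {..d}"
    unfolding upol_def using assms by (intro hom_finsum) auto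
  also have "\<dots> = upol S d (\<lambda>j. h (a j)) (h y)"
    unfolding upol_def using assms by (intro S.finsum_cong') (auto simp: Pi_def)
  finally show ?thesis .
qed

lemma (in cring) upol_closed:
  assumes "a \<in> {..d} \<rightarrow> carrier R" "y \<in> carrier R"
  shows "upol R d a y \<in> carrier R"
  using assms by (auto simp: upol_def intro!: finsum_closed)

section \<open>Ideals, shifted systems and eliminants\<close>

context affine_space
begin

text \<open>Monomial multiples of the \<open>F i\<close>, so for \<open>F i\<close> in the
  polynomial functions the linear span is their ideal in the ring of polynomial functions, and not
  in the ring \<open>A\<close> of all functions.\<close>

definition ideal_gens :: "nat \<Rightarrow> (nat \<Rightarrow> (nat \<Rightarrow> 'a) \<Rightarrow> 'a) \<Rightarrow> ((nat \<Rightarrow> 'a) \<Rightarrow> 'a) set" where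
  "ideal_gens t F = {mpow A {..<k} xs \<gamma> \<otimes>\<^bsub>A\<^esub> F i |i \<gamma>. i < t}"

lemma ideal_gens_closed: "(\<And>i. i < t \<Longrightarrow> F i \<in> carrier A) \<Longrightarrow> ideal_gens t F \<subseteq> carrier A"
  using xs_Pi[OF order_refl] by (auto simp: ideal_gens_def)

lemma ideal_gens_mult:
  assumes F: "\<And>i. i < t \<Longrightarrow> F i \<in> carrier A" and m: "m \<in> range (mpow A {..<k} xs)" "g \<in> ideal_gens t F"
  shows "m \<otimes>\<^bsub>A\<^esub> g \<in> s.sp (ideal_gens t F)"
proof -
  obtain \<mu> i \<gamma> where g: "m = mpow A {..<k} xs \<mu>" "i < t" "g = mpow A {..<k} xs \<gamma> \<otimes>\<^bsub>A\<^esub> F i"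
    using m by (auto simp: ideal_gens_def)
  have "m \<otimes>\<^bsub>A\<^esub> g = mpow A {..<k} xs (\<lambda>j. \<mu> j + \<gamma> j) \<otimes>\<^bsub>A\<^esub> F i"
    using g F xs_Pi[OF order_refl] by (simp add: s.S.mpow_add s.m_assoc)
  then have "m \<otimes>\<^bsub>A\<^esub> g \<in> ideal_gens t F" using g by (auto simp: ideal_gens_def)
  then show ?thesis using s.sp_base[OF ideal_gens_closed] F by blast
qed

lemma F_in_ideal:
  assumes F: "\<And>i. i < t \<Longrightarrow> F i \<in> carrier A" and "i < t"
  shows "F i \<in> s.sp (ideal_gens t F)"
proof -
  have "mpow A {..<k} xs (\<lambda>_. 0) \<otimes>\<^bsub>A\<^esub> F i = F i" using assms by (simp add: s.S.mpow_zero)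
  then have "F i \<in> ideal_gens t F" using assms(2) unfolding ideal_gens_def
    by (intro CollectI exI[of _ i] exI[of _ "\<lambda>_. 0"]) simp
  then show ?thesis using s.sp_base[OF ideal_gens_closed] F by blast
qed

definition shifted :: "(nat \<Rightarrow> (nat \<Rightarrow> 'a) \<Rightarrow> 'a) \<Rightarrow> (nat \<Rightarrow> nat) \<Rightarrow> nat \<Rightarrow> (nat \<Rightarrow> nat \<Rightarrow> 'a) \<Rightarrow> nat \<Rightarrow> (nat \<Rightarrow> 'a) \<Rightarrow> 'a" where
  "shifted f d r a i = f i \<oplus>\<^bsub>A\<^esub> upol A (d i) (\<lambda>j. \<kappa> (a i j)) (xs r)"

text \<open>Geometrically, such a \<open>p\<close> shows that the projection of the common zeros of
  \<open>F\<close> to the coordinates in \<open>S\<close> is not dense.\<close>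

definition has_eliminant :: "nat \<Rightarrow> nat set \<Rightarrow> (nat \<Rightarrow> (nat \<Rightarrow> 'a) \<Rightarrow> 'a) \<Rightarrow> bool" where
  "has_eliminant t S F \<longleftrightarrow> (\<exists>e p. p \<in> s.sp (mpow A {..<k} xs ` box S e) \<and> p \<noteq> \<zero>\<^bsub>A\<^esub> \<and> p \<in> s.sp (ideal_gens t F))"

text \<open>Sending \<open>a\<close> to the tuple of values \<open>- a_i (\<rho>)\<close> maps the
  shifts without eliminant injectively into the zeros of one polynomial on a grid. It is a single
  polynomial because the relation \<open>Q\<close> and the specialisation of \<open>X_S\<close> are
  fixed before \<open>a\<close> is chosen.\<close>

lemma card_no_eliminant:
  assumes S: "S \<subseteq> {..<k}" "r \<in> S" "card S + t = k + 1"
    and f: "\<And>i. i < t \<Longrightarrow> f i \<in> s.sp (mpow A {..<k} xs ` box {..<k} \<delta>)" and \<delta>: "\<delta> \<ge> 1"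
    and E: "((k + 1) * E * \<delta> + 1) ^ k < (E + 1) ^ (k + 1)"
    and K: "finite K" "K \<subseteq> carrier L" "\<And>a b. \<lbrakk>a \<in> K; b \<in> K\<rbrakk> \<Longrightarrow> a \<ominus> b \<in> K"
    and M: "\<And>i. i < t \<Longrightarrow> M \<le> card K ^ (d i + 1)"
  shows "card {a \<in> PiE {..<t} (\<lambda>i. {..d i} \<rightarrow>\<^sub>E K). \<not> has_eliminant t S (shifted f d r a)} * M
    \<le> t * E * (\<Prod>i<t. card K ^ (d i + 1))"
proof -
  \<comment> \<open>Index \<open>i < t\<close> will stand for \<open>f i\<close> and index
    \<open>t + i\<close> for the coordinate \<open>xs i\<close>; the offset makes the two kinds
    disjoint, with \<open>k + 1\<close> indices in total.\<close>
  let ?X = "mpow A {..<k} xs" and ?SV = "(\<lambda>i. t + i) ` S"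
  let ?V = "{..<t} \<union> ?SV"
  have xs: "xs \<in> {..<k} \<rightarrow> carrier A" using xs_Pi by simp
  have Xc: "?X ` P \<subseteq> carrier A" for P using xs by (rule s.S.mpow_image)
  have fS: "finite S" using S finite_subset by auto
  have disj: "?SV \<inter> {..<t} = {}" by auto
  have fV: "finite ?V" using fS by simp
  have cV: "card ?V = k + 1"
    using fS S disj by (subst card_Un_disjoint) (auto simp: card_image)
  have fc: "\<And>i. i < t \<Longrightarrow> f i \<in> carrier A" using f s.sp_closed[OF Xc] by blast
  have xin: "xs i \<in> s.sp (?X ` box W e)" if "i \<in> W" "W \<subseteq> {..<k}" "1 \<le> e" for i W e
  proof -
    have "?X (\<lambda>j. if j = i then 1 else 0) = xs i"
      using that xs s.S.mpow_single[of "{..<k}" i xs 1] xs_closed[of i] by auto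
    then show ?thesis using that s.sp_mpow[OF xs, of "\<lambda>j. if j = i then 1 else 0" "box W e"]
      by (auto simp: box_iff)
  qed
  define z where "z i = (if i < t then f i else xs (i - t))" for i
  have z: "z i \<in> s.sp (?X ` box {..<k} \<delta>)" if "i \<in> ?V" for i
    using that f xin S \<delta> by (auto simp: z_def)
  obtain c where c: "c \<in> box ?V E \<rightarrow> carrier L" "\<exists>\<beta>\<in>box ?V E. c \<beta> \<noteq> \<zero>"
    "bpol A \<kappa> ?V z E c = \<zero>\<^bsub>A\<^esub>"
    using s.algebraic_dependence[where E = E and z = z, OF xs finite_lessThan fV z] E
    unfolding cV card_lessThan by blast
  \<comment> \<open>All coordinates of the point \<open>\<eta>\<close> are taken in this infinite
    set, so that one choice achieves both: \<open>Q\<close> is nonzero at \<open>\<eta>\<close>, and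
    the coordinate belonging to \<open>r\<close> separates the polynomials over
    \<open>K\<close>.\<close>
  define T where "T = {y \<in> carrier L. \<forall>i\<in>{..<t}. inj_on (\<lambda>a. upol L (d i) a y) ({..d i} \<rightarrow>\<^sub>E K)}"
  have "infinite T" unfolding T_def using inf K by (intro infinite_separating_points) auto
  then obtain \<eta> where \<eta>: "\<eta> \<in> PiE ?V (\<lambda>_. T)" "bpol L id ?V \<eta> E c \<noteq> \<zero>"
    using exists_nonzero_point[OF fV c(1,2), of "\<lambda>_. T"] by (auto simp: T_def)
  have \<eta>c: "\<eta> i \<in> carrier L" if "i \<in> ?V" for i using \<eta>(1) that PiE_mem[OF \<eta>(1) that] by (simp add: T_def)
  interpret i: scalars L L id by (rule scalars_id)
  \<comment> \<open>\<open>Q\<close> with \<open>X_S\<close> replaced by the values of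
    \<open>\<eta>\<close>. Its value at the first \<open>t\<close> coordinates of
    \<open>\<eta>\<close> is \<open>Q (\<eta>)\<close>, which is nonzero, so \<open>c'\<close> is
    not the zero polynomial.\<close>
  obtain c' where c': "c' \<in> box {..<t} E \<rightarrow> carrier L" "\<And>y. y \<in> {..<t} \<rightarrow> carrier L \<Longrightarrow>
     bpol L id ?V (\<lambda>i. if i < t then y i else \<eta> i) E c = bpol L id {..<t} y E c'"
    using bpol_partial[OF disj _ c(1), of \<eta>] \<eta>c fS by auto
  have "bpol L id ?V \<eta> E c = bpol L id {..<t} \<eta> E c'"
    using c'(2)[of \<eta>] \<eta>c by auto
  then have nz: "\<exists>\<beta>\<in>box {..<t} E. c' \<beta> \<noteq> \<zero>"
  proof -
    have False if "\<forall>\<beta>\<in>box {..<t} E. c' \<beta> = \<zero>"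
    proof -
      have "bpol L id {..<t} \<eta> E c' = (\<Oplus>\<beta>\<in>box {..<t} E. \<zero>)"
        unfolding bpol_def using that \<eta>c by (intro finsum_cong') auto
      then show False using \<eta> \<open>bpol L id ?V \<eta> E c = bpol L id {..<t} \<eta> E c'\<close> by (simp add: finsum_zero)
    qed
    then show ?thesis by blast
  qed
  define \<rho> where "\<rho> = \<eta> (t + r)"
  have \<rho>: "\<rho> \<in> carrier L" "\<And>i. i < t \<Longrightarrow> inj_on (\<lambda>a. upol L (d i) a \<rho>) ({..d i} \<rightarrow>\<^sub>E K)"
    using PiE_mem[OF \<eta>(1), of "t + r"] S by (auto simp: T_def \<rho>_def)
  \<comment> \<open>The grid for Schwartz-Zippel: by injectivity side \<open>i\<close> has exactly
    \<open>card K ^ (d i + 1)\<close> elements.\<close>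
  define Y where "Y i = (\<lambda>a. \<ominus> upol L (d i) a \<rho>) ` ({..d i} \<rightarrow>\<^sub>E K)" for i
  have KL: "a \<in> {..d} \<rightarrow> carrier L" if "a \<in> {..d} \<rightarrow>\<^sub>E K" for a :: "nat \<Rightarrow> 'a" and d using that K by auto
  have uc: "upol L (d i) a \<rho> \<in> carrier L" if "a \<in> {..d i} \<rightarrow>\<^sub>E K" for a i
    using KL[OF that] \<rho> by (intro upol_closed) auto
  have injY: "inj_on (\<lambda>a. \<ominus> upol L (d i) a \<rho>) ({..d i} \<rightarrow>\<^sub>E K)" if "i < t" for i
    using \<rho>(2)[OF that] uc by (auto simp: inj_on_def) (metis minus_minus)
  have cY: "card (Y i) = card K ^ (d i + 1)" if "i < t" for i
    unfolding Y_def using card_image[OF injY[OF that]] by (simp add: card_funcsetE)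
  have Yprop: "finite (Y i) \<and> Y i \<subseteq> carrier L \<and> M \<le> card (Y i)" if "i < t" for i
    using that cY M K uc finite_PiE[of "{..d i}" "\<lambda>_. K"] by (auto simp: Y_def)
  define bad where "bad = {a \<in> PiE {..<t} (\<lambda>i. {..d i} \<rightarrow>\<^sub>E K). \<not> has_eliminant t S (shifted f d r a)}"
  define yy where "yy a = (\<lambda>i\<in>{..<t}. \<ominus> upol L (d i) (a i) \<rho>)" for a
  have "inj_on yy bad"
  proof (rule inj_onI)
    fix a b assume ab: "a \<in> bad" "b \<in> bad" "yy a = yy b"
    have ai: "a i \<in> {..d i} \<rightarrow>\<^sub>E K" "b i \<in> {..d i} \<rightarrow>\<^sub>E K" if "i < t" for i
      using ab(1,2) that by (auto simp: bad_def PiE_mem)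
    have "a i = b i" if "i < t" for i
      using fun_cong[OF ab(3), of i] that injY[OF that] ai[OF that] by (auto simp: yy_def inj_on_def)
    then show "a = b" using ab(1,2) unfolding bad_def by (intro PiE_ext[of a "{..<t}" _ b]) auto
  qed
  moreover have "yy a \<in> {y \<in> PiE {..<t} Y. bpol L id {..<t} y E c' = \<zero>}" if a: "a \<in> bad" for a
  proof -
    have aP: "a \<in> PiE {..<t} (\<lambda>i. {..d i} \<rightarrow>\<^sub>E K)" and ng: "\<not> has_eliminant t S (shifted f d r a)"
      using a by (auto simp: bad_def)
    have ai: "a i \<in> {..d i} \<rightarrow>\<^sub>E K" if "i < t" for i using aP that by (auto simp: PiE_mem)
    have yP: "yy a \<in> PiE {..<t} Y" using ai by (auto simp: yy_def Y_def)
    have yc: "yy a \<in> {..<t} \<rightarrow> carrier L" using yP Yprop by auto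
    define u where "u i = upol A (d i) (\<lambda>j. \<kappa> (a i j)) (xs r)" for i
    have ka: "\<kappa> (a i j) \<in> carrier A" if "i < t" "j \<le> d i" for i j using ai[OF that(1)] that K by auto
    have rk: "r < k" using S by auto
    obtain e where e: "e \<ge> 1" "\<And>i. i < t \<Longrightarrow> d i \<le> e"
    proof
      show "Suc (Max (d ` {..<t} \<union> {0})) \<ge> 1" by simp
      show "d i \<le> Suc (Max (d ` {..<t} \<union> {0}))" if "i < t" for i
        using that by (intro le_SucI Max_ge) auto
    qed
    have u: "u i \<in> s.sp (?X ` box S e)" if "i < t" for i
      unfolding u_def upol_def
    proof (intro s.sp_finsum Xc s.sp_smult)
      fix j assume j: "j \<in> {..d i}"
      show "a i j \<in> carrier L" using ai[OF that] K j by auto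
      have "xs r [^]\<^bsub>A\<^esub> j = ?X (\<lambda>l. if l = r then j else 0)"
        using rk xs by (intro s.S.mpow_single[symmetric]) auto
      moreover have "(\<lambda>l. if l = r then j else 0) \<in> box S e"
        using S e(2)[OF that] j by (auto simp: box_iff)
      ultimately show "xs r [^]\<^bsub>A\<^esub> j \<in> s.sp (?X ` box S e)" using s.sp_mpow[OF xs] by simp
    qed
    then have uA: "\<And>i. i < t \<Longrightarrow> u i \<in> carrier A" using s.sp_closed[OF Xc] by blast
    define w where "w i = (if i < t then \<ominus>\<^bsub>A\<^esub> u i else xs (i - t))" for i
    have w: "w i \<in> s.sp (?X ` box S e)" if "i \<in> ?V" for i
      using that u[of i] s.sp_minus[OF Xc, of "u i" "box S e"] xin[of "i - t" S e] S e
      by (auto simp: w_def)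
    then have wA: "w \<in> ?V \<rightarrow> carrier A" using s.sp_closed[OF Xc] by blast
    \<comment> \<open>Only variables in \<open>S\<close> occur in \<open>p\<close>: the
      \<open>u i\<close> are polynomials in the variable \<open>r\<close>, which belongs to
      \<open>S\<close>.\<close>
    define p where "p = bpol A \<kappa> ?V w E c"
    have "p \<in> s.sp (?X ` box S (card ?V * E * e))"
      unfolding p_def bpol_def
    proof (intro s.sp_finsum Xc s.sp_smult)
      fix \<beta> assume b: "\<beta> \<in> box ?V E"
      then show "c \<beta> \<in> carrier L" using c by auto
      have m: "mpow A ?V w \<beta> \<in> s.sp (?X ` box S (\<Sum>i\<in>?V. \<beta> i * e))"
        by (rule s.sp_mpow_power_products[where P = "box S" and e = "\<lambda>_. e", OF xs _ box_add fV w])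
          (simp_all add: box_iff)
      have "(\<Sum>i\<in>?V. \<beta> i * e) \<le> (\<Sum>i\<in>?V. E * e)"
        using b by (intro sum_mono) (auto simp: box_iff)
      then have sub: "box S (\<Sum>i\<in>?V. \<beta> i * e) \<subseteq> box S (card ?V * E * e)" by (intro box_mono) simp
      show "mpow A ?V w \<beta> \<in> s.sp (?X ` box S (card ?V * E * e))"
        by (rule subsetD[OF s.sp_mono[OF image_mono[OF sub]] m])
    qed
    moreover have "p \<in> s.sp (ideal_gens t (shifted f d r a))"
    proof -
      let ?F = "shifted f d r a"
      have FA: "?F i \<in> carrier A" if "i < t" for i
        using fc[OF that] uA[OF that] by (simp add: shifted_def u_def)
      have G: "ideal_gens t ?F \<subseteq> carrier A" using FA by (rule ideal_gens_closed)
      have "w i \<ominus>\<^bsub>A\<^esub> z i \<in> s.sp (ideal_gens t ?F)" if "i \<in> ?V" for i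
      proof (cases "i < t")
        case True
        have "\<ominus>\<^bsub>A\<^esub> ?F i = w i \<ominus>\<^bsub>A\<^esub> z i"
          using True fc[OF True] uA[OF True]
          by (simp add: shifted_def w_def z_def u_def[symmetric] s.minus_eq s.minus_add s.a_comm)
        then show ?thesis using s.sp_minus[OF G F_in_ideal[where F = ?F, OF FA True]] by simp
      next
        case False
        then have "w i \<in> carrier A" "w i = z i" using funcset_mem[OF wA that] by (simp_all add: w_def z_def)
        then show ?thesis by (simp add: s.minus_eq s.r_neg s.sp_zero)
      qed
      moreover have "?X ` box W e \<subseteq> range ?X" for W e by auto
      then have "s.sp (?X ` box W e) \<subseteq> s.sp (range ?X)" for W e by (rule s.sp_mono)
      then have "w i \<in> s.sp (range ?X)" "z i \<in> s.sp (range ?X)" if "i \<in> ?V" for i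
        using w[OF that] z[OF that] by blast+
      moreover have "\<one>\<^bsub>A\<^esub> \<in> s.sp (range ?X)"
        using s.sp_mpow[OF xs, of "\<lambda>_. 0" UNIV] by (simp add: s.S.mpow_zero)
      moreover have "g \<otimes>\<^bsub>A\<^esub> h \<in> s.sp (range ?X)" if "g \<in> range ?X" "h \<in> range ?X" for g h
        using that s.sp_mpow_mult[OF xs s.sp_mpow[OF xs] s.sp_mpow[OF xs], of _ UNIV _ UNIV UNIV] by auto
      ultimately have "p \<ominus>\<^bsub>A\<^esub> bpol A \<kappa> ?V z E c \<in> s.sp (ideal_gens t ?F)"
        unfolding p_def using Xc G fV c(1) FA ideal_gens_mult[of t ?F]
        by (intro s.bpol_cong_mod[where M = "range ?X"]) auto
      moreover have "p \<in> carrier A" unfolding p_def using wA c by simp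
      ultimately show ?thesis using c(3) by (simp add: s.minus_eq)
    qed
    ultimately have p0: "p = \<zero>\<^bsub>A\<^esub>" using ng unfolding has_eliminant_def by blast
    \<comment> \<open>The point of \<open>L^k\<close> with the \<open>S\<close>-coordinates of
      \<open>\<eta>\<close>; the value zero elsewhere is a default.\<close>
    define x where "x = (\<lambda>i\<in>{..<k}. if i \<in> S then \<eta> (t + i) else \<zero>)"
    have x: "x \<in> D" using \<eta>c by (auto simp: x_def aff_def)
    have "\<zero> = p x" using p0 x by (simp add: fun_ring_simps)
    also have "\<dots> = bpol L id ?V (\<lambda>i. w i x) E c"
      unfolding p_def using wA c x by (intro eval_bpol) auto
    also have "\<dots> = bpol L id ?V (\<lambda>i. if i < t then yy a i else \<eta> i) E c"
    proof (rule i.bpol_cong)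
      show "(\<lambda>i. if i < t then yy a i else \<eta> i) \<in> ?V \<rightarrow> carrier L" using yc \<eta>c by auto
      fix i assume i: "i \<in> ?V"
      interpret h: ring_hom_cring A L "\<lambda>F. F x" using x by (rule eval_hom)
      show "w i x = (if i < t then yy a i else \<eta> i)"
      proof (cases "i < t")
        case True
        have "u i x = upol L (d i) (\<lambda>j. \<kappa> (a i j) x) (xs r x)"
          unfolding u_def using ka[OF True] xs_closed[OF rk] by (intro h.hom_upol) auto
        also have "\<dots> = upol L (d i) (a i) \<rho>"
          using x rk S by (simp add: kappa_apply xs_apply \<rho>_def) (simp add: x_def)
        finally show ?thesis using True uA[OF True] by (simp add: w_def yy_def)
      next
        case False
        then show ?thesis using i x S by (auto simp: w_def xs_apply) (auto simp: x_def)
      qed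
    qed (use c in auto)
    also have "\<dots> = bpol L id {..<t} (yy a) E c'" using c'(2)[OF yc] .
    finally show ?thesis using yP by simp
  qed
  then have "yy ` bad \<subseteq> {y \<in> PiE {..<t} Y. bpol L id {..<t} y E c' = \<zero>}" by blast
  moreover have "finite (PiE {..<t} Y)" using Yprop by (intro finite_PiE) auto
  ultimately have "card bad \<le> card {y \<in> PiE {..<t} Y. bpol L id {..<t} y E c' = \<zero>}"
    by (intro card_inj_on_le) auto
  then have "card bad * M \<le> card {y \<in> PiE {..<t} Y. bpol L id {..<t} y E c' = \<zero>} * M" by simp
  also have "\<dots> \<le> card {..<t} * E * (\<Prod>i\<in>{..<t}. card (Y i))"
    using Yprop by (intro card_bpol_zeros c'(1) nz) auto
  also have "\<dots> = t * E * (\<Prod>i<t. card K ^ (d i + 1))" using cY by simp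
  finally show ?thesis unfolding bad_def .
qed

end

section \<open>Dimension\<close>

lemma exists_maximizer:
  fixes f :: "'a \<Rightarrow> nat"
  assumes "finite N" "N \<noteq> {}"
  shows "\<exists>a\<in>N. \<forall>b\<in>N. f b \<le> f a"
proof -
  have "Max (f ` N) \<in> f ` N" using assms by (intro Max_in) auto
  then obtain a where a: "a \<in> N" "f a = Max (f ` N)" by auto
  have "f b \<le> f a" if "b \<in> N" for b unfolding a(2) using assms that by (intro Max_ge) auto
  then show ?thesis using a by blast
qed

lemma div_digit: "(r::nat) < m \<Longrightarrow> (r + q * m) div m = q"
proof -
  assume "r < m"
  moreover from this have "m \<noteq> 0" by auto
  ultimately show ?thesis by simp
qed

lemma digits_less:
  fixes \<alpha> :: "nat \<Rightarrow> nat"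
  assumes "\<And>i. i < k \<Longrightarrow> \<alpha> i < B"
  shows "(\<Sum>i<k. \<alpha> i * B ^ i) < B ^ k"
  using assms
proof (induction k)
  case (Suc k)
  have "(\<Sum>i<Suc k. \<alpha> i * B ^ i) < B ^ k + \<alpha> k * B ^ k" using Suc by simp
  also have "\<dots> = (\<alpha> k + 1) * B ^ k" by simp
  also have "\<dots> \<le> B * B ^ k" using Suc.prems[of k] by (intro mult_le_mono1) simp
  finally show ?case by simp
qed simp

lemma digits_inj:
  fixes \<alpha> \<beta> :: "nat \<Rightarrow> nat"
  assumes "\<And>i. i < k \<Longrightarrow> \<alpha> i < B" "\<And>i. i < k \<Longrightarrow> \<beta> i < B"
    and "(\<Sum>i<k. \<alpha> i * B ^ i) = (\<Sum>i<k. \<beta> i * B ^ i)" "i < k"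
  shows "\<alpha> i = \<beta> i"
  using assms
proof (induction k)
  case (Suc k)
  have a: "(\<Sum>i<k. \<alpha> i * B ^ i) < B ^ k" "(\<Sum>i<k. \<beta> i * B ^ i) < B ^ k"
    using Suc.prems by (auto intro: digits_less)
  have eq: "(\<Sum>i<k. \<alpha> i * B ^ i) + \<alpha> k * B ^ k = (\<Sum>i<k. \<beta> i * B ^ i) + \<beta> k * B ^ k"
    using Suc.prems(3) by simp
  have "\<alpha> k = ((\<Sum>i<k. \<alpha> i * B ^ i) + \<alpha> k * B ^ k) div B ^ k" using a by (simp only: div_digit)
  also have "\<dots> = \<beta> k" unfolding eq using a by (simp only: div_digit)
  finally have k: "\<alpha> k = \<beta> k" .
  then have "(\<Sum>i<k. \<alpha> i * B ^ i) = (\<Sum>i<k. \<beta> i * B ^ i)" using eq by simp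
  then show ?case using Suc k by (cases "i = k") auto
qed simp

text \<open>A weight refining the total degree, additive in the exponent, and injective on exponents
  whose entries are less than \<open>B\<close>: it plays the role of a graded monomial order.\<close>
definition wt :: "nat \<Rightarrow> nat \<Rightarrow> (nat \<Rightarrow> nat) \<Rightarrow> nat" where
  "wt k B \<alpha> = (\<Sum>i<k. \<alpha> i) * B ^ k + (\<Sum>i<k. \<alpha> i * B ^ i)"

lemma wt_add: "wt k B (\<lambda>i. \<alpha> i + \<beta> i) = wt k B \<alpha> + wt k B \<beta>"
  by (simp add: wt_def sum.distrib algebra_simps)

lemma wt_inj:
  assumes "\<And>i. i < k \<Longrightarrow> \<alpha> i < B" "\<And>i. i < k \<Longrightarrow> \<beta> i < B" "wt k B \<alpha> = wt k B \<beta>" "i < k"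
  shows "\<alpha> i = \<beta> i"
proof -
  have d: "(\<Sum>i<k. \<alpha> i * B ^ i) < B ^ k" "(\<Sum>i<k. \<beta> i * B ^ i) < B ^ k"
    using assms by (auto intro: digits_less)
  have "(\<Sum>i<k. \<alpha> i * B ^ i) = wt k B \<alpha> mod B ^ k" using d by (simp add: wt_def)
  also have "\<dots> = (\<Sum>i<k. \<beta> i * B ^ i)" unfolding assms(3) using d by (simp add: wt_def)
  finally show ?thesis using digits_inj[of k \<alpha> B \<beta>, OF assms(1,2)] assms(4) by blast
qed

text \<open>The second summand of \<open>wt\<close> is less than \<open>B ^ k\<close>, so division
  by \<open>B ^ k\<close> recovers the total degree.\<close>

lemma wt_degree:
  assumes "\<And>i. i < k \<Longrightarrow> \<alpha> i < B" "\<And>i. i < k \<Longrightarrow> \<beta> i < B" "wt k B \<alpha> \<le> wt k B \<beta>"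
  shows "(\<Sum>i<k. \<alpha> i) \<le> (\<Sum>i<k. \<beta> i)"
proof -
  have d: "(\<Sum>i<k. \<alpha> i * B ^ i) < B ^ k" "(\<Sum>i<k. \<beta> i * B ^ i) < B ^ k"
    using assms by (auto intro: digits_less)
  have "(\<Sum>i<k. \<alpha> i) = wt k B \<alpha> div B ^ k"
    unfolding wt_def using d by (subst add.commute) (simp only: div_digit)
  also have "\<dots> \<le> wt k B \<beta> div B ^ k" using assms(3) by (rule div_le_mono)
  also have "\<dots> = (\<Sum>i<k. \<beta> i)"
    unfolding wt_def using d by (subst add.commute) (simp only: div_digit)
  finally show ?thesis .
qed

text \<open>Solves the combination \<open>p\<close> for one of its terms: modulo \<open>p\<close>,
  the element \<open>m a\<close> is a combination of the other terms that occur. This is the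
  elementary reduction step of a normal form.\<close>

lemma (in scalars) sp_leading_term:
  assumes m: "m ` B \<subseteq> carrier A" and "finite B" and c: "c \<in> B \<rightarrow> carrier L" and a: "a \<in> B" "c a \<noteq> \<zero>\<^bsub>L\<^esub>"
    and p: "p = (\<Oplus>\<beta>\<in>B. \<kappa> (c \<beta>) \<otimes> m \<beta>)"
  shows "m a \<in> sp (m ` {\<beta> \<in> B. \<beta> \<noteq> a \<and> c \<beta> \<noteq> \<zero>\<^bsub>L\<^esub>} \<union> {p})"
proof -
  let ?B = "{\<beta> \<in> B. \<beta> \<noteq> a \<and> c \<beta> \<noteq> \<zero>\<^bsub>L\<^esub>}"
  have cc: "\<And>\<beta>. \<beta> \<in> B \<Longrightarrow> c \<beta> \<in> carrier L" and mc: "\<And>\<beta>. \<beta> \<in> B \<Longrightarrow> m \<beta> \<in> carrier A" using c m by auto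
  have pc: "p \<in> carrier A" unfolding p using cc mc by (intro finsum_closed) auto
  have G: "m ` ?B \<union> {p} \<subseteq> carrier A" using m pc by auto
  define q where "q = (\<Oplus>\<beta>\<in>?B. \<kappa> (c \<beta>) \<otimes> m \<beta>)"
  have q: "q \<in> sp (m ` ?B \<union> {p})"
    unfolding q_def using cc G by (intro sp_finsum sp_smult sp_base) auto
  have qc: "q \<in> carrier A" using sp_closed[OF G q] .
  have "p = (\<Oplus>\<beta>\<in>insert a ?B. \<kappa> (c \<beta>) \<otimes> m \<beta>)"
    unfolding p using assms(2) a cc mc by (intro add.finprod_mono_neutral_cong_right) auto
  also have "\<dots> = \<kappa> (c a) \<otimes> m a \<oplus> q"
    unfolding q_def using assms(2) a cc mc by (intro finsum_insert) auto
  finally have "\<kappa> (c a) \<otimes> m a = p \<ominus> q"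
    using a cc mc qc by (simp add: minus_eq a_assoc r_neg)
  moreover have inv: "inv\<^bsub>L\<^esub> (c a) \<in> carrier L" "inv\<^bsub>L\<^esub> (c a) \<otimes>\<^bsub>L\<^esub> c a = \<one>\<^bsub>L\<^esub>"
    using a cc L.field_Units by auto
  have "m a = \<kappa> (inv\<^bsub>L\<^esub> (c a) \<otimes>\<^bsub>L\<^esub> c a) \<otimes> m a" using inv a mc by simp
  then have "m a = \<kappa> (inv\<^bsub>L\<^esub> (c a)) \<otimes> (\<kappa> (c a) \<otimes> m a)"
    using inv(1) a cc mc by (simp add: m_assoc)
  ultimately have "m a = \<kappa> (inv\<^bsub>L\<^esub> (c a)) \<otimes> (p \<ominus> q)" by simp
  moreover have "\<kappa> (inv\<^bsub>L\<^esub> (c a)) \<otimes> (p \<ominus> q) \<in> sp (m ` ?B \<union> {p})"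
    using inv by (intro sp_smult[OF G] sp_diff[OF G] q sp_base[OF G]) auto
  ultimately show ?thesis by simp
qed

lemma monoms_add: "\<lbrakk>\<alpha> \<in> monoms k m; \<beta> \<in> monoms k n\<rbrakk> \<Longrightarrow> (\<lambda>i. \<alpha> i + \<beta> i) \<in> monoms k (m + n)"
  by (auto simp: monoms_def sum.distrib)

lemma monoms_mono: "m \<le> n \<Longrightarrow> monoms k m \<subseteq> monoms k n"
  by (auto simp: monoms_def)

lemma monoms_subset_box: "monoms k d \<subseteq> box {..<k} d"
proof
  fix \<alpha> assume a: "\<alpha> \<in> monoms k d"
  have "\<alpha> i \<le> (\<Sum>i<k. \<alpha> i)" if "i < k" for i using that by (intro member_le_sum) auto
  then show "\<alpha> \<in> box {..<k} d" using a by (force simp: monoms_def box_iff)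
qed

lemma finite_monoms: "finite (monoms k d)"
  using monoms_subset_box finite_box[of "{..<k}"] finite_subset by blast

section \<open>Polynomial functions and standard monomials\<close>

context affine_space
begin

abbreviation "xmon \<equiv> mpow A {..<k} xs"
abbreviation "PF \<equiv> s.sp (range xmon)"

definition vanish :: "(nat \<Rightarrow> 'a) set \<Rightarrow> ((nat \<Rightarrow> 'a) \<Rightarrow> 'a) set" where
  "vanish V = {F \<in> carrier A. \<forall>x\<in>V. F x = \<zero>}"

lemma xs_carrier: "xs \<in> {..<k} \<rightarrow> carrier A"
  using xs_Pi by simp

lemma xmon_closed [simp]: "xmon \<alpha> \<in> carrier A"
  using xs_carrier by simp

lemma xmon_image: "xmon ` P \<subseteq> carrier A"
  by auto

lemma PF_closed: "F \<in> PF \<Longrightarrow> F \<in> carrier A"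
  using s.sp_closed[OF xmon_image] .

lemma PF_mult: "\<lbrakk>F \<in> PF; G \<in> PF\<rbrakk> \<Longrightarrow> F \<otimes>\<^bsub>A\<^esub> G \<in> PF"
  using s.sp_mpow_mult[OF xs_carrier, of F UNIV G UNIV UNIV] by simp

lemma PF_one: "\<one>\<^bsub>A\<^esub> \<in> PF"
  using s.sp_mpow[OF xs_carrier, of "\<lambda>_. 0" UNIV] by (simp add: s.S.mpow_zero)

lemma PF_pow: "F \<in> PF \<Longrightarrow> F [^]\<^bsub>A\<^esub> (n::nat) \<in> PF"
  by (induction n) (auto intro: PF_one PF_mult)

lemma PF_const: "c \<in> carrier L \<Longrightarrow> \<kappa> c \<in> PF"
  using s.sp_smult[OF xmon_image PF_one, of c] by simp

lemma sp_xmon_PF: "F \<in> s.sp (xmon ` P) \<Longrightarrow> F \<in> PF"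
  using s.sp_mono[of "xmon ` P" "range xmon"] by auto

lemma PF_degree: "F \<in> PF \<Longrightarrow> \<exists>e. F \<in> s.sp (xmon ` monoms k e)"
proof (induction rule: s.sp.induct)
  case sp_zero
  then show ?case using s.sp_zero by blast
next
  case (sp_step F g c)
  then obtain e \<gamma> where e: "F \<in> s.sp (xmon ` monoms k e)" "g = xmon \<gamma>" by auto
  \<comment> \<open>Exponents at indices from \<open>k\<close> on are invisible to
    \<open>xmon\<close>; they are cleared because \<open>monoms\<close> demands it.\<close>
  let ?g = "\<lambda>i. if i < k then \<gamma> i else 0"
  let ?e = "max e (\<Sum>i<k. \<gamma> i)"
  have "g = xmon ?g" unfolding e by (intro s.S.mpow_cong xs_carrier) auto
  moreover have "?g \<in> monoms k ?e" by (auto simp: monoms_def)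
  ultimately have "g \<in> xmon ` monoms k ?e" by blast
  moreover have "F \<in> s.sp (xmon ` monoms k ?e)"
    using e(1) s.sp_mono[OF image_mono[OF monoms_mono[of e ?e k]]] by auto
  ultimately show ?case using sp_step by (intro exI[of _ ?e] s.sp_step) auto
qed

lemma PF_mpow: "\<lbrakk>finite V; \<And>i. i \<in> V \<Longrightarrow> g i \<in> PF\<rbrakk> \<Longrightarrow> mpow A V g \<beta> \<in> PF"
  by (rule s.sp_mpow_power_products[where P = "\<lambda>_. UNIV" and e = "\<lambda>_. 0", OF xs_carrier]) auto

lemma PF_bpol:
  assumes "finite V" "\<And>i. i \<in> V \<Longrightarrow> g i \<in> PF" "c \<in> box V E \<rightarrow> carrier L"
  shows "bpol A \<kappa> V g E c \<in> PF"
  unfolding bpol_def using assms by (intro s.sp_finsum xmon_image s.sp_smult PF_mpow) auto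

lemma vanish_closed: "vanish V \<subseteq> carrier A"
  by (auto simp: vanish_def)

lemma sp_vanish:
  assumes V: "V \<subseteq> D" and F: "F \<in> s.sp (vanish V)"
  shows "F \<in> vanish V"
  using F
proof induction
  case sp_zero
  then show ?case using V by (auto simp: vanish_def fun_ring_simps)
next
  case (sp_step F g c)
  have "(\<kappa> c \<otimes>\<^bsub>A\<^esub> g \<oplus>\<^bsub>A\<^esub> F) x = \<zero>" if "x \<in> V" for x
  proof -
    have "x \<in> D" using that V by auto
    then show ?thesis using sp_step that by (simp add: vanish_def fun_ring_simps cst_def)
  qed
  then show ?case using sp_step by (auto simp: vanish_def)
qed

lemma vanish_mult:
  assumes V: "V \<subseteq> D" and F: "F \<in> vanish V" "G \<in> carrier A"
  shows "G \<otimes>\<^bsub>A\<^esub> F \<in> vanish V"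
proof -
  have "(G \<otimes>\<^bsub>A\<^esub> F) x = \<zero>" if "x \<in> V" for x
  proof -
    have "x \<in> D" using that V by auto
    then show ?thesis using F A_apply[of G x] that by (simp add: vanish_def fun_ring_simps)
  qed
  then show ?thesis using F by (auto simp: vanish_def)
qed

text \<open>Standard exponents, those with fewer than \<open>n\<close> large entries. An exponent
  with \<open>n\<close> entries at least \<open>B\<close> will be divisible by the leading monomial
  of the eliminant in these variables and can be reduced.\<close>

definition std :: "nat \<Rightarrow> nat \<Rightarrow> nat \<Rightarrow> (nat \<Rightarrow> nat) set" where
  "std n B e = {\<delta> \<in> monoms k e. card {i. i < k \<and> B \<le> \<delta> i} < n}"

lemma finite_std: "finite (std n B e)"
  using finite_monoms by (simp add: std_def)

text \<open>There are at most \<open>2 ^ k\<close> choices for the set \<open>U\<close> of large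
  entries; the at most \<open>n - 1\<close> entries in \<open>U\<close> range up to
  \<open>e\<close>, the others stay below \<open>B\<close>. For fixed \<open>B\<close> this grows
  like \<open>e^(n - 1)\<close>.\<close>

lemma card_std:
  assumes "n \<ge> 1" "B \<ge> 1"
  shows "card (std n B e) \<le> 2 ^ k * ((e + 1) ^ (n - 1) * B ^ k)"
proof -
  let ?U = "{U. U \<subseteq> {..<k} \<and> card U < n}"
  let ?S = "\<lambda>U i. if i \<in> U then {..e} else {..<B}"
  have fU: "finite ?U" by (rule finite_subset[of _ "Pow {..<k}"]) auto
  have fS: "finite (exps {..<k} (?S U))" for U by (intro finite_exps) auto
  have "std n B e \<subseteq> (\<Union>U\<in>?U. exps {..<k} (?S U))"
  proof
    fix \<delta> assume d: "\<delta> \<in> std n B e"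
    let ?V = "{i. i < k \<and> B \<le> \<delta> i}"
    have "\<delta> \<in> box {..<k} e" using d monoms_subset_box by (auto simp: std_def)
    then have "\<delta> \<in> exps {..<k} (?S ?V)" by (auto simp: exps_def box_iff)
    moreover have "?V \<in> ?U" using d by (auto simp: std_def)
    ultimately show "\<delta> \<in> (\<Union>U\<in>?U. exps {..<k} (?S U))" by blast
  qed
  then have "card (std n B e) \<le> card (\<Union>U\<in>?U. exps {..<k} (?S U))"
    using fU fS by (intro card_mono) auto
  also have "\<dots> \<le> (\<Sum>U\<in>?U. card (exps {..<k} (?S U)))" by (rule card_UN_le[OF fU])
  also have "\<dots> \<le> (\<Sum>U\<in>?U. (e + 1) ^ (n - 1) * B ^ k)"
  proof (intro sum_mono)
    fix U assume U: "U \<in> ?U"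
    have "card (exps {..<k} (?S U)) = (\<Prod>i<k. card (?S U i))" by (intro card_exps) auto
    also have "\<dots> = (\<Prod>i<k. (if i \<in> U then e + 1 else 1) * (if i \<in> U then 1 else B))"
      by (intro prod.cong) auto
    also have "\<dots> = (\<Prod>i<k. if i \<in> U then e + 1 else 1) * (\<Prod>i<k. if i \<in> U then 1 else B)"
      by (rule prod.distrib)
    also have "(\<Prod>i<k. if i \<in> U then e + 1 else 1) = (e + 1) ^ card U"
    proof -
      have "{..<k} \<inter> {x. x \<in> U} = U" using U by auto
      then show ?thesis by (simp add: prod.If_cases)
    qed
    also have "\<dots> * (\<Prod>i<k. if i \<in> U then 1 else B) \<le> (e + 1) ^ (n - 1) * (\<Prod>i<k. B)"
      using U assms by (intro mult_mono power_increasing prod_mono) auto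
    finally show "card (exps {..<k} (?S U)) \<le> (e + 1) ^ (n - 1) * B ^ k" by simp
  qed
  also have "\<dots> = card ?U * ((e + 1) ^ (n - 1) * B ^ k)" by simp
  also have "card ?U \<le> card (Pow {..<k})" by (intro card_mono) auto
  finally show ?thesis by (simp add: card_Pow)
qed

text \<open>Reduction to normal form by the eliminants \<open>p S\<close>. If
  \<open>\<gamma>\<close> is not standard, some leading exponent \<open>a S\<close> divides it; the
  replacement lowers \<open>wt\<close> without raising the total degree, so the induction never
  leaves \<open>monoms k e\<close>. One \<open>B\<close> serves every \<open>e\<close>.\<close>

lemma std_spans:
  assumes V: "V \<subseteq> D"
    and el: "\<And>S. \<lbrakk>S \<subseteq> {..<k}; card S = n\<rbrakk> \<Longrightarrow> \<exists>e p. p \<in> s.sp (xmon ` box S e) \<and> p \<noteq> \<zero>\<^bsub>A\<^esub> \<and> p \<in> vanish V"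
  obtains B where "B \<ge> 1" "\<And>e \<gamma>. \<gamma> \<in> monoms k e \<Longrightarrow> xmon \<gamma> \<in> s.sp (xmon ` std n B e \<union> vanish V)"
proof -
  let ?\<S> = "{S. S \<subseteq> {..<k} \<and> card S = n}"
  have fS: "finite ?\<S>" by (rule finite_subset[of _ "Pow {..<k}"]) auto
  obtain ee p where p: "\<And>S. S \<in> ?\<S> \<Longrightarrow> p S \<in> s.sp (xmon ` box S (ee S)) \<and> p S \<noteq> \<zero>\<^bsub>A\<^esub> \<and> p S \<in> vanish V"
    using el by (simp only: mem_Collect_eq) metis
  define e0 where "e0 = Max (ee ` ?\<S> \<union> {0})"
  have e0: "ee S \<le> e0" if "S \<in> ?\<S>" for S
    unfolding e0_def using that fS by (intro Max_ge) auto
  \<comment> \<open>\<open>B\<close> exceeds every exponent allowed in an eliminant: hence entries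
    at least \<open>B\<close> dominate those of a leading exponent, and \<open>wt\<close> is
    injective on the boxes in question.\<close>
  define B where "B = Suc e0"
  define lead where "lead S a \<longleftrightarrow> a \<in> box S e0 \<and> xmon a \<in> s.sp (xmon ` {\<alpha> \<in> box S e0. wt k B \<alpha> < wt k B a \<and> (\<Sum>i<k. \<alpha> i) \<le> (\<Sum>i<k. a i)} \<union> {p S})" for S a
  have ex: "\<exists>a. lead S a"
    if S: "S \<in> ?\<S>" for S
  proof -
    have finS: "finite S" using S finite_subset by auto
    have "p S \<in> s.sp (xmon ` box S e0)"
      using p[OF S] s.sp_mono[OF image_mono[OF box_mono[OF e0[OF S]]]] by auto
    then obtain c where c: "c \<in> box S e0 \<rightarrow> carrier L" "p S = (\<Oplus>\<^bsub>A\<^esub>\<beta>\<in>box S e0. \<kappa> (c \<beta>) \<otimes>\<^bsub>A\<^esub> xmon \<beta>)"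
      using s.sp_finite_imageD[OF _ xmon_image finite_box[OF finS]] by blast
    let ?N = "{\<alpha> \<in> box S e0. c \<alpha> \<noteq> \<zero>}"
    have "?N \<noteq> {}"
    proof
      assume "?N = {}"
      then have "p S = (\<Oplus>\<^bsub>A\<^esub>\<beta>\<in>box S e0. \<zero>\<^bsub>A\<^esub>)"
        unfolding c(2) by (intro s.finsum_cong') auto
      then show False using p[OF S] by (simp add: s.finsum_zero)
    qed
    moreover have "finite ?N" using finite_box[OF finS] by simp
    ultimately obtain a where a: "a \<in> ?N" "\<And>\<alpha>. \<alpha> \<in> ?N \<Longrightarrow> wt k B \<alpha> \<le> wt k B a"
      using exists_maximizer[of ?N "wt k B"] by blast
    have lt: "\<alpha> i < B" if "\<alpha> \<in> box S e0" for \<alpha> i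
      using that by (cases "i \<in> S") (auto simp: box_iff B_def le_imp_less_Suc)
    have sub: "{\<beta> \<in> box S e0. \<beta> \<noteq> a \<and> c \<beta> \<noteq> \<zero>} \<subseteq> {\<alpha> \<in> box S e0. wt k B \<alpha> < wt k B a \<and> (\<Sum>i<k. \<alpha> i) \<le> (\<Sum>i<k. a i)}"
    proof
      fix \<beta> assume b: "\<beta> \<in> {\<beta> \<in> box S e0. \<beta> \<noteq> a \<and> c \<beta> \<noteq> \<zero>}"
      then have le: "wt k B \<beta> \<le> wt k B a" using a by auto
      have "wt k B \<beta> \<noteq> wt k B a"
      proof
        assume "wt k B \<beta> = wt k B a"
        then have "\<beta> i = a i" if "i < k" for i using wt_inj[of k \<beta> B a] lt a b that by auto
        moreover have "\<beta> i = a i" if "\<not> i < k" for i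
        proof -
          have "i \<notin> S" using that S by auto
          then show ?thesis using a b by (simp add: box_iff)
        qed
        ultimately have "\<beta> = a" by blast
        then show False using b by simp
      qed
      moreover have "(\<Sum>i<k. \<beta> i) \<le> (\<Sum>i<k. a i)" using wt_degree[OF _ _ le] lt a b by auto
      ultimately show "\<beta> \<in> {\<alpha> \<in> box S e0. wt k B \<alpha> < wt k B a \<and> (\<Sum>i<k. \<alpha> i) \<le> (\<Sum>i<k. a i)}"
        using le b by auto
    qed
    have mem: "xmon a \<in> s.sp (xmon ` {\<beta> \<in> box S e0. \<beta> \<noteq> a \<and> c \<beta> \<noteq> \<zero>} \<union> {p S})"
      using a c finite_box[OF finS] by (intro s.sp_leading_term) auto
    have "xmon a \<in> s.sp (xmon ` {\<alpha> \<in> box S e0. wt k B \<alpha> < wt k B a \<and> (\<Sum>i<k. \<alpha> i) \<le> (\<Sum>i<k. a i)} \<union> {p S})"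
      by (rule subsetD[OF s.sp_mono[OF Un_mono[OF image_mono[OF sub] subset_refl]] mem])
    then show ?thesis using a unfolding lead_def by blast
  qed
  obtain a where a: "\<And>S. S \<in> ?\<S> \<Longrightarrow> lead S (a S)"
    using ex by metis
  have "xmon \<gamma> \<in> s.sp (xmon ` std n B e \<union> vanish V)" if "\<gamma> \<in> monoms k e" for \<gamma> e
    using that
  proof (induction "wt k B \<gamma>" arbitrary: \<gamma> rule: less_induct)
    case less
    have G: "xmon ` std n B e \<union> vanish V \<subseteq> carrier A" using vanish_closed by auto
    show ?case
    proof (cases "\<gamma> \<in> std n B e")
      case True
      then show ?thesis using G by (intro s.sp_base) auto
    next
      case False
      then have "n \<le> card {i. i < k \<and> B \<le> \<gamma> i}" using less.prems by (auto simp: std_def)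
      then obtain S where S: "S \<subseteq> {i. i < k \<and> B \<le> \<gamma> i}" "card S = n" by (meson obtain_subset_with_card_n)
      then have S': "S \<in> ?\<S>" by auto
      have aS: "a S \<in> box S e0" and aSp: "xmon (a S) \<in> s.sp (xmon ` {\<alpha> \<in> box S e0. wt k B \<alpha> < wt k B (a S) \<and> (\<Sum>i<k. \<alpha> i) \<le> (\<Sum>i<k. a S i)} \<union> {p S})"
        using a[OF S'] by (auto simp: lead_def)
      have le: "a S i \<le> \<gamma> i" for i
      proof (cases "i \<in> S")
        case True
        then have "a S i \<le> e0" "B \<le> \<gamma> i" using aS S by (auto simp: box_iff)
        then show ?thesis by (simp add: B_def)
      qed (use aS in \<open>auto simp: box_iff\<close>)
      define \<gamma>' where "\<gamma>' i = \<gamma> i - a S i" for i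
      have g: "\<gamma> = (\<lambda>i. \<gamma>' i + a S i)" using le by (auto simp: \<gamma>'_def)
      have "xmon \<gamma> = xmon \<gamma>' \<otimes>\<^bsub>A\<^esub> xmon (a S)"
        by (subst g) (rule s.S.mpow_add[OF xs_carrier])
      moreover have "xmon \<gamma>' \<otimes>\<^bsub>A\<^esub> xmon (a S) \<in> s.sp (xmon ` std n B e \<union> vanish V)"
      proof (rule s.sp_mult_base[OF G _ _ _ aSp])
        show "xmon ` {\<alpha> \<in> box S e0. wt k B \<alpha> < wt k B (a S) \<and> (\<Sum>i<k. \<alpha> i) \<le> (\<Sum>i<k. a S i)} \<union> {p S} \<subseteq> carrier A"
          using p[OF S'] vanish_closed by auto
        fix h assume h: "h \<in> xmon ` {\<alpha> \<in> box S e0. wt k B \<alpha> < wt k B (a S) \<and> (\<Sum>i<k. \<alpha> i) \<le> (\<Sum>i<k. a S i)} \<union> {p S}"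
        show "xmon \<gamma>' \<otimes>\<^bsub>A\<^esub> h \<in> s.sp (xmon ` std n B e \<union> vanish V)"
        proof (cases "h = p S")
          case True
          then have "xmon \<gamma>' \<otimes>\<^bsub>A\<^esub> h \<in> vanish V" using p[OF S'] V by (intro vanish_mult) auto
          then show ?thesis using G by (intro s.sp_base) auto
        next
          case False
          then obtain \<alpha> where al: "\<alpha> \<in> box S e0" "wt k B \<alpha> < wt k B (a S)" "(\<Sum>i<k. \<alpha> i) \<le> (\<Sum>i<k. a S i)" "h = xmon \<alpha>"
            using h by auto
          let ?g = "\<lambda>i. \<gamma>' i + \<alpha> i"
          have "wt k B ?g < wt k B \<gamma>" using al g wt_add[of k B \<gamma>' \<alpha>] wt_add[of k B \<gamma>' "a S"] by simp
          moreover have "?g \<in> monoms k e"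
          proof -
            have "(\<Sum>i<k. ?g i) \<le> (\<Sum>i<k. \<gamma> i)" by (subst (2) g) (simp add: sum.distrib al)
            moreover have "?g i = 0" if "k \<le> i" for i
              using that al S' less.prems by (auto simp: \<gamma>'_def monoms_def box_iff)
            ultimately show ?thesis using less.prems by (auto simp: monoms_def)
          qed
          ultimately have "xmon ?g \<in> s.sp (xmon ` std n B e \<union> vanish V)" by (rule less.hyps)
          then show ?thesis unfolding al(4) using s.S.mpow_add[OF xs_carrier, of \<gamma>' \<alpha>] by simp
        qed
      qed simp
      ultimately show ?thesis by simp
    qed
  qed
  then show ?thesis using that[of B] by (simp add: B_def)
qed

text \<open>Modulo the functions vanishing on \<open>V\<close>, the standard monomials of degree up
  to \<open>s\<close> grow in number like \<open>s^(n - 1)\<close>, whereas the \<open>g i\<close>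
  have \<open>(E + 1) ^ n\<close> power products of degree linear in \<open>E\<close>.\<close>

lemma algebraically_dependent_on:
  assumes V: "V \<subseteq> D" and n: "n \<ge> 1"
    and el: "\<And>S. \<lbrakk>S \<subseteq> {..<k}; card S = n\<rbrakk> \<Longrightarrow> \<exists>e p. p \<in> s.sp (xmon ` box S e) \<and> p \<noteq> \<zero>\<^bsub>A\<^esub> \<and> p \<in> vanish V"
    and g: "\<And>i. i < n \<Longrightarrow> g i \<in> PF"
  shows "\<exists>E c. c \<in> box {..<n} E \<rightarrow> carrier L \<and> (\<exists>\<beta>\<in>box {..<n} E. c \<beta> \<noteq> \<zero>) \<and> bpol A \<kappa> {..<n} g E c \<in> vanish V"
proof -
  obtain B where B: "B \<ge> 1" "\<And>e \<gamma>. \<gamma> \<in> monoms k e \<Longrightarrow> xmon \<gamma> \<in> s.sp (xmon ` std n B e \<union> vanish V)"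
    using std_spans[OF V el] by blast
  obtain ee where ee: "\<And>i. i < n \<Longrightarrow> g i \<in> s.sp (xmon ` monoms k (ee i))" using PF_degree[OF g] by metis
  define e where "e = Max (ee ` {..<n})"
  have ge: "g i \<in> s.sp (xmon ` monoms k e)" if "i \<in> {..<n}" for i
  proof -
    have "ee i \<le> e" unfolding e_def using that by (intro Max_ge) auto
    then show ?thesis using ee[of i] that s.sp_mono[OF image_mono[OF monoms_mono]] by blast
  qed
  \<comment> \<open>Chosen so that, by \<open>n * E * e + 1 \<le> (E + 1) * (n * e + 1)\<close>, the
    bound of \<open>card_std\<close> becomes \<open>E * (E + 1) ^ (n - 1)\<close>, just below
    \<open>(E + 1) ^ n\<close>.\<close>
  define E where "E = 2 ^ k * B ^ k * (n * e + 1) ^ (n - 1)"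
  let ?s = "n * E * e"
  let ?J = "xmon ` std n B ?s"
  have "card ?J \<le> card (std n B ?s)" using finite_std by (rule card_image_le)
  also have "\<dots> \<le> 2 ^ k * ((?s + 1) ^ (n - 1) * B ^ k)" using n B by (intro card_std)
  also have "\<dots> \<le> 2 ^ k * (((E + 1) * (n * e + 1)) ^ (n - 1) * B ^ k)"
    by (intro mult_le_mono power_mono) (auto simp: algebra_simps)
  also have "\<dots> = (2 ^ k * B ^ k * (n * e + 1) ^ (n - 1)) * (E + 1) ^ (n - 1)"
    by (simp only: power_mult_distrib ac_simps)
  also have "\<dots> = E * (E + 1) ^ (n - 1)" by (simp only: E_def)
  also have "\<dots> < (E + 1) * (E + 1) ^ (n - 1)" by simp
  also have "\<dots> = (E + 1) ^ n" using n by (metis power_eq_if not_one_le_zero)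
  finally have card: "card ?J < card (box {..<n} E)" by (simp add: card_box)
  have "mpow A {..<n} g \<beta> \<in> s.sp (?J \<union> vanish V)" if b: "\<beta> \<in> box {..<n} E" for \<beta>
  proof -
    have mem: "mpow A {..<n} g \<beta> \<in> s.sp (xmon ` monoms k (\<Sum>i\<in>{..<n}. \<beta> i * e))"
      by (rule s.sp_mpow_power_products[where P = "monoms k" and e = "\<lambda>_. e", OF xs_carrier _ monoms_add _ ge])
        (auto simp: monoms_def)
    have "(\<Sum>i\<in>{..<n}. \<beta> i * e) \<le> (\<Sum>i\<in>{..<n}. E * e)"
      using b by (intro sum_mono) (auto simp: box_iff)
    then have sub: "monoms k (\<Sum>i\<in>{..<n}. \<beta> i * e) \<subseteq> monoms k ?s" by (intro monoms_mono) simp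
    have "mpow A {..<n} g \<beta> \<in> s.sp (xmon ` monoms k ?s)"
      by (rule subsetD[OF s.sp_mono[OF image_mono[OF sub]] mem])
    moreover have "s.sp (xmon ` monoms k ?s) \<subseteq> s.sp (?J \<union> vanish V)"
      using B(2) vanish_closed by (intro s.sp_sub) auto
    ultimately show ?thesis by blast
  qed
  then obtain c where c: "c \<in> box {..<n} E \<rightarrow> carrier L" "\<exists>b\<in>box {..<n} E. c b \<noteq> \<zero>"
    "(\<Oplus>\<^bsub>A\<^esub>b\<in>box {..<n} E. \<kappa> (c b) \<otimes>\<^bsub>A\<^esub> mpow A {..<n} g b) \<in> s.sp (vanish V)"
    using s.exists_dependence[of "vanish V" ?J "box {..<n} E" "mpow A {..<n} g"] card
      vanish_closed finite_std finite_box[of "{..<n}"] xmon_image[of "std n B ?s"] by auto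
  then show ?thesis using sp_vanish[OF V c(3)] by (auto simp: bpol_def)
qed

end

section \<open>Zariski closed sets and chains of irreducible sets\<close>

context affine_space
begin

lemma eval_sum:
  assumes c: "c \<in> B \<rightarrow> carrier L" and F: "F \<in> B \<rightarrow> carrier A" and x: "x \<in> D"
  shows "(\<Oplus>\<^bsub>A\<^esub>\<beta>\<in>B. \<kappa> (c \<beta>) \<otimes>\<^bsub>A\<^esub> F \<beta>) x = (\<Oplus>\<beta>\<in>B. c \<beta> \<otimes> F \<beta> x)"
proof -
  interpret h: ring_hom_cring A L "\<lambda>F. F x" using x by (rule eval_hom)
  have "(\<Oplus>\<^bsub>A\<^esub>\<beta>\<in>B. \<kappa> (c \<beta>) \<otimes>\<^bsub>A\<^esub> F \<beta>) x =
     (\<Oplus>\<beta>\<in>B. ((\<lambda>F. F x) \<circ> (\<lambda>\<beta>. \<kappa> (c \<beta>) \<otimes>\<^bsub>A\<^esub> F \<beta>)) \<beta>)"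
    using c F by (intro h.hom_finsum) (auto simp: Pi_def)
  also have "\<dots> = (\<Oplus>\<beta>\<in>B. c \<beta> \<otimes> F \<beta> x)"
  proof (rule finsum_cong')
    show "(\<lambda>\<beta>. c \<beta> \<otimes> F \<beta> x) \<in> B \<rightarrow> carrier L"
      using c F A_apply[OF _ x] by (auto simp: Pi_def)
    show "((\<lambda>F. F x) \<circ> (\<lambda>\<beta>. \<kappa> (c \<beta>) \<otimes>\<^bsub>A\<^esub> F \<beta>)) i = c i \<otimes> F i x" if "i \<in> B" for i
      using c F x that by (simp add: fun_ring_simps kappa_apply)
  qed simp
  finally show ?thesis .
qed

lemma eval_xsum:
  assumes c: "c \<in> B \<rightarrow> carrier L" and x: "x \<in> D"
  shows "(\<Oplus>\<^bsub>A\<^esub>\<beta>\<in>B. \<kappa> (c \<beta>) \<otimes>\<^bsub>A\<^esub> xmon \<beta>) x = (\<Oplus>\<beta>\<in>B. c \<beta> \<otimes> mpow L {..<k} x \<beta>)"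
proof -
  interpret h: ring_hom_cring A L "\<lambda>F. F x" using x by (rule eval_hom)
  have "xmon \<beta> x = mpow L {..<k} x \<beta>" for \<beta>
    using h.hom_mpow[OF xs_carrier, of \<beta>] x by (simp add: xs_apply)
  then show ?thesis using eval_sum[OF c _ x, of xmon] by simp
qed

lemma mpoly_PF:
  assumes p: "p \<in> mpolys L k"
  shows "\<exists>F\<in>PF. \<forall>x\<in>D. F x = mpoly_eval L k p x"
proof
  let ?B = "{\<alpha>. p \<alpha> \<noteq> \<zero>}" and ?F = "\<Oplus>\<^bsub>A\<^esub>\<beta>\<in>{\<alpha>. p \<alpha> \<noteq> \<zero>}. \<kappa> (p \<beta>) \<otimes>\<^bsub>A\<^esub> xmon \<beta>"
  have pc: "p \<in> ?B \<rightarrow> carrier L" using p by (auto simp: mpolys_def)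
  show "\<forall>x\<in>D. ?F x = mpoly_eval L k p x"
    using eval_xsum[OF pc] by (simp add: mpoly_eval_def mpow_def)
  show "?F \<in> PF" using sp_xmon_PF[OF s.sp_finsumI[OF xmon_image pc]] .
qed

lemma PF_mpoly:
  assumes F: "F \<in> PF"
  shows "\<exists>p\<in>mpolys L k. \<forall>x\<in>D. mpoly_eval L k p x = F x"
proof -
  obtain e where "F \<in> s.sp (xmon ` monoms k e)" using PF_degree[OF F] by blast
  then obtain c where c: "c \<in> monoms k e \<rightarrow> carrier L"
    "F = (\<Oplus>\<^bsub>A\<^esub>\<beta>\<in>monoms k e. \<kappa> (c \<beta>) \<otimes>\<^bsub>A\<^esub> xmon \<beta>)"
    using s.sp_finite_imageD[OF _ xmon_image finite_monoms] by blast
  define p where "p \<alpha> = (if \<alpha> \<in> monoms k e then c \<alpha> else \<zero>)" for \<alpha>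
  have sub: "{\<alpha>. p \<alpha> \<noteq> \<zero>} \<subseteq> monoms k e" by (auto simp: p_def)
  have pm: "p \<in> mpolys L k"
    using c(1) finite_subset[OF sub finite_monoms] sub by (auto simp: mpolys_def p_def monoms_def)
  have "mpoly_eval L k p x = F x" if x: "x \<in> D" for x
  proof -
    have xL: "x \<in> {..<k} \<rightarrow> carrier L" using x by (auto simp: aff_def)
    have "mpoly_eval L k p x = (\<Oplus>\<alpha>\<in>{\<alpha>. p \<alpha> \<noteq> \<zero>}. p \<alpha> \<otimes> mpow L {..<k} x \<alpha>)"
      by (simp add: mpoly_eval_def mpow_def)
    also have "\<dots> = (\<Oplus>\<alpha>\<in>monoms k e. c \<alpha> \<otimes> mpow L {..<k} x \<alpha>)"
      using sub xL c(1) finite_monoms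
      by (intro add.finprod_mono_neutral_cong_left) (auto simp: p_def Pi_def split: if_splits)
    also have "\<dots> = F x" unfolding c(2) by (rule eval_xsum[OF c(1) x, symmetric])
    finally show ?thesis .
  qed
  then show ?thesis using pm by blast
qed

lemma zar_closed_subset: "zar_closed L k Z \<Longrightarrow> Z \<subseteq> D"
  by (auto simp: zar_closed_def zero_set_def)

lemma zar_closed_separated:
  assumes Z: "zar_closed L k Z" and Z': "Z' \<subseteq> D" "\<not> Z' \<subseteq> Z"
  shows "\<exists>F\<in>PF. F \<in> vanish Z \<and> F \<notin> vanish Z'"
proof -
  obtain P where P: "P \<subseteq> mpolys L k" "Z = zero_set L k P" using Z by (auto simp: zar_closed_def)
  obtain x where x: "x \<in> Z'" "x \<in> D" "x \<notin> Z" using Z' by blast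
  then obtain p where p: "p \<in> P" "mpoly_eval L k p x \<noteq> \<zero>" using P by (auto simp: zero_set_def)
  then obtain F where F: "F \<in> PF" "\<And>y. y \<in> D \<Longrightarrow> F y = mpoly_eval L k p y"
    using mpoly_PF[of p] P by blast
  have "F \<in> vanish Z" using F p P PF_closed by (auto simp: vanish_def zero_set_def)
  moreover have "F x \<noteq> \<zero>" using F(2)[OF x(2)] p(2) by simp
  then have "F \<notin> vanish Z'" using x(1) by (auto simp: vanish_def)
  ultimately show ?thesis using F by blast
qed

text \<open>The zeros of \<open>F\<close> and of \<open>G\<close> inside \<open>Z\<close> are closed
  and together cover \<open>Z\<close>, so one of them is all of \<open>Z\<close>.\<close>

lemma irreducible_prime:
  assumes Z: "zar_irreducible L k Z" and F: "F \<in> PF" and G: "G \<in> PF" and FG: "F \<otimes>\<^bsub>A\<^esub> G \<in> vanish Z"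
  shows "F \<in> vanish Z \<or> G \<in> vanish Z"
proof -
  have cl: "zar_closed L k {x \<in> Z. F x = \<zero>}" if F: "F \<in> PF" for F
  proof -
    obtain P where P: "P \<subseteq> mpolys L k" "Z = zero_set L k P" using Z by (auto simp: zar_closed_def zar_irreducible_def)
    obtain p where p: "p \<in> mpolys L k" "\<And>x. x \<in> D \<Longrightarrow> mpoly_eval L k p x = F x" using PF_mpoly[OF F] by blast
    have "{x \<in> Z. F x = \<zero>} = zero_set L k (insert p P)" using P p by (auto simp: zero_set_def)
    then show ?thesis unfolding zar_closed_def using P p by (intro exI[of _ "insert p P"]) auto
  qed
  have ZD: "Z \<subseteq> D" using Z zar_closed_subset by (auto simp: zar_irreducible_def)
  have "F x = \<zero> \<or> G x = \<zero>" if x: "x \<in> Z" for x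
  proof -
    have "F x \<in> carrier L" "G x \<in> carrier L" using A_apply PF_closed F G x ZD by auto
    moreover have "x \<in> D" using x ZD by blast
    moreover have "(F \<otimes>\<^bsub>A\<^esub> G) x = \<zero>" using FG x by (simp add: vanish_def)
    ultimately have "F x \<otimes> G x = \<zero>" "F x \<in> carrier L" "G x \<in> carrier L"
      by (simp_all add: fun_ring_simps)
    then show ?thesis using integral by blast
  qed
  then have "Z = {x \<in> Z. F x = \<zero>} \<union> {x \<in> Z. G x = \<zero>}" by blast
  then have "Z = {x \<in> Z. F x = \<zero>} \<or> Z = {x \<in> Z. G x = \<zero>}"
    using Z cl[OF F] cl[OF G] unfolding zar_irreducible_def by blast
  then show ?thesis using PF_closed[OF F] PF_closed[OF G] by (auto simp: vanish_def)
qed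

lemma vanish_add:
  assumes V: "V \<subseteq> D" and "F \<oplus>\<^bsub>A\<^esub> G \<in> vanish V" "F \<in> vanish V" "G \<in> carrier A"
  shows "G \<in> vanish V"
proof -
  have "G x = \<zero>" if x: "x \<in> V" for x
  proof -
    have "x \<in> D" using x V by auto
    then show ?thesis using assms x A_apply[of G x] by (auto simp: vanish_def fun_ring_simps)
  qed
  then show ?thesis using assms by (auto simp: vanish_def)
qed

text \<open>On \<open>Z\<close> the sum reduces to its constant term \<open>\<Psi> 0\<close>, which
  is therefore zero. Then \<open>g\<close> factors out and, not vanishing on the irreducible
  \<open>Z'\<close>, can be cancelled; this leaves a sum of smaller degree.\<close>

lemma coefficients_vanish:
  assumes Z': "zar_irreducible L k Z'" and ZZ': "Z \<subseteq> Z'"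
    and g: "g \<in> PF" "g \<in> vanish Z" "g \<notin> vanish Z'"
    and \<Psi>: "\<And>j. j \<le> E \<Longrightarrow> \<Psi> j \<in> PF" "\<And>j. \<lbrakk>j \<le> E; \<Psi> j \<in> vanish Z\<rbrakk> \<Longrightarrow> \<Psi> j = \<zero>\<^bsub>A\<^esub>"
    and sum: "(\<Oplus>\<^bsub>A\<^esub>j\<in>{..E}. \<Psi> j \<otimes>\<^bsub>A\<^esub> g [^]\<^bsub>A\<^esub> (j::nat)) \<in> vanish Z'"
  shows "\<forall>j\<le>E. \<Psi> j = \<zero>\<^bsub>A\<^esub>"
  using \<Psi> sum
proof (induction E arbitrary: \<Psi>)
  case 0
  then have "\<Psi> 0 \<in> vanish Z'" using PF_closed by simp
  then show ?case using 0 ZZ' by (auto simp: vanish_def)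
next
  case (Suc E)
  have Z'D: "Z' \<subseteq> D" using Z' zar_closed_subset by (auto simp: zar_irreducible_def)
  have gc: "g \<in> carrier A" using g PF_closed by simp
  have pc: "\<And>j. j \<le> Suc E \<Longrightarrow> \<Psi> j \<in> carrier A" using Suc.prems PF_closed by simp
  define R where "R = (\<Oplus>\<^bsub>A\<^esub>j\<in>{..E}. \<Psi> (Suc j) \<otimes>\<^bsub>A\<^esub> g [^]\<^bsub>A\<^esub> j)"
  have R: "R \<in> PF"
    unfolding R_def using Suc.prems g by (intro s.sp_finsum xmon_image PF_mult PF_pow) auto
  have "(\<Oplus>\<^bsub>A\<^esub>j\<in>{..Suc E}. \<Psi> j \<otimes>\<^bsub>A\<^esub> g [^]\<^bsub>A\<^esub> j) =
     (\<Oplus>\<^bsub>A\<^esub>j\<in>{..E}. \<Psi> (Suc j) \<otimes>\<^bsub>A\<^esub> g [^]\<^bsub>A\<^esub> Suc j) \<oplus>\<^bsub>A\<^esub> \<Psi> 0 \<otimes>\<^bsub>A\<^esub> g [^]\<^bsub>A\<^esub> (0::nat)"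
    using pc gc by (intro s.finsum_Suc2) auto
  also have "(\<Oplus>\<^bsub>A\<^esub>j\<in>{..E}. \<Psi> (Suc j) \<otimes>\<^bsub>A\<^esub> g [^]\<^bsub>A\<^esub> Suc j) = (\<Oplus>\<^bsub>A\<^esub>j\<in>{..E}. g \<otimes>\<^bsub>A\<^esub> (\<Psi> (Suc j) \<otimes>\<^bsub>A\<^esub> g [^]\<^bsub>A\<^esub> j))"
    using pc gc by (intro s.finsum_cong') (auto simp: s.m_ac)
  also have "\<dots> = g \<otimes>\<^bsub>A\<^esub> R"
    unfolding R_def using pc gc by (intro s.finsum_rdistr[symmetric]) auto
  finally have eq: "(\<Oplus>\<^bsub>A\<^esub>j\<in>{..Suc E}. \<Psi> j \<otimes>\<^bsub>A\<^esub> g [^]\<^bsub>A\<^esub> j) = g \<otimes>\<^bsub>A\<^esub> R \<oplus>\<^bsub>A\<^esub> \<Psi> 0"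
    using pc by simp
  have Rc: "R \<in> carrier A" using R PF_closed by simp
  have gR: "g \<otimes>\<^bsub>A\<^esub> R \<in> vanish Z"
    using vanish_mult[of Z g R] g Rc ZZ' Z'D gc by (simp add: s.m_comm)
  have gRZ: "g \<otimes>\<^bsub>A\<^esub> R \<oplus>\<^bsub>A\<^esub> \<Psi> 0 \<in> vanish Z"
    using Suc.prems(3) ZZ' unfolding eq by (auto simp: vanish_def)
  have "\<Psi> 0 \<in> vanish Z"
    by (rule vanish_add[OF subset_trans[OF ZZ' Z'D] gRZ gR pc]) simp
  then have P0: "\<Psi> 0 = \<zero>\<^bsub>A\<^esub>" using Suc.prems by simp
  then have "g \<otimes>\<^bsub>A\<^esub> R \<in> vanish Z'" using Suc.prems(3) gc Rc unfolding eq by simp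
  then have "R \<in> vanish Z'" using irreducible_prime[OF Z' g(1) R] g by blast
  then have "\<forall>j\<le>E. \<Psi> (Suc j) = \<zero>\<^bsub>A\<^esub>"
    using Suc.prems unfolding R_def by (intro Suc.IH) auto
  then show ?case using P0 by (auto simp: less_Suc_eq_0_disj simp flip: less_Suc_eq_le)
qed

text \<open>Each step of the chain contributes a function that vanishes on the smaller set but not
  on the larger. The relation is read as a polynomial in the last function;
  \<open>coefficients_vanish\<close> makes its coefficients zero, and these are relations between
  the remaining functions on the next smaller set.\<close>

lemma chain_independent:
  assumes Z: "\<And>i. i \<le> n \<Longrightarrow> zar_irreducible L k (Z i)" "\<And>i. i < n \<Longrightarrow> Z i \<subseteq> Z (Suc i)"
    and g: "\<And>i. i < n \<Longrightarrow> g i \<in> PF \<and> g i \<in> vanish (Z i) \<and> g i \<notin> vanish (Z (Suc i))"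
    and c: "c \<in> box {..<n} E \<rightarrow> carrier L" and v: "bpol A \<kappa> {..<n} g E c \<in> vanish (Z n)"
    and \<beta>: "\<beta> \<in> box {..<n} E"
  shows "c \<beta> = \<zero>"
  using assms
proof (induction n arbitrary: c \<beta>)
  case 0
  obtain x where x: "x \<in> Z 0" using 0 by (auto simp: zar_irreducible_def)
  have xD: "x \<in> D" using x 0 zar_closed_subset by (auto simp: zar_irreducible_def)
  have b: "box {..<0} E = {\<lambda>_. 0}" by (auto simp: box_iff)
  then have b0: "\<beta> = (\<lambda>_. 0)" using 0 by simp
  have c0: "c \<beta> \<in> carrier L" using 0 by auto
  have "bpol A \<kappa> {..<0} g E c = \<kappa> (c \<beta>)"
    unfolding bpol_def b using c0 by (simp add: mpow_def b0)
  then show ?case using 0 x xD by (auto simp: vanish_def kappa_apply)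
next
  case (Suc n)
  let ?W = "{..<n}"
  define cj where "cj j \<beta> = c (\<beta>(n := j))" for j \<beta>
  have ins: "{..<Suc n} = insert n ?W" by auto
  have cj: "cj j \<in> box ?W E \<rightarrow> carrier L" if "j \<le> E" for j
    unfolding cj_def
    using that by (intro funcsetI funcset_mem[OF Suc.prems(4)]) (auto simp: box_iff less_Suc_eq)
  have gPF: "g i \<in> PF" if "i < Suc n" for i using Suc.prems(3)[OF that] by simp
  have gc: "g \<in> {..<Suc n} \<rightarrow> carrier A" using gPF PF_closed by auto
  define \<Psi> where "\<Psi> j = bpol A \<kappa> ?W g E (cj j)" for j
  \<comment> \<open>The induction hypothesis for one coefficient. It serves twice: as a premise of
    \<open>coefficients_vanish\<close>, and to descend from \<open>\<Psi>\<close> to the scalars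
    \<open>c\<close> at the end.\<close>
  have zero: "cj j \<gamma> = \<zero>" if "j \<le> E" "\<Psi> j \<in> vanish (Z n)" "\<gamma> \<in> box ?W E" for j \<gamma>
    using that Suc.prems cj[OF that(1)] unfolding \<Psi>_def by (intro Suc.IH[of "cj j"]) auto
  have P: "\<forall>j\<le>E. \<Psi> j = \<zero>\<^bsub>A\<^esub>"
  proof (rule coefficients_vanish)
    show "zar_irreducible L k (Z (Suc n))" "Z n \<subseteq> Z (Suc n)" "g n \<in> PF" "g n \<in> vanish (Z n)"
      "g n \<notin> vanish (Z (Suc n))" using Suc.prems by auto
    show "\<Psi> j \<in> PF" if "j \<le> E" for j
      unfolding \<Psi>_def using gPF cj[OF that] by (intro PF_bpol) auto
    show "\<Psi> j = \<zero>\<^bsub>A\<^esub>" if "j \<le> E" "\<Psi> j \<in> vanish (Z n)" for j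
    proof -
      have "\<Psi> j = (\<Oplus>\<^bsub>A\<^esub>\<beta>\<in>box ?W E. \<zero>\<^bsub>A\<^esub>)"
        unfolding \<Psi>_def bpol_def using zero[OF that] gc
        by (intro s.finsum_cong') (auto simp: Pi_def)
      then show ?thesis by (simp add: s.finsum_zero)
    qed
    have "bpol A \<kappa> {..<Suc n} g E c = (\<Oplus>\<^bsub>A\<^esub>j\<in>{..E}. \<Psi> j \<otimes>\<^bsub>A\<^esub> g n [^]\<^bsub>A\<^esub> j)"
      unfolding ins \<Psi>_def cj_def using gc Suc.prems(4) unfolding ins by (intro s.bpol_insert) auto
    then show "(\<Oplus>\<^bsub>A\<^esub>j\<in>{..E}. \<Psi> j \<otimes>\<^bsub>A\<^esub> g n [^]\<^bsub>A\<^esub> j) \<in> vanish (Z (Suc n))" using Suc.prems(5) by simp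
  qed
  have bn: "\<beta> n \<le> E" "\<beta>(n := 0) \<in> box ?W E" using Suc.prems(6) by (auto simp: box_iff less_Suc_eq)
  have "Z n \<subseteq> D" using Suc.prems(1)[of n] zar_closed_subset by (auto simp: zar_irreducible_def)
  then have "\<Psi> (\<beta> n) \<in> vanish (Z n)" using P bn by (auto simp: vanish_def fun_ring_simps)
  then have "cj (\<beta> n) (\<beta>(n := 0)) = \<zero>" using zero bn by blast
  then show ?case by (simp add: cj_def)
qed

text \<open>A chain of length at least \<open>n\<close> would yield \<open>n\<close> functions that
  are independent on its member \<open>Z n\<close>, contained in \<open>V\<close>, against
  \<open>algebraically_dependent_on\<close>.\<close>

lemma zar_dim_less:
  assumes V: "V \<subseteq> D" and n: "n \<ge> 1"
    and el: "\<And>S. \<lbrakk>S \<subseteq> {..<k}; card S = n\<rbrakk> \<Longrightarrow> \<exists>e p. p \<in> s.sp (xmon ` box S e) \<and> p \<noteq> \<zero>\<^bsub>A\<^esub> \<and> p \<in> vanish V"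
  shows "\<not> zar_dim L k V > enat (n - 1)"
proof
  assume "zar_dim L k V > enat (n - 1)"
  then obtain m Z where m: "n - 1 < m"
    and Z': "\<forall>i\<le>m. zar_irreducible L k (Z i) \<and> Z i \<subseteq> V" "\<forall>i<m. Z i \<subset> Z (Suc i)"
    unfolding zar_dim_def less_Sup_iff by auto
  have Z: "\<And>i. i \<le> m \<Longrightarrow> zar_irreducible L k (Z i) \<and> Z i \<subseteq> V" "\<And>i. i < m \<Longrightarrow> Z i \<subset> Z (Suc i)"
    using Z' by blast+
  have nm: "n \<le> m" using m n by simp
  have "\<exists>F\<in>PF. F \<in> vanish (Z i) \<and> F \<notin> vanish (Z (Suc i))" if "i < n" for i
    using that nm Z(1)[of i] Z(1)[of "Suc i"] Z(2)[of i] V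
    by (intro zar_closed_separated) (auto simp: zar_irreducible_def)
  then obtain g where g: "\<And>i. i < n \<Longrightarrow> g i \<in> PF \<and> g i \<in> vanish (Z i) \<and> g i \<notin> vanish (Z (Suc i))"
    by metis
  obtain E c \<beta> where c: "c \<in> box {..<n} E \<rightarrow> carrier L" "\<beta> \<in> box {..<n} E" "c \<beta> \<noteq> \<zero>"
    "bpol A \<kappa> {..<n} g E c \<in> vanish V"
    using algebraically_dependent_on[OF V n el, of g] g by blast
  have "bpol A \<kappa> {..<n} g E c \<in> vanish (Z n)" using c(4) Z(1)[OF nm] by (auto simp: vanish_def)
  moreover have "zar_irreducible L k (Z i)" if "i \<le> n" for i using Z(1) that nm by auto
  moreover have "Z i \<subseteq> Z (Suc i)" if "i < n" for i using Z(2)[of i] that nm by auto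
  ultimately have "c \<beta> = \<zero>" using chain_independent[of n Z g c E \<beta>] g c by blast
  then show False using c by simp
qed

lemma ideal_vanish:
  assumes F: "\<And>i. i < t \<Longrightarrow> F i \<in> carrier A" and p: "p \<in> s.sp (ideal_gens t F)"
    and V: "V \<subseteq> D" "\<And>x i. \<lbrakk>x \<in> V; i < t\<rbrakk> \<Longrightarrow> F i x = \<zero>"
  shows "p \<in> vanish V"
proof -
  have "ideal_gens t F \<subseteq> vanish V"
  proof
    fix h assume "h \<in> ideal_gens t F"
    then obtain i \<gamma> where h: "i < t" "h = xmon \<gamma> \<otimes>\<^bsub>A\<^esub> F i" by (auto simp: ideal_gens_def)
    have "F i \<in> vanish V" using F V h by (auto simp: vanish_def)
    then show "h \<in> vanish V" unfolding h(2) by (intro vanish_mult V) auto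
  qed
  then show ?thesis using s.sp_mono p sp_vanish[OF V(1)] by blast
qed

end

section \<open>Bezout's inequality\<close>

definition exs :: "nat \<Rightarrow> (nat \<Rightarrow> nat) set" where
  "exs k = {\<alpha>. \<forall>i. k \<le> i \<longrightarrow> \<alpha> i = 0}"

definition tdeg :: "nat \<Rightarrow> (nat \<Rightarrow> nat) \<Rightarrow> nat" where
  "tdeg k \<alpha> = (\<Sum>i<k. \<alpha> i)"

lemma tdeg_add: "tdeg k (\<lambda>i. \<alpha> i + \<beta> i) = tdeg k \<alpha> + tdeg k \<beta>"
  by (simp add: tdeg_def sum.distrib)

lemma tdeg_ge: "i < k \<Longrightarrow> \<alpha> i \<le> tdeg k \<alpha>"
  unfolding tdeg_def by (intro member_le_sum) auto

lemma exs_deg_subset_box: "{\<alpha> \<in> exs k. tdeg k \<alpha> \<le> n} \<subseteq> box {..<k} n"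
  using tdeg_ge by (fastforce simp: exs_def box_iff intro: order_trans)

lemma finite_exs_deg: "finite {\<alpha> \<in> exs k. tdeg k \<alpha> = n}"
  by (rule finite_subset[OF _ finite_box[of "{..<k}" n]]) (use exs_deg_subset_box in auto)

text \<open>\<open>y\<close> are coordinates centred at a point; in the polynomials in
  \<open>y\<close>, the monomials of degree at least \<open>n\<close> span the \<open>n\<close>-th
  power of the maximal ideal. The assumption \<open>parameters\<close> puts a power of each
  \<open>y i\<close> in the ideal of \<open>f\<close> up to every such power, with one exponent for
  all \<open>n\<close>. Working modulo these powers replaces localisation.\<close>

locale local_parameters = scalars +
  fixes k :: nat and y f :: "nat \<Rightarrow> 'c"
  assumes k: "k \<ge> 1"
    and y: "y \<in> {..<k} \<rightarrow> carrier A"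
    and f: "\<And>j. j < k \<Longrightarrow> f j \<in> sp (mpow A {..<k} y ` {\<gamma>. 1 \<le> tdeg k \<gamma>})"
    and indep: "\<And>B c \<beta>. \<lbrakk>finite B; B \<subseteq> exs k; c \<in> B \<rightarrow> carrier L;
        (\<Oplus>\<beta>\<in>B. \<kappa> (c \<beta>) \<otimes> mpow A {..<k} y \<beta>) = \<zero>; \<beta> \<in> B\<rbrakk> \<Longrightarrow> c \<beta> = \<zero>\<^bsub>L\<^esub>"
    and parameters: "\<And>i. i < k \<Longrightarrow> \<exists>e::nat. \<forall>n. y i [^] e \<in> sp ({mpow A {..<k} y \<gamma> \<otimes> f j |\<gamma> j. j < k} \<union>
        mpow A {..<k} y ` {\<gamma>. n \<le> tdeg k \<gamma>})"
begin

abbreviation "W \<equiv> {..<k}"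
abbreviation "ymon \<equiv> mpow A W y"
abbreviation "fmon \<equiv> mpow A W f"
abbreviation "m n \<equiv> ymon ` {\<gamma>. n \<le> tdeg k \<gamma>}"

lemma m_closed: "ymon ` P \<subseteq> carrier A"
  using y by (rule mpow_image)

lemma f_carrier: "f \<in> W \<rightarrow> carrier A"
  using f sp_closed[OF m_closed] by auto

lemma ymon_carrier [simp]: "ymon \<gamma> \<in> carrier A"
  using y by simp

lemma fmon_carrier [simp]: "fmon \<gamma> \<in> carrier A"
  using f_carrier by simp

lemma ymon_add: "ymon (\<lambda>i. \<alpha> i + \<beta> i) = ymon \<alpha> \<otimes> ymon \<beta>"
  using y by (rule mpow_add)

lemma fmon_add: "fmon (\<lambda>i. \<alpha> i + \<beta> i) = fmon \<alpha> \<otimes> fmon \<beta>"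
  using f_carrier by (rule mpow_add)

lemma m_mult: "\<lbrakk>F \<in> sp (m a); G \<in> sp (m b)\<rbrakk> \<Longrightarrow> F \<otimes> G \<in> sp (m (a + b))"
  by (rule sp_mpow_mult[OF y]) (auto simp: tdeg_add)

lemma fmon_order: "fmon \<alpha> \<in> sp (m (tdeg k \<alpha>))"
proof -
  have "fmon \<alpha> \<in> sp (m (\<Sum>i\<in>W. \<alpha> i * 1))"
    by (rule sp_mpow_power_products[where P = "\<lambda>n. {\<gamma>. n \<le> tdeg k \<gamma>}" and e = "\<lambda>_. 1", OF y])
      (use f in \<open>auto simp: tdeg_add\<close>)
  then show ?thesis by (simp add: tdeg_def)
qed

lemma ymon_fmon_order:
  assumes "n \<le> tdeg k \<gamma> + tdeg k \<alpha>"
  shows "ymon \<gamma> \<otimes> fmon \<alpha> \<in> sp (m n)"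
proof -
  have "ymon \<gamma> \<in> sp (m (tdeg k \<gamma>))" using y by (intro sp_mpow) auto
  then have mem: "ymon \<gamma> \<otimes> fmon \<alpha> \<in> sp (m (tdeg k \<gamma> + tdeg k \<alpha>))" using fmon_order by (rule m_mult)
  have sub: "{\<mu>. tdeg k \<gamma> + tdeg k \<alpha> \<le> tdeg k \<mu>} \<subseteq> {\<mu>. n \<le> tdeg k \<mu>}" using assms by auto
  show ?thesis by (rule subsetD[OF sp_mono[OF image_mono[OF sub]] mem])
qed

lemma ymon_restrict: "ymon (\<lambda>i. if i < k then \<gamma> i else 0) = ymon \<gamma>"
  using y by (intro mpow_cong) auto

lemma fmon_restrict: "fmon (\<lambda>i. if i < k then \<gamma> i else 0) = fmon \<gamma>"
  using f_carrier by (intro mpow_cong) auto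

text \<open>The \<open>(E + 1) ^ k\<close> monomials of the box have degree at most
  \<open>k * E < n\<close>. They remain independent modulo the \<open>n\<close>-th power of the
  maximal ideal, and \<open>J\<close> has too few elements to generate them.\<close>

lemma ymon_not_spanned:
  assumes J: "J \<subseteq> carrier A" "finite J" "card J < (E + 1) ^ k" and n: "k * E < n"
  shows "\<exists>\<gamma>. ymon \<gamma> \<notin> sp (J \<union> m n)"
proof (rule ccontr)
  assume neg: "\<not> ?thesis"
  let ?B = "box W E"
  have fB: "finite ?B" by (simp add: finite_box)
  obtain a where a: "a \<in> ?B \<rightarrow> carrier L" "\<exists>b\<in>?B. a b \<noteq> \<zero>\<^bsub>L\<^esub>"
    "(\<Oplus>b\<in>?B. \<kappa> (a b) \<otimes> ymon b) \<in> sp (m n)"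
    using exists_dependence[of "m n" J ?B ymon] J neg m_closed fB by (auto simp: card_box)
  \<comment> \<open>Representatives are chosen in \<open>exs k\<close>, because \<open>indep\<close>
    speaks only of such exponents.\<close>
  have mn: "m n = ymon ` {\<gamma> \<in> exs k. n \<le> tdeg k \<gamma>}"
  proof (intro equalityI subsetI)
    fix h assume "h \<in> m n"
    then obtain \<gamma> where g: "n \<le> tdeg k \<gamma>" "h = ymon \<gamma>" by auto
    then have "h = ymon (\<lambda>i. if i < k then \<gamma> i else 0)" by (simp add: ymon_restrict)
    moreover have "(\<lambda>i. if i < k then \<gamma> i else 0) \<in> {\<gamma> \<in> exs k. n \<le> tdeg k \<gamma>}"
      using g by (simp add: exs_def tdeg_def)
    ultimately show "h \<in> ymon ` {\<gamma> \<in> exs k. n \<le> tdeg k \<gamma>}" by (rule image_eqI)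
  qed auto
  then obtain B0 b where b: "finite B0" "B0 \<subseteq> {\<gamma> \<in> exs k. n \<le> tdeg k \<gamma>}" "b \<in> B0 \<rightarrow> carrier L"
    "(\<Oplus>b\<in>?B. \<kappa> (a b) \<otimes> ymon b) = (\<Oplus>\<beta>\<in>B0. \<kappa> (b \<beta>) \<otimes> ymon \<beta>)"
    using sp_imageD[OF a(3)[unfolded mn] m_closed] by (elim exE conjE)
  have dB: "tdeg k \<beta> < n" if "\<beta> \<in> ?B" for \<beta>
  proof -
    have "tdeg k \<beta> \<le> (\<Sum>i<k. E)" unfolding tdeg_def using that by (intro sum_mono) (auto simp: box_iff)
    then show ?thesis using n by simp
  qed
  have disj: "?B \<inter> B0 = {}" using dB b by fastforce
  \<comment> \<open>Moves the part of degree at least \<open>n\<close> to the other side; the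
    degrees keep the two index sets apart, so nothing in the box cancels.\<close>
  define cc where "cc \<beta> = (if \<beta> \<in> ?B then a \<beta> else \<ominus>\<^bsub>L\<^esub> b \<beta>)" for \<beta>
  have ac: "\<And>\<beta>. \<beta> \<in> ?B \<Longrightarrow> a \<beta> \<in> carrier L" and bc: "\<And>\<beta>. \<beta> \<in> B0 \<Longrightarrow> b \<beta> \<in> carrier L"
    using a b by auto
  have ccc: "cc \<in> ?B \<union> B0 \<rightarrow> carrier L" using ac bc by (auto simp: cc_def)
  have "(\<Oplus>\<beta>\<in>?B \<union> B0. \<kappa> (cc \<beta>) \<otimes> ymon \<beta>) =
      (\<Oplus>\<beta>\<in>?B. \<kappa> (cc \<beta>) \<otimes> ymon \<beta>) \<oplus> (\<Oplus>\<beta>\<in>B0. \<kappa> (cc \<beta>) \<otimes> ymon \<beta>)"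
    using fB b disj ccc by (intro finsum_Un_disjoint) (auto simp: Pi_def)
  also have "(\<Oplus>\<beta>\<in>?B. \<kappa> (cc \<beta>) \<otimes> ymon \<beta>) = (\<Oplus>\<beta>\<in>?B. \<kappa> (a \<beta>) \<otimes> ymon \<beta>)"
    using ac by (intro finsum_cong') (auto simp: cc_def)
  also have "(\<Oplus>\<beta>\<in>B0. \<kappa> (cc \<beta>) \<otimes> ymon \<beta>) = (\<Oplus>\<beta>\<in>B0. \<ominus> \<one> \<otimes> (\<kappa> (b \<beta>) \<otimes> ymon \<beta>))"
    using bc disj by (intro finsum_cong') (auto simp: cc_def l_minus)
  also have "\<dots> = \<ominus> \<one> \<otimes> (\<Oplus>\<beta>\<in>B0. \<kappa> (b \<beta>) \<otimes> ymon \<beta>)"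
    using b bc by (intro finsum_rdistr[symmetric]) auto
  also have "(\<Oplus>b\<in>?B. \<kappa> (a b) \<otimes> ymon b) \<oplus> \<dots> = \<zero>"
  proof -
    have "(\<Oplus>\<beta>\<in>B0. \<kappa> (b \<beta>) \<otimes> ymon \<beta>) \<in> carrier A" using bc by (intro finsum_closed) auto
    then show ?thesis unfolding b(4) by (simp add: l_minus r_neg)
  qed
  finally have z: "(\<Oplus>\<beta>\<in>?B \<union> B0. \<kappa> (cc \<beta>) \<otimes> ymon \<beta>) = \<zero>" .
  have "?B \<subseteq> exs k" by (auto simp: box_iff exs_def)
  then have "cc \<beta> = \<zero>\<^bsub>L\<^esub>" if "\<beta> \<in> ?B" for \<beta>
    using that b fB ccc z by (intro indep[of "?B \<union> B0" cc]) auto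
  then show False using a(2) by (auto simp: cc_def)
qed

text \<open>Otherwise one leading power product of \<open>f\<close> can be eliminated, and the products
  \<open>y\<^sup>\<gamma> f\<^sup>\<alpha>\<close> that remain are too few to span the functions modulo the \<open>n\<close>-th power of the maximal
  ideal.\<close>
lemma powers_independent:
  assumes c: "c \<in> {\<alpha> \<in> exs k. tdeg k \<alpha> = r} \<rightarrow> carrier L"
    and rel: "(\<Oplus>\<alpha>\<in>{\<alpha> \<in> exs k. tdeg k \<alpha> = r}. \<kappa> (c \<alpha>) \<otimes> fmon \<alpha>) \<in>
      sp {ymon \<delta> \<otimes> fmon \<alpha> |\<delta> \<alpha>. 1 \<le> tdeg k \<delta> \<and> tdeg k \<alpha> = r}" (is "?p \<in> sp ?R")
    and \<alpha>: "\<alpha> \<in> exs k" "tdeg k \<alpha> = r"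
  shows "c \<alpha> = \<zero>\<^bsub>L\<^esub>"
proof (rule ccontr)
  assume nz: "c \<alpha> \<noteq> \<zero>\<^bsub>L\<^esub>"
  let ?E = "{\<alpha> \<in> exs k. tdeg k \<alpha> = r}" and ?B = "Suc r"
  let ?N = "{\<alpha> \<in> ?E. c \<alpha> \<noteq> \<zero>\<^bsub>L\<^esub>}"
  have "finite ?N" by (rule finite_subset[OF _ finite_exs_deg[of k r]]) auto
  moreover have "?N \<noteq> {}" using nz \<alpha> by auto
  ultimately obtain a where a: "a \<in> ?N" "\<And>\<beta>. \<beta> \<in> ?N \<Longrightarrow> wt k ?B \<beta> \<le> wt k ?B a"
    using exists_maximizer[of ?N "wt k ?B"] by blast
  \<comment> \<open>Exponents of total degree \<open>r\<close> have entries at most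
    \<open>r\<close>, so the base \<open>Suc r\<close> makes \<open>wt\<close> injective on
    them.\<close>
  have ltB: "\<beta> i < ?B" if "\<beta> \<in> ?E" "i < k" for \<beta> i
    using tdeg_ge[OF that(2), of \<beta>] that by simp
  have Rc: "?R \<subseteq> carrier A" by auto
  let ?G = "fmon ` {\<beta>. tdeg k \<beta> = r \<and> wt k ?B \<beta> < wt k ?B a} \<union> ?R"
  have Gc: "?G \<subseteq> carrier A" using Rc by auto
  have lead: "fmon a \<in> sp ?G"
  proof -
    have "fmon a \<in> sp (fmon ` {\<beta> \<in> ?E. \<beta> \<noteq> a \<and> c \<beta> \<noteq> \<zero>\<^bsub>L\<^esub>} \<union> {?p})"
      using a c finite_exs_deg by (intro sp_leading_term) auto
    moreover have "fmon ` {\<beta> \<in> ?E. \<beta> \<noteq> a \<and> c \<beta> \<noteq> \<zero>\<^bsub>L\<^esub>} \<union> {?p} \<subseteq> sp ?G"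
    proof
      fix h assume h: "h \<in> fmon ` {\<beta> \<in> ?E. \<beta> \<noteq> a \<and> c \<beta> \<noteq> \<zero>\<^bsub>L\<^esub>} \<union> {?p}"
      show "h \<in> sp ?G"
      proof (cases "h = ?p")
        case True
        then show ?thesis using rel sp_mono[of ?R ?G] by blast
      next
        case False
        then obtain \<beta> where b: "\<beta> \<in> ?E" "\<beta> \<noteq> a" "c \<beta> \<noteq> \<zero>\<^bsub>L\<^esub>" "h = fmon \<beta>" using h by auto
        have "wt k ?B \<beta> \<noteq> wt k ?B a"
        proof
          assume eq: "wt k ?B \<beta> = wt k ?B a"
          have "\<beta> i = a i" if "i < k" for i
            using wt_inj[of k \<beta> ?B a, OF ltB[OF b(1)] ltB[of a] eq that] a(1) by auto
          moreover have "\<beta> i = a i" if "\<not> i < k" for i using that a(1) b(1) by (auto simp: exs_def)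
          ultimately have "\<beta> = a" by blast
          then show False using b by simp
        qed
        then have "wt k ?B \<beta> < wt k ?B a" using a(2)[of \<beta>] b by auto
        then have "h \<in> ?G" using b by auto
        then show ?thesis by (rule sp_base[OF Gc])
      qed
    qed
    ultimately show ?thesis using sp_sub[OF Gc] by blast
  qed
  define e where "e i = (SOME e::nat. \<forall>n. y i [^] e \<in> sp ({ymon \<gamma> \<otimes> f j |\<gamma> j. j < k} \<union> m n))" for i
  have e: "y i [^] e i \<in> sp ({ymon \<gamma> \<otimes> f j |\<gamma> j. j < k} \<union> m n)" if "i < k" for i n
    using someI_ex[OF parameters[OF that]] unfolding e_def by (rule spec)
  \<comment> \<open>By pigeonhole a \<open>\<gamma>\<close> of degree at least \<open>e0\<close> has
    some \<open>\<gamma> i \<ge> e i\<close>, where \<open>parameters\<close> applies.\<close>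
  define e0 where "e0 = Suc (\<Sum>i<k. e i)"
  \<comment> \<open>Normal forms: the degree of \<open>\<gamma>\<close> is bounded and
    \<open>\<alpha>\<close> is not divisible by the leading exponent \<open>a\<close>. Since one
    entry of \<open>\<alpha>\<close> is then bounded independently of \<open>n\<close>, their number
    grows only like \<open>n^(k - 1)\<close>.\<close>
  define std where "std n = {ymon \<gamma> \<otimes> fmon \<alpha> |\<gamma> \<alpha>. \<gamma> \<in> exs k \<and> tdeg k \<gamma> < e0 \<and> \<alpha> \<in> exs k \<and>
     tdeg k \<alpha> < n \<and> (\<exists>i<k. \<alpha> i < a i)}" for n
  have stdc: "std n \<subseteq> carrier A" for n by (auto simp: std_def)
  have reduce: "ymon \<gamma> \<otimes> fmon \<alpha> \<in> sp (std n \<union> m n)" for \<gamma> \<alpha> n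
  \<comment> \<open>a rewriting step raises the degree of \<open>\<alpha>\<close>, or raises that of \<open>\<gamma>\<close> only, or lowers the weight of \<open>\<alpha>\<close> only\<close>
  proof (induction "(\<gamma>, \<alpha>)" arbitrary: \<gamma> \<alpha>
      rule: wf_induct_rule[OF wf_measures[of "[\<lambda>(\<gamma>, \<alpha>). n - tdeg k \<alpha>, \<lambda>(\<gamma>, \<alpha>). n - tdeg k \<gamma>, \<lambda>(\<gamma>, \<alpha>). wt k ?B \<alpha>]"]])
    case (1 \<gamma> \<alpha>)
    have Tc: "std n \<union> m n \<subseteq> carrier A" using stdc m_closed by auto
    have mT: "sp (m n) \<subseteq> sp (std n \<union> m n)" by (rule sp_mono) auto
    show ?case
    proof (cases "n \<le> tdeg k \<gamma> + tdeg k \<alpha>")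
      case True
      then show ?thesis using ymon_fmon_order mT by blast
    next
      case small: False
      show ?thesis
      proof (cases "tdeg k \<gamma> < e0")
        case False
        have "\<exists>i<k. e i \<le> \<gamma> i"
        proof (rule ccontr)
          assume "\<not> ?thesis"
          then have "tdeg k \<gamma> \<le> (\<Sum>i<k. e i)" unfolding tdeg_def by (intro sum_mono) auto
          then show False using False by (simp add: e0_def)
        qed
        then obtain i where i: "i < k" "e i \<le> \<gamma> i" by auto
        define \<gamma>' where "\<gamma>' = \<gamma>(i := \<gamma> i - e i)"
        have "\<gamma> = (\<lambda>j. \<gamma>' j + (if j = i then e i else 0))" using i by (auto simp: \<gamma>'_def)
        then have "ymon \<gamma> = ymon \<gamma>' \<otimes> y i [^] e i"
          using ymon_add[of \<gamma>' "\<lambda>j. if j = i then e i else 0"] mpow_single[of W i y "e i"] i y by simp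
        then have "ymon \<gamma> \<otimes> fmon \<alpha> = (ymon \<gamma>' \<otimes> fmon \<alpha>) \<otimes> y i [^] e i"
          using i y by (simp add: m_ac Pi_def)
        also have "\<dots> \<in> sp (std n \<union> m n)"
        proof (rule sp_mult_base[OF Tc _ _ _ e[OF i(1), of n]])
          show "{ymon \<gamma> \<otimes> f j |\<gamma> j. j < k} \<union> m n \<subseteq> carrier A" using f_carrier m_closed by auto
          fix g assume "g \<in> {ymon \<gamma> \<otimes> f j |\<gamma> j. j < k} \<union> m n"
          then consider \<delta> j where "j < k" "g = ymon \<delta> \<otimes> f j" | \<delta> where "n \<le> tdeg k \<delta>" "g = ymon \<delta>" by auto
          then show "ymon \<gamma>' \<otimes> fmon \<alpha> \<otimes> g \<in> sp (std n \<union> m n)"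
          proof cases
            case 1
            let ?g = "\<lambda>l. \<gamma>' l + \<delta> l" and ?a = "\<lambda>l. \<alpha> l + (if l = j then 1 else 0)"
            have "tdeg k ?a = Suc (tdeg k \<alpha>)" using 1(1) by (simp add: tdeg_add) (simp add: tdeg_def)
            then have "n - tdeg k ?a < n - tdeg k \<alpha>" using small by linarith
            then have "ymon ?g \<otimes> fmon ?a \<in> sp (std n \<union> m n)"
              by (intro "1.hyps") simp
            moreover have "fmon ?a = fmon \<alpha> \<otimes> f j"
              using fmon_add[of \<alpha> "\<lambda>l. if l = j then 1 else 0"] mpow_single[of W j f 1] 1(1) f_carrier
              by (simp add: Pi_def)
            then have "ymon ?g \<otimes> fmon ?a = ymon \<gamma>' \<otimes> fmon \<alpha> \<otimes> g"
              using 1 f_carrier ymon_add[of \<gamma>' \<delta>] by (simp add: m_ac Pi_def)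
            ultimately show ?thesis by simp
          next
            case 2
            have "ymon \<gamma>' \<otimes> fmon \<alpha> \<otimes> g = ymon (\<lambda>l. \<gamma>' l + \<delta> l) \<otimes> fmon \<alpha>"
              using 2 ymon_add[of \<gamma>' \<delta>] by (simp add: m_ac)
            also have "\<dots> \<in> sp (m n)" using 2 by (intro ymon_fmon_order) (simp add: tdeg_add)
            finally show ?thesis using mT by blast
          qed
        qed simp
        finally show ?thesis .
      next
        case low: True
        show ?thesis
        proof (cases "\<exists>i<k. \<alpha> i < a i")
          case True
          let ?g = "\<lambda>i. if i < k then \<gamma> i else 0" and ?a = "\<lambda>i. if i < k then \<alpha> i else 0"
          have "ymon ?g \<otimes> fmon ?a \<in> std n"
          proof -
            have "?g \<in> exs k" "?a \<in> exs k" "tdeg k ?g = tdeg k \<gamma>" "tdeg k ?a = tdeg k \<alpha>"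
              by (simp_all add: exs_def tdeg_def)
            moreover have "\<exists>i<k. ?a i < a i" using True by auto
            moreover have "tdeg k \<alpha> < n" using small by linarith
            ultimately show ?thesis unfolding std_def using low
              by (intro CollectI exI[of _ ?g] exI[of _ ?a] conjI refl) simp_all
          qed
          then have "ymon ?g \<otimes> fmon ?a \<in> sp (std n \<union> m n)" by (intro sp_base[OF Tc] UnI1)
          then show ?thesis by (simp add: ymon_restrict fmon_restrict)
        next
          case False
          define \<alpha>' where "\<alpha>' i = \<alpha> i - a i" for i
          have le: "a i \<le> \<alpha> i" for i
            using False a(1) by (cases "i < k") (auto simp: exs_def not_less)
          have al: "\<alpha> = (\<lambda>i. \<alpha>' i + a i)" using le by (auto simp: \<alpha>'_def)
          have dal: "tdeg k \<alpha> = tdeg k \<alpha>' + r" using a(1) by (subst al) (simp add: tdeg_add)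
          have wal: "wt k ?B \<alpha> = wt k ?B \<alpha>' + wt k ?B a" by (subst al) (rule wt_add)
          have "fmon \<alpha> = fmon \<alpha>' \<otimes> fmon a" by (subst al) (rule fmon_add)
          then have "ymon \<gamma> \<otimes> fmon \<alpha> = (ymon \<gamma> \<otimes> fmon \<alpha>') \<otimes> fmon a" by (simp add: m_assoc)
          also have "\<dots> \<in> sp (std n \<union> m n)"
          proof (rule sp_mult_base[OF Tc Gc _ _ lead])
            fix g assume "g \<in> ?G"
            then consider \<beta> where "tdeg k \<beta> = r" "wt k ?B \<beta> < wt k ?B a" "g = fmon \<beta>"
              | \<delta> \<beta> where "1 \<le> tdeg k \<delta>" "tdeg k \<beta> = r" "g = ymon \<delta> \<otimes> fmon \<beta>" by blast
            then show "ymon \<gamma> \<otimes> fmon \<alpha>' \<otimes> g \<in> sp (std n \<union> m n)"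
            proof cases
              case 1
              let ?a = "\<lambda>i. \<alpha>' i + \<beta> i"
              have "tdeg k ?a = tdeg k \<alpha>" "wt k ?B ?a < wt k ?B \<alpha>"
                using 1 dal wal by (simp_all add: tdeg_add wt_add)
              then have "ymon \<gamma> \<otimes> fmon ?a \<in> sp (std n \<union> m n)" by (intro "1.hyps") simp
              then show ?thesis using 1 fmon_add[of \<alpha>' \<beta>] by (simp add: m_assoc)
            next
              case 2
              let ?a = "\<lambda>i. \<alpha>' i + \<beta> i" and ?g = "\<lambda>i. \<gamma> i + \<delta> i"
              have "tdeg k ?a = tdeg k \<alpha>" "tdeg k ?g = tdeg k \<gamma> + tdeg k \<delta>"
                using 2 dal by (simp_all add: tdeg_add)
              moreover from this have "n - tdeg k ?g < n - tdeg k \<gamma>" using small 2 by linarith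
              ultimately have "ymon ?g \<otimes> fmon ?a \<in> sp (std n \<union> m n)"
                by (intro "1.hyps") simp
              then show ?thesis using 2 fmon_add[of \<alpha>' \<beta>] ymon_add[of \<gamma> \<delta>] by (simp add: m_ac)
            qed
          qed simp
          finally show ?thesis .
        qed
      qed
    qed
  qed
  \<comment> \<open>With \<open>n = k * C + 1\<close>, and hence
    \<open>n + 1 \<le> (C + 1) * (k + 2)\<close>, the count of normal forms becomes at most
    \<open>C * (C + 1) ^ (k - 1)\<close>, which is less than the \<open>(C + 1) ^ k\<close> required
    for spanning.\<close>
  define C where "C = (e0 + 1) ^ k * (k * r * (k + 2) ^ (k - 1))"
  define n where "n = Suc (k * C)"
  let ?P = "{\<gamma> \<in> exs k. tdeg k \<gamma> < e0}" and ?Q = "{\<alpha> \<in> exs k. tdeg k \<alpha> < n \<and> (\<exists>i<k. \<alpha> i < a i)}"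
  let ?S = "\<lambda>i j. if j = i then {..<a i} else {..n}"
  have P: "?P \<subseteq> box W e0" using exs_deg_subset_box[of k e0] by auto
  have cP: "finite ?P" "card ?P \<le> (e0 + 1) ^ k"
    using card_mono[OF finite_box P] finite_subset[OF P finite_box] by (auto simp: card_box)
  have Q: "?Q \<subseteq> (\<Union>i<k. exps W (?S i))"
  proof
    fix \<alpha> assume al: "\<alpha> \<in> ?Q"
    then obtain i where i: "i < k" "\<alpha> i < a i" by auto
    have "\<alpha> j \<le> n" if "j < k" for j using tdeg_ge[OF that, of \<alpha>] al by simp
    then have "\<alpha> \<in> exps W (?S i)" using al i by (auto simp: exps_def exs_def)
    then show "\<alpha> \<in> (\<Union>i<k. exps W (?S i))" using i by blast
  qed
  have fS: "finite (exps W (?S i))" for i by (intro finite_exps) auto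
  have cQ: "finite ?Q" using finite_subset[OF Q] fS by auto
  have "card ?Q \<le> card (\<Union>i<k. exps W (?S i))" using Q fS by (intro card_mono) auto
  also have "\<dots> \<le> (\<Sum>i<k. card (exps W (?S i)))" by (intro card_UN_le) auto
  also have "\<dots> \<le> (\<Sum>i<k. r * (n + 1) ^ (k - 1))"
  proof (intro sum_mono)
    fix i assume i: "i \<in> W"
    have "card (exps W (?S i)) = (\<Prod>j\<in>W. card (?S i j))" by (intro card_exps) auto
    also have "\<dots> = card (?S i i) * (\<Prod>j\<in>W - {i}. card (?S i j))" using i by (intro prod.remove) auto
    also have "(\<Prod>j\<in>W - {i}. card (?S i j)) = (\<Prod>j\<in>W - {i}. n + 1)" by (intro prod.cong) auto
    also have "card (?S i i) * \<dots> \<le> r * (n + 1) ^ (k - 1)"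
      using i tdeg_ge[of i k a] a(1) by (intro mult_le_mono) (auto simp: card_Diff_singleton)
    finally show "card (exps W (?S i)) \<le> r * (n + 1) ^ (k - 1)" .
  qed
  also have "\<dots> = k * r * (n + 1) ^ (k - 1)" by simp
  finally have cQ': "card ?Q \<le> k * r * (n + 1) ^ (k - 1)" .
  have std_eq: "std n = (\<lambda>(\<gamma>, \<alpha>). ymon \<gamma> \<otimes> fmon \<alpha>) ` (?P \<times> ?Q)" by (auto simp: std_def)
  have "card (std n) \<le> card ?P * card ?Q"
    unfolding std_eq using card_image_le[of "?P \<times> ?Q"] cP cQ by (auto simp: card_cartesian_product)
  also have "\<dots> \<le> (e0 + 1) ^ k * (k * r * (n + 1) ^ (k - 1))" using cP cQ' by (intro mult_le_mono)
  also have "\<dots> \<le> (e0 + 1) ^ k * (k * r * ((C + 1) * (k + 2)) ^ (k - 1))"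
    by (intro mult_le_mono order_refl power_mono) (auto simp: n_def algebra_simps)
  also have "\<dots> = ((e0 + 1) ^ k * (k * r * (k + 2) ^ (k - 1))) * (C + 1) ^ (k - 1)"
    by (simp only: power_mult_distrib ac_simps)
  also have "\<dots> = C * (C + 1) ^ (k - 1)" by (simp only: C_def)
  also have "\<dots> < (C + 1) * (C + 1) ^ (k - 1)" by simp
  also have "\<dots> = (C + 1) ^ k" using k by (metis power_eq_if not_one_le_zero)
  finally have "card (std n) < (C + 1) ^ k" .
  moreover have "finite (std n)" unfolding std_eq using cP cQ by auto
  ultimately obtain \<gamma> where "ymon \<gamma> \<notin> sp (std n \<union> m n)"
    using ymon_not_spanned[OF stdc, of n C n] by (auto simp: n_def)
  moreover have "ymon \<gamma> \<otimes> fmon (\<lambda>_. 0) = ymon \<gamma>" by (simp add: mpow_zero)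
  ultimately show False using reduce[of \<gamma> "\<lambda>_. 0" n] by simp
qed

end

section \<open>Local coordinates at a zero of the system\<close>

lemma (in scalars) sp_empty: "F \<in> sp {} \<Longrightarrow> F = \<zero>"
  by (induction rule: sp.induct) auto

text \<open>Splits off the lowest power of \<open>Y\<close>. If \<open>Y\<close> vanishes at a
  point, the cofactor \<open>a + Y R\<close> with \<open>a \<noteq> 0\<close> is a unit in the local
  ring there.\<close>

lemma (in scalars) univariate_lowest_term:
  assumes Y: "Y \<in> carrier A" and c: "c \<in> {..e} \<rightarrow> carrier L"
    and nz: "(\<Oplus>j\<in>{..e}. \<kappa> (c j) \<otimes> Y [^] (j::nat)) \<noteq> \<zero>"
  shows "\<exists>j0::nat. \<exists>a\<in>carrier L. \<exists>R\<in>sp (range (\<lambda>j::nat. Y [^] j)). a \<noteq> \<zero>\<^bsub>L\<^esub> \<and>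
    (\<Oplus>j\<in>{..e}. \<kappa> (c j) \<otimes> Y [^] j) = Y [^] j0 \<otimes> (\<kappa> a \<oplus> Y \<otimes> R)"
  using c nz
proof (induction e arbitrary: c)
  case 0
  then have "c 0 \<in> carrier L" by auto
  then show ?case using 0 Y
    by (intro exI[of _ 0] bexI[of _ "c 0"] bexI[of _ "\<zero>"]) (auto intro: sp_zero)
next
  case (Suc e)
  have cc: "\<And>j. j \<le> Suc e \<Longrightarrow> c j \<in> carrier L" using Suc.prems by auto
  define R where "R = (\<Oplus>j\<in>{..e}. \<kappa> (c (Suc j)) \<otimes> Y [^] j)"
  have Pc: "range (\<lambda>j::nat. Y [^] j) \<subseteq> carrier A" using Y by auto
  have R: "R \<in> sp (range (\<lambda>j::nat. Y [^] j))"
    unfolding R_def using cc by (intro sp_finsum[OF Pc] sp_smult[OF Pc] sp_base[OF Pc]) auto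
  then have Rc: "R \<in> carrier A" using sp_closed[OF Pc] by blast
  have "(\<Oplus>j\<in>{..Suc e}. \<kappa> (c j) \<otimes> Y [^] j) = (\<Oplus>j\<in>{..e}. \<kappa> (c (Suc j)) \<otimes> Y [^] Suc j) \<oplus> \<kappa> (c 0) \<otimes> Y [^] (0::nat)"
    using cc Y by (intro finsum_Suc2) auto
  also have "(\<Oplus>j\<in>{..e}. \<kappa> (c (Suc j)) \<otimes> Y [^] Suc j) = (\<Oplus>j\<in>{..e}. Y \<otimes> (\<kappa> (c (Suc j)) \<otimes> Y [^] j))"
    using cc Y by (intro finsum_cong') (auto simp: m_ac)
  also have "\<dots> = Y \<otimes> R" unfolding R_def using cc Y by (intro finsum_rdistr[symmetric]) auto
  finally have eq: "(\<Oplus>j\<in>{..Suc e}. \<kappa> (c j) \<otimes> Y [^] j) = \<kappa> (c 0) \<oplus> Y \<otimes> R"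
    using cc Y Rc by (simp add: a_comm)
  show ?case
  proof (cases "c 0 = \<zero>\<^bsub>L\<^esub>")
    case False
    then show ?thesis unfolding eq using cc R Y Rc
      by (intro exI[of _ 0] bexI[of _ "c 0"] bexI[of _ R]) auto
  next
    case True
    then have eq': "(\<Oplus>j\<in>{..Suc e}. \<kappa> (c j) \<otimes> Y [^] j) = Y \<otimes> R" unfolding eq using Y Rc by simp
    then have "R \<noteq> \<zero>" using Suc.prems(2) Y by auto
    then obtain j0 a R' where IH: "a \<in> carrier L" "R' \<in> sp (range (\<lambda>j::nat. Y [^] j))" "a \<noteq> \<zero>\<^bsub>L\<^esub>"
      "R = Y [^] (j0::nat) \<otimes> (\<kappa> a \<oplus> Y \<otimes> R')"
      using Suc.IH[of "\<lambda>j. c (Suc j)"] cc unfolding R_def by auto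
    have "R' \<in> carrier A" using IH(2) sp_closed[OF Pc] by blast
    then have "Y \<otimes> R = Y [^] Suc j0 \<otimes> (\<kappa> a \<oplus> Y \<otimes> R')"
      unfolding IH(4) using Y IH(1) by (simp add: m_ac)
    then show ?thesis unfolding eq' using IH by (intro exI[of _ "Suc j0"] bexI[of _ a] bexI[of _ R']) auto
  qed
qed

text \<open>Lets a power product of degree above \<open>r\<close> be written as one of degree
  exactly \<open>r\<close> times a remainder.\<close>

lemma tdeg_split:
  assumes "r \<le> tdeg k \<alpha>"
  shows "\<exists>\<alpha>'. (\<forall>i. \<alpha>' i \<le> \<alpha> i) \<and> tdeg k \<alpha>' = r"
  using assms
proof (induction r)
  case 0
  then show ?case by (intro exI[of _ "\<lambda>_. 0"]) (auto simp: tdeg_def)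
next
  case (Suc r)
  then obtain \<alpha>' where a: "\<And>i. \<alpha>' i \<le> \<alpha> i" "tdeg k \<alpha>' = r" by auto
  have "\<exists>i<k. \<alpha>' i < \<alpha> i"
  proof (rule ccontr)
    assume "\<not> ?thesis"
    then have "tdeg k \<alpha> \<le> tdeg k \<alpha>'" unfolding tdeg_def by (intro sum_mono) auto
    then show False using Suc.prems a by simp
  qed
  then obtain i where i: "i < k" "\<alpha>' i < \<alpha> i" by auto
  let ?b = "\<lambda>j. \<alpha>' j + (if j = i then 1 else 0)"
  have "tdeg k ?b = Suc r" using a i by (simp add: tdeg_add) (simp add: tdeg_def)
  moreover have "?b j \<le> \<alpha> j" for j using a(1)[of j] i by auto
  ultimately show ?case by (intro exI[of _ ?b]) auto
qed

context affine_space
begin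

definition xat :: "(nat \<Rightarrow> 'a) \<Rightarrow> nat \<Rightarrow> (nat \<Rightarrow> 'a) \<Rightarrow> 'a" where
  "xat P i = xs i \<ominus>\<^bsub>A\<^esub> \<kappa> (P i)"

abbreviation "pmon P \<equiv> mpow A {..<k} (xat P)"

context
  fixes P assumes P: "P \<in> D"
begin

lemma xat_closed: "i < k \<Longrightarrow> xat P i \<in> carrier A"
  using xs_closed D_apply[OF P] by (simp add: xat_def)

lemma xat_carrier: "xat P \<in> {..<k} \<rightarrow> carrier A"
  using xat_closed by auto

lemma xat_apply: "\<lbrakk>x \<in> D; i < k\<rbrakk> \<Longrightarrow> xat P i x = x i \<ominus> P i"
proof -
  assume x: "x \<in> D" "i < k"
  interpret h: ring_hom_cring A L "\<lambda>F. F x" using x(1) by (rule eval_hom)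
  show "xat P i x = x i \<ominus> P i"
    unfolding xat_def minus_eq s.minus_eq using x xs_closed D_apply[OF P] by (simp add: xs_apply kappa_apply)
qed

lemma pmon_closed [simp]: "pmon P \<gamma> \<in> carrier A"
  using xat_carrier by simp

lemma pmon_image: "pmon P ` B \<subseteq> carrier A"
  by auto

lemma xs_eq: "i < k \<Longrightarrow> xs i = xat P i \<oplus>\<^bsub>A\<^esub> \<kappa> (P i)"
  using xs_closed D_apply[OF P] by (simp add: xat_def s.minus_eq s.a_assoc s.l_neg)

lemma xs_in_pmon:
  assumes i: "i \<in> S" "S \<subseteq> {..<k}"
  shows "xs i \<in> s.sp (pmon P ` box S 1)"
proof -
  have ik: "i < k" using i by auto
  have "pmon P (\<lambda>j. if j = i then 1 else 0) \<in> s.sp (pmon P ` box S 1)"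
    using i by (intro s.sp_mpow xat_carrier) (auto simp: box_iff)
  moreover have "pmon P (\<lambda>j. if j = i then 1 else 0) = xat P i"
    using ik xat_carrier s.S.mpow_single[of "{..<k}" i "xat P" 1] xat_closed by simp
  moreover have "\<kappa> (P i) \<otimes>\<^bsub>A\<^esub> pmon P (\<lambda>_. 0) \<in> s.sp (pmon P ` box S 1)"
    using D_apply[OF P ik] by (intro s.sp_smult s.sp_mpow xat_carrier pmon_image) (auto simp: box_iff)
  moreover have "\<kappa> (P i) \<otimes>\<^bsub>A\<^esub> pmon P (\<lambda>_. 0) = \<kappa> (P i)"
    using D_apply[OF P ik] by (simp add: s.S.mpow_zero)
  ultimately show ?thesis unfolding xs_eq[OF ik] using s.sp_add[OF pmon_image] by auto
qed

lemma PF_subset_pmon: "PF \<subseteq> s.sp (range (pmon P))"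
proof (rule s.sp_sub)
  show "range xmon \<subseteq> s.sp (range (pmon P))"
  proof
    fix h assume "h \<in> range xmon"
    then obtain \<gamma> where h: "h = xmon \<gamma>" by auto
    have "xs i \<in> s.sp (range (pmon P))" if "i \<in> {..<k}" for i
      using xs_in_pmon[OF that] s.sp_mono[of "pmon P ` box {..<k} 1" "range (pmon P)"] by auto
    then show "h \<in> s.sp (range (pmon P))" unfolding h
      by (intro s.sp_mpow_power_products[where P = "\<lambda>_. UNIV" and e = "\<lambda>_. 0", OF xat_carrier]) auto
  qed
qed (rule pmon_image)

text \<open>In centred coordinates the constant term of \<open>F\<close> is its value at
  \<open>P\<close>.\<close>

lemma order_positive:
  assumes F: "F \<in> PF" "F P = \<zero>"
  shows "F \<in> s.sp (pmon P ` {\<gamma>. 1 \<le> tdeg k \<gamma>})"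
proof -
  let ?m = "pmon P ` {\<gamma>. 1 \<le> tdeg k \<gamma>}"
  have "range (pmon P) \<subseteq> insert \<one>\<^bsub>A\<^esub> ?m"
  proof
    fix h assume "h \<in> range (pmon P)"
    then obtain \<gamma> where h: "h = pmon P \<gamma>" by auto
    show "h \<in> insert \<one>\<^bsub>A\<^esub> ?m"
    proof (cases "1 \<le> tdeg k \<gamma>")
      case False
      then have "tdeg k \<gamma> = 0" by simp
      then have "pmon P \<gamma> = \<one>\<^bsub>A\<^esub>" by (intro s.S.mpow_zero) (auto simp: tdeg_def)
      then show ?thesis using h by simp
    qed (use h in auto)
  qed
  then have "F \<in> s.sp (insert \<one>\<^bsub>A\<^esub> ?m)" using F PF_subset_pmon s.sp_mono by blast
  then obtain c F' where c: "c \<in> carrier L" "F' \<in> s.sp ?m" "F = \<kappa> c \<otimes>\<^bsub>A\<^esub> \<one>\<^bsub>A\<^esub> \<oplus>\<^bsub>A\<^esub> F'"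
    using s.sp_insertD[of F "\<one>\<^bsub>A\<^esub>" ?m] pmon_image[of "{\<gamma>. 1 \<le> tdeg k \<gamma>}"] by auto
  have "?m \<subseteq> vanish {P}"
  proof
    fix h assume "h \<in> ?m"
    then obtain \<gamma> where h: "1 \<le> tdeg k \<gamma>" "h = pmon P \<gamma>" by auto
    have "\<exists>i<k. 1 \<le> \<gamma> i"
    proof (rule ccontr)
      assume "\<not> ?thesis"
      then have "tdeg k \<gamma> = 0" by (auto simp: tdeg_def not_le)
      then show False using h by simp
    qed
    then obtain i where i: "i < k" "1 \<le> \<gamma> i" by auto
    have "\<gamma> = (\<lambda>j. (\<gamma>(i := \<gamma> i - 1)) j + (if j = i then 1 else 0))" using i by auto
    then have "pmon P \<gamma> = pmon P (\<gamma>(i := \<gamma> i - 1)) \<otimes>\<^bsub>A\<^esub> pmon P (\<lambda>j. if j = i then 1 else 0)"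
      using s.S.mpow_add[OF xat_carrier, of "\<gamma>(i := \<gamma> i - 1)" "\<lambda>j. if j = i then 1 else 0"] by simp
    also have "pmon P (\<lambda>j. if j = i then 1 else 0) = xat P i"
      using i xat_carrier s.S.mpow_single[of "{..<k}" i "xat P" 1] xat_closed by simp
    finally have eq: "pmon P \<gamma> = pmon P (\<gamma>(i := \<gamma> i - 1)) \<otimes>\<^bsub>A\<^esub> xat P i" .
    have "xat P i \<in> vanish {P}"
      using i P xat_closed D_apply[OF P] by (simp add: vanish_def xat_apply minus_eq r_neg)
    then show "h \<in> vanish {P}" unfolding h(2) eq using P by (intro vanish_mult) auto
  qed
  then have "F' \<in> vanish {P}" using c(2) s.sp_mono sp_vanish[of "{P}"] P by blast
  then have F': "F' \<in> carrier A" "F' P = \<zero>" by (auto simp: vanish_def)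
  have "F P = c" unfolding c(3) using c(1) F' P by (simp add: fun_ring_simps kappa_apply)
  then have "c = \<zero>" using F by simp
  then show ?thesis using c(2) unfolding c(3) using F' by simp
qed

text \<open>Translation reduces this to ordinary monomials: their combination at \<open>u\<close> is
  the centred combination at \<open>u + P\<close>.\<close>

lemma pmon_independent:
  assumes B: "finite B" "B \<subseteq> exs k" and c: "c \<in> B \<rightarrow> carrier L"
    and z: "(\<Oplus>\<^bsub>A\<^esub>\<beta>\<in>B. \<kappa> (c \<beta>) \<otimes>\<^bsub>A\<^esub> pmon P \<beta>) = \<zero>\<^bsub>A\<^esub>" and b: "\<beta> \<in> B"
  shows "c \<beta> = \<zero>"
proof (rule monomials_independent[OF B(1) _ c _ b])
  show "\<beta> i = 0" if "\<beta> \<in> B" "k \<le> i" for \<beta> i using B that by (auto simp: exs_def)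
  show "(\<Oplus>\<^bsub>A\<^esub>\<beta>\<in>B. \<kappa> (c \<beta>) \<otimes>\<^bsub>A\<^esub> xmon \<beta>) = \<zero>\<^bsub>A\<^esub>"
  proof (rule carrier_A_eqI)
    show "(\<Oplus>\<^bsub>A\<^esub>\<beta>\<in>B. \<kappa> (c \<beta>) \<otimes>\<^bsub>A\<^esub> xmon \<beta>) \<in> carrier A" using c by (intro s.finsum_closed) (auto simp: Pi_def)
    fix u assume u: "u \<in> D"
    define x where "x = (\<lambda>i\<in>{..<k}. u i \<oplus> P i)"
    have x: "x \<in> D" using u P by (auto simp: x_def aff_def)
    interpret h: ring_hom_cring A L "\<lambda>F. F x" using x by (rule eval_hom)
    interpret h': ring_hom_cring A L "\<lambda>F. F u" using u by (rule eval_hom)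
    have "xmon \<beta> u = pmon P \<beta> x" for \<beta>
    proof -
      have "pmon P \<beta> x = mpow L {..<k} (\<lambda>i. xat P i x) \<beta>" using xat_carrier by (rule h.hom_mpow)
      also have "\<dots> = mpow L {..<k} (\<lambda>i. xs i u) \<beta>"
      proof (rule mpow_cong)
        show "(\<lambda>i. xs i u) \<in> {..<k} \<rightarrow> carrier L" using u D_apply by (auto simp: xs_apply)
        fix i assume i: "i \<in> {..<k}"
        then have "u i \<in> carrier L" "P i \<in> carrier L" using u P D_apply by auto
        then show "xat P i x = xs i u"
          using i x u by (simp add: xat_apply xs_apply) (simp add: x_def minus_eq a_assoc r_neg)
      qed simp
      also have "\<dots> = xmon \<beta> u" using xs_carrier by (rule h'.hom_mpow[symmetric])
      finally show ?thesis by simp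
    qed
    then have "(\<Oplus>\<^bsub>A\<^esub>\<beta>\<in>B. \<kappa> (c \<beta>) \<otimes>\<^bsub>A\<^esub> xmon \<beta>) u = (\<Oplus>\<^bsub>A\<^esub>\<beta>\<in>B. \<kappa> (c \<beta>) \<otimes>\<^bsub>A\<^esub> pmon P \<beta>) x"
      using eval_sum[OF c _ u, of xmon] eval_sum[OF c _ x, of "pmon P"] by simp
    then show "(\<Oplus>\<^bsub>A\<^esub>\<beta>\<in>B. \<kappa> (c \<beta>) \<otimes>\<^bsub>A\<^esub> xmon \<beta>) u = \<zero>\<^bsub>A\<^esub> u" using z u x by (simp add: fun_ring_simps)
  qed simp
qed

text \<open>The eliminant is univariate, \<open>p = Y^j0 (a + Y R)\<close> in the centred coordinate
  \<open>Y\<close>. Hence \<open>Y^j0 = p / a + Y^j0 U\<close> with \<open>U\<close> of positive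
  order, and substituting this equation into itself leaves \<open>Y^j0\<close> in the ideal of
  \<open>f\<close> up to a remainder of order \<open>n\<close>. The exponent \<open>j0\<close> is
  the same for all \<open>n\<close>.\<close>

lemma eliminant_power:
  assumes f: "\<And>j. j < t \<Longrightarrow> f j \<in> PF" and i: "i < k" and el: "has_eliminant t {i} f"
  shows "\<exists>e::nat. \<forall>n. xat P i [^]\<^bsub>A\<^esub> e \<in> s.sp ({pmon P \<gamma> \<otimes>\<^bsub>A\<^esub> f j |\<gamma> j. j < t} \<union> pmon P ` {\<gamma>. n \<le> tdeg k \<gamma>})"
proof -
  let ?G = "{pmon P \<gamma> \<otimes>\<^bsub>A\<^esub> f j |\<gamma> j. j < t}" and ?m = "\<lambda>n. pmon P ` {\<gamma>. n \<le> tdeg k \<gamma>}"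
  define Y where "Y = xat P i"
  have Y: "Y \<in> carrier A" using xat_closed[OF i] by (simp add: Y_def)
  have fc: "\<And>j. j < t \<Longrightarrow> f j \<in> carrier A" using f PF_closed by blast
  have Gc: "?G \<subseteq> carrier A" using fc by auto
  obtain e p where p: "p \<in> s.sp (xmon ` box {i} e)" "p \<noteq> \<zero>\<^bsub>A\<^esub>" "p \<in> s.sp (ideal_gens t f)"
    using el unfolding has_eliminant_def by blast
  have powc: "(\<lambda>j::nat. Y [^]\<^bsub>A\<^esub> j) ` B \<subseteq> carrier A" for B using Y by auto
  have pY: "pmon P \<beta> = Y [^]\<^bsub>A\<^esub> \<beta> i" if "\<beta> \<in> box {i} e" for \<beta> e
  proof -
    have "\<beta> = (\<lambda>j. if j = i then \<beta> i else 0)" using that by (auto simp: box_iff)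
    then show ?thesis using s.S.mpow_single[of "{..<k}" i "xat P" "\<beta> i"] i xat_carrier
      unfolding Y_def by (metis finite_lessThan lessThan_iff)
  qed
  have "xmon ` box {i} e \<subseteq> s.sp ((\<lambda>j::nat. Y [^]\<^bsub>A\<^esub> j) ` {..e})"
  proof
    fix h assume "h \<in> xmon ` box {i} e"
    then obtain \<beta> where b: "\<beta> \<in> box {i} e" "h = xmon \<beta>" by auto
    have "h = mpow A {i} xs \<beta>" unfolding b(2) using i b xs_carrier
      by (intro s.S.mpow_subset) (auto simp: box_iff)
    also have "\<dots> \<in> s.sp (pmon P ` box {i} (\<Sum>j\<in>{i}. \<beta> j * 1))"
      using xs_in_pmon[of i "{i}"] i
      by (intro s.sp_mpow_power_products[where P = "box {i}" and e = "\<lambda>_. 1", OF xat_carrier _ box_add])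
         (auto simp: box_iff)
    also have "\<dots> \<subseteq> s.sp ((\<lambda>j::nat. Y [^]\<^bsub>A\<^esub> j) ` {..e})"
    proof (rule s.sp_mono)
      show "pmon P ` box {i} (\<Sum>j\<in>{i}. \<beta> j * 1) \<subseteq> (\<lambda>j::nat. Y [^]\<^bsub>A\<^esub> j) ` {..e}"
      proof
        fix g assume "g \<in> pmon P ` box {i} (\<Sum>j\<in>{i}. \<beta> j * 1)"
        then obtain \<gamma> where g: "\<gamma> \<in> box {i} (\<beta> i)" "g = pmon P \<gamma>" by auto
        then have "g = Y [^]\<^bsub>A\<^esub> \<gamma> i" using pY by simp
        moreover have "\<gamma> i \<le> e" using g b by (auto simp: box_iff intro: order_trans)
        ultimately show "g \<in> (\<lambda>j::nat. Y [^]\<^bsub>A\<^esub> j) ` {..e}" by auto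
      qed
    qed
    finally show "h \<in> s.sp ((\<lambda>j::nat. Y [^]\<^bsub>A\<^esub> j) ` {..e})" .
  qed
  then have "p \<in> s.sp ((\<lambda>j::nat. Y [^]\<^bsub>A\<^esub> j) ` {..e})" using p(1) s.sp_sub[OF powc] by blast
  then obtain c where c: "c \<in> {..e} \<rightarrow> carrier L" "p = (\<Oplus>\<^bsub>A\<^esub>j\<in>{..e}. \<kappa> (c j) \<otimes>\<^bsub>A\<^esub> Y [^]\<^bsub>A\<^esub> j)"
    using s.sp_finite_imageD[OF _ powc] by blast
  obtain j0 :: nat and a R where jaR: "a \<in> carrier L" "R \<in> s.sp (range (\<lambda>j::nat. Y [^]\<^bsub>A\<^esub> j))" "a \<noteq> \<zero>"
    "p = Y [^]\<^bsub>A\<^esub> j0 \<otimes>\<^bsub>A\<^esub> (\<kappa> a \<oplus>\<^bsub>A\<^esub> Y \<otimes>\<^bsub>A\<^esub> R)"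
    using s.univariate_lowest_term[OF Y c(1)] p(2) unfolding c(2) by blast
  have Rc: "R \<in> carrier A" using jaR(2) s.sp_closed[OF powc] by blast
  have ia: "inv a \<in> carrier L" "inv a \<otimes> a = \<one>" using jaR field_Units by auto
  have pc: "p \<in> carrier A" unfolding jaR(4) using Y Rc jaR by simp
  define U where "U = \<ominus>\<^bsub>A\<^esub> (\<kappa> (inv a) \<otimes>\<^bsub>A\<^esub> (Y \<otimes>\<^bsub>A\<^esub> R))"
  have Uc: "U \<in> carrier A" unfolding U_def using Y Rc ia by simp
  define u where "u = Y [^]\<^bsub>A\<^esub> j0"
  have uc: "u \<in> carrier A" using Y by (simp add: u_def)
  have step: "u = \<kappa> (inv a) \<otimes>\<^bsub>A\<^esub> p \<oplus>\<^bsub>A\<^esub> u \<otimes>\<^bsub>A\<^esub> U"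
  proof -
    have k1: "\<kappa> (inv a) \<otimes>\<^bsub>A\<^esub> \<kappa> a = \<one>\<^bsub>A\<^esub>" using ia jaR(1) by (metis s.hom_mult s.hom_one)
    have kc: "\<kappa> (inv a) \<in> carrier A" "\<kappa> a \<in> carrier A" "Y \<otimes>\<^bsub>A\<^esub> R \<in> carrier A" using ia jaR Y Rc by auto
    have "\<kappa> (inv a) \<otimes>\<^bsub>A\<^esub> p = \<kappa> (inv a) \<otimes>\<^bsub>A\<^esub> (u \<otimes>\<^bsub>A\<^esub> (\<kappa> a \<oplus>\<^bsub>A\<^esub> Y \<otimes>\<^bsub>A\<^esub> R))" by (simp add: jaR(4) u_def)
    also have "\<dots> = u \<otimes>\<^bsub>A\<^esub> (\<kappa> (inv a) \<otimes>\<^bsub>A\<^esub> \<kappa> a) \<oplus>\<^bsub>A\<^esub> u \<otimes>\<^bsub>A\<^esub> (\<kappa> (inv a) \<otimes>\<^bsub>A\<^esub> (Y \<otimes>\<^bsub>A\<^esub> R))"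
      using kc uc by (simp add: s.r_distr s.m_ac)
    finally have "\<kappa> (inv a) \<otimes>\<^bsub>A\<^esub> p \<oplus>\<^bsub>A\<^esub> u \<otimes>\<^bsub>A\<^esub> U =
        u \<oplus>\<^bsub>A\<^esub> u \<otimes>\<^bsub>A\<^esub> (\<kappa> (inv a) \<otimes>\<^bsub>A\<^esub> (Y \<otimes>\<^bsub>A\<^esub> R)) \<oplus>\<^bsub>A\<^esub> u \<otimes>\<^bsub>A\<^esub> U"
      unfolding k1 using uc by simp
    also have "\<dots> = u" unfolding U_def using uc kc by (simp add: s.r_minus s.a_assoc s.r_neg)
    finally show ?thesis by simp
  qed
  have PF'_mult: "F \<otimes>\<^bsub>A\<^esub> G \<in> s.sp (range (pmon P))" if "F \<in> s.sp (range (pmon P))" "G \<in> s.sp (range (pmon P))" for F G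
    using s.sp_mpow_mult[OF xat_carrier that, of UNIV] by simp
  have G_mult: "F \<otimes>\<^bsub>A\<^esub> H \<in> s.sp ?G" if "F \<in> s.sp (range (pmon P))" "H \<in> s.sp ?G" for F H
  proof (rule s.sp_mult[OF Gc pmon_image Gc _ that])
    fix g h assume "g \<in> range (pmon P)" "h \<in> ?G"
    then obtain \<mu> \<gamma> j where gh: "j < t" "g = pmon P \<mu>" "h = pmon P \<gamma> \<otimes>\<^bsub>A\<^esub> f j" by auto
    have "g \<otimes>\<^bsub>A\<^esub> h = pmon P (\<lambda>l. \<mu> l + \<gamma> l) \<otimes>\<^bsub>A\<^esub> f j"
      using gh fc s.S.mpow_add[OF xat_carrier, of \<mu> \<gamma>] by (simp add: s.m_assoc)
    then have "g \<otimes>\<^bsub>A\<^esub> h \<in> ?G" using gh by auto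
    then show "g \<otimes>\<^bsub>A\<^esub> h \<in> s.sp ?G" by (rule s.sp_base[OF Gc])
  qed
  have fG: "f j \<in> s.sp ?G" if "j < t" for j
  proof -
    have "pmon P (\<lambda>_. 0) \<otimes>\<^bsub>A\<^esub> f j = f j" using fc[OF that] by (simp add: s.S.mpow_zero)
    then have "f j \<in> ?G" using that by (intro CollectI exI[of _ "\<lambda>_. 0"] exI[of _ j]) simp
    then show ?thesis by (rule s.sp_base[OF Gc])
  qed
  have "ideal_gens t f \<subseteq> s.sp ?G"
  proof
    fix h assume "h \<in> ideal_gens t f"
    then obtain \<gamma> j where h: "j < t" "h = xmon \<gamma> \<otimes>\<^bsub>A\<^esub> f j" by (auto simp: ideal_gens_def)
    have "xmon \<gamma> \<in> s.sp (range (pmon P))" using PF_subset_pmon s.sp_base[OF xmon_image, of "xmon \<gamma>" UNIV] by auto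
    then show "h \<in> s.sp ?G" unfolding h(2) using fG[OF h(1)] by (rule G_mult)
  qed
  then have pG: "p \<in> s.sp ?G" using p(3) s.sp_sub[OF Gc] by blast
  have m_mult: "F \<otimes>\<^bsub>A\<^esub> G \<in> s.sp (?m (a + b))" if "F \<in> s.sp (?m a)" "G \<in> s.sp (?m b)" for F G a b
    using that by (rule s.sp_mpow_mult[OF xat_carrier]) (auto simp: tdeg_add)
  have m0: "?m 0 = range (pmon P)" by auto
  have Y1: "Y \<in> s.sp (?m 1)"
  proof -
    have "tdeg k (\<lambda>j. if j = i then 1 else 0) = 1" using i by (simp add: tdeg_def)
    moreover have "pmon P (\<lambda>j. if j = i then 1 else 0) = Y"
      using i xat_carrier s.S.mpow_single[of "{..<k}" i "xat P" 1] Y by (simp add: Y_def)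
    ultimately show ?thesis
      using s.sp_mpow[OF xat_carrier, of "\<lambda>j. if j = i then 1 else 0" "{\<gamma>. 1 \<le> tdeg k \<gamma>}"] by simp
  qed
  have one: "\<one>\<^bsub>A\<^esub> \<in> s.sp (?m 0)"
    using s.sp_mpow[OF xat_carrier, of "\<lambda>_. 0" UNIV] unfolding m0 by (simp add: s.S.mpow_zero)
  have pow: "F [^]\<^bsub>A\<^esub> n \<in> s.sp (?m n)" if F: "F \<in> s.sp (?m 1)" for F and n :: nat
  proof (induction n)
    case (Suc n)
    then show ?case using m_mult[of "F [^]\<^bsub>A\<^esub> n" n F 1] F by simp
  qed (use one in simp)
  have mm: "s.sp (?m n) \<subseteq> s.sp (?m 0)" for n by (rule s.sp_mono) auto
  have "range (\<lambda>j::nat. Y [^]\<^bsub>A\<^esub> j) \<subseteq> s.sp (?m 0)" using pow[OF Y1] mm by blast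
  then have R0: "R \<in> s.sp (?m 0)" using jaR(2) s.sp_sub[OF pmon_image] by blast
  have U1: "U \<in> s.sp (?m 1)"
    unfolding U_def using m_mult[OF Y1 R0] ia by (intro s.sp_minus s.sp_smult pmon_image) auto
  have iter: "\<exists>H\<in>s.sp ?G. u = H \<oplus>\<^bsub>A\<^esub> u \<otimes>\<^bsub>A\<^esub> U [^]\<^bsub>A\<^esub> n" for n :: nat
  proof (induction n)
    case 0
    then show ?case using uc by (intro bexI[of _ "\<zero>\<^bsub>A\<^esub>"]) (auto intro: s.sp_zero)
  next
    case (Suc n)
    then obtain H where H: "H \<in> s.sp ?G" "u = H \<oplus>\<^bsub>A\<^esub> u \<otimes>\<^bsub>A\<^esub> U [^]\<^bsub>A\<^esub> n" by blast
    have Hc: "H \<in> carrier A" using H s.sp_closed[OF Gc] by blast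
    have Un: "U [^]\<^bsub>A\<^esub> n \<in> s.sp (range (pmon P))" using pow[OF U1, of n] mm m0 by auto
    let ?H = "H \<oplus>\<^bsub>A\<^esub> U [^]\<^bsub>A\<^esub> n \<otimes>\<^bsub>A\<^esub> (\<kappa> (inv a) \<otimes>\<^bsub>A\<^esub> p)"
    have "?H \<in> s.sp ?G" using H(1) G_mult[OF Un s.sp_smult[OF Gc pG ia(1)]] by (intro s.sp_add[OF Gc])
    moreover have "u = ?H \<oplus>\<^bsub>A\<^esub> u \<otimes>\<^bsub>A\<^esub> U [^]\<^bsub>A\<^esub> Suc n"
    proof -
      have kc: "\<kappa> (inv a) \<otimes>\<^bsub>A\<^esub> p \<in> carrier A" "U [^]\<^bsub>A\<^esub> n \<in> carrier A" using ia pc Uc by auto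
      have "u \<otimes>\<^bsub>A\<^esub> U [^]\<^bsub>A\<^esub> n = (\<kappa> (inv a) \<otimes>\<^bsub>A\<^esub> p \<oplus>\<^bsub>A\<^esub> u \<otimes>\<^bsub>A\<^esub> U) \<otimes>\<^bsub>A\<^esub> U [^]\<^bsub>A\<^esub> n"
        using step by simp
      also have "\<dots> = U [^]\<^bsub>A\<^esub> n \<otimes>\<^bsub>A\<^esub> (\<kappa> (inv a) \<otimes>\<^bsub>A\<^esub> p) \<oplus>\<^bsub>A\<^esub> u \<otimes>\<^bsub>A\<^esub> U [^]\<^bsub>A\<^esub> Suc n"
        using kc uc Uc by (simp add: s.l_distr s.r_distr s.m_ac)
      finally show ?thesis using H(2) Hc kc uc Uc by (simp add: s.a_assoc)
    qed
    ultimately show ?case by blast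
  qed
  have "u \<in> s.sp (?G \<union> ?m n)" for n
  proof -
    obtain H where H: "H \<in> s.sp ?G" "u = H \<oplus>\<^bsub>A\<^esub> u \<otimes>\<^bsub>A\<^esub> U [^]\<^bsub>A\<^esub> n" using iter by blast
    have "u \<in> s.sp (?m 0)" using pow[OF Y1, of j0] mm unfolding u_def by blast
    then have "u \<otimes>\<^bsub>A\<^esub> U [^]\<^bsub>A\<^esub> n \<in> s.sp (?m n)" using m_mult[OF _ pow[OF U1, of n], of u 0] by simp
    then have "u \<otimes>\<^bsub>A\<^esub> U [^]\<^bsub>A\<^esub> n \<in> s.sp (?G \<union> ?m n)" using s.sp_mono[of "?m n" "?G \<union> ?m n"] by blast
    moreover have "H \<in> s.sp (?G \<union> ?m n)" using H s.sp_mono[of ?G "?G \<union> ?m n"] by blast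
    ultimately have "H \<oplus>\<^bsub>A\<^esub> u \<otimes>\<^bsub>A\<^esub> U [^]\<^bsub>A\<^esub> n \<in> s.sp (?G \<union> ?m n)"
      using Gc pmon_image by (intro s.sp_add) auto
    then show ?thesis using H(2) by simp
  qed
  then show ?thesis unfolding u_def Y_def by blast
qed

end

lemma local_parametersI:
  assumes k: "k \<ge> 1" and P: "P \<in> D" and f: "\<And>j. j < k \<Longrightarrow> f j \<in> PF \<and> f j P = \<zero>"
    and el: "\<And>i. i < k \<Longrightarrow> has_eliminant k {i} f"
  shows "local_parameters L A \<kappa> k (xat P) f"
proof (intro local_parameters.intro local_parameters_axioms.intro)
  show "scalars L A \<kappa>" by (rule s.scalars_axioms)
  show "xat P \<in> {..<k} \<rightarrow> carrier A" using P by (rule xat_carrier)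
  show "f j \<in> s.sp (pmon P ` {\<gamma>. 1 \<le> tdeg k \<gamma>})" if "j < k" for j
    using f[OF that] by (intro order_positive P) auto
  show "c \<beta> = \<zero>" if "finite B" "B \<subseteq> exs k" "c \<in> B \<rightarrow> carrier L"
    "(\<Oplus>\<^bsub>A\<^esub>\<beta>\<in>B. \<kappa> (c \<beta>) \<otimes>\<^bsub>A\<^esub> pmon P \<beta>) = \<zero>\<^bsub>A\<^esub>" "\<beta> \<in> B" for B c \<beta>
    using pmon_independent[OF P that] .
  show "\<exists>e::nat. \<forall>n. xat P i [^]\<^bsub>A\<^esub> e \<in> s.sp ({pmon P \<gamma> \<otimes>\<^bsub>A\<^esub> f j |\<gamma> j. j < k} \<union> pmon P ` {\<gamma>. n \<le> tdeg k \<gamma>})"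
    if "i < k" for i
    using f by (intro eliminant_power P that el) auto
qed (rule k)

text \<open>Lagrange interpolation: each point \<open>P'\<close> to be avoided contributes a factor
  \<open>(x_i - P'_i) / (P_i - P'_i)\<close> at a coordinate where it differs from
  \<open>P\<close>.\<close>

lemma separating_function:
  assumes "finite Q" "Q \<subseteq> D" "P \<in> D" "P \<notin> Q"
  shows "\<exists>h\<in>PF. h P = \<one> \<and> (\<forall>P'\<in>Q. h P' = \<zero>)"
  using assms
proof (induction Q rule: finite_induct)
  case empty
  then show ?case using PF_one by (intro bexI[of _ "\<one>\<^bsub>A\<^esub>"]) (auto simp: fun_ring_simps)
next
  case (insert P' Q)
  then obtain h where h: "h \<in> PF" "h P = \<one>" "\<And>R. R \<in> Q \<Longrightarrow> h R = \<zero>" by auto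
  have P': "P' \<in> D" "P \<in> D" "P \<noteq> P'" using insert by auto
  then obtain i where i: "i < k" "P i \<noteq> P' i" unfolding aff_def by (metis PiE_ext lessThan_iff)
  have PL: "P i \<in> carrier L" "P' i \<in> carrier L" using P' D_apply i by auto
  define a where "a = P i \<ominus> P' i"
  have a: "a \<in> carrier L" "a \<noteq> \<zero>" using PL i by (auto simp: a_def)
  then have ia: "inv a \<in> carrier L" "inv a \<otimes> a = \<one>" using field_Units by auto
  have xP: "xat P' i \<in> PF"
  proof -
    have "xs i = xmon (\<lambda>j. if j = i then 1 else 0)"
      using i s.S.mpow_single[of "{..<k}" i xs 1] xs_carrier xs_closed by simp
    then have "xs i \<in> PF" using s.sp_base[OF xmon_image, of "xs i" UNIV] by auto
    then show ?thesis unfolding xat_def using PF_const[OF PL(2)] by (intro s.sp_diff xmon_image)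
  qed
  let ?g = "\<kappa> (inv a) \<otimes>\<^bsub>A\<^esub> xat P' i \<otimes>\<^bsub>A\<^esub> h"
  have g: "?g \<in> PF" using h xP PF_const[OF ia(1)] by (intro PF_mult)
  have gx: "?g x = inv a \<otimes> (x i \<ominus> P' i) \<otimes> h x" if "x \<in> D" for x
    using that i P'(1) by (simp add: fun_ring_simps kappa_apply xat_apply)
  have "?g P = \<one>" using gx[OF P'(2)] h ia by (simp add: a_def[symmetric])
  moreover have "?g P' = \<zero>" using gx[OF P'(1)] PL ia A_apply[OF PF_closed[OF h(1)] P'(1)]
    by (simp add: minus_eq r_neg)
  moreover have "?g R = \<zero>" if R: "R \<in> Q" for R
  proof -
    have RD: "R \<in> D" using insert.prems R by auto
    then have "R i \<in> carrier L" using D_apply i by auto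
    then show ?thesis using gx[OF RD] h(3)[OF R] ia PL by simp
  qed
  ultimately show ?case using g by blast
qed

end

section \<open>Asymptotic comparison of monomial counts\<close>

text \<open>The quotient of two values of \<open>M\<close> at distance \<open>e\<close> cannot exceed \<open>1 + 1 / C\<close> throughout,
  as \<open>M\<close> has polynomial growth.\<close>
lemma growth_bound:
  fixes M T :: "nat \<Rightarrow> nat"
  assumes 1: "\<And>s. N * T s \<le> M (s + e)" and 2: "\<And>s. M s \<le> C * T s"
    and 3: "\<And>s. M s \<le> (s + 1) ^ k" and 4: "M 0 \<ge> 1"
  shows "N \<le> C"
proof (rule ccontr)
  assume "\<not> N \<le> C"
  then have N: "C + 1 \<le> N" by simp
  have C: "C \<ge> 1" using 2[of 0] 4 by (cases C) auto
  define x where "x = 1 / real C"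
  have x: "x \<ge> 0" by (simp add: x_def)
  have step: "(1 + x) * real (M s) \<le> real (M (s + e))" for s
  proof -
    have "(C + 1) * M s \<le> (C + 1) * (C * T s)" using 2[of s] by (intro mult_le_mono2)
    also have "\<dots> = C * ((C + 1) * T s)" by (simp only: ac_simps)
    also have "\<dots> \<le> C * (N * T s)" using N by (intro mult_le_mono2 mult_le_mono1)
    also have "\<dots> \<le> C * M (s + e)" using 1[of s] by (intro mult_le_mono2)
    finally have "real ((C + 1) * M s) \<le> real (C * M (s + e))" by (simp only: of_nat_le_iff)
    then show ?thesis using C by (simp add: x_def field_simps)
  qed
  have pow: "(1 + x) ^ j \<le> real (M (j * e))" for j
  proof (induction j)
    case 0
    then show ?case using 4 by simp
  next
    case (Suc j)
    have "(1 + x) ^ Suc j \<le> (1 + x) * real (M (j * e))" using Suc x by simp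
    also have "\<dots> \<le> real (M (j * e + e))" by (rule step)
    finally show ?case by (simp add: add.commute)
  qed
  \<comment> \<open>The Bernoulli inequality for \<open>(1 + x) ^ i\<close>, raised to the power
    \<open>k + 1\<close>, gives growth at least \<open>(i / C)^(k + 1)\<close>, against the upper
    bound \<open>i^k * B\<close>. This is contradictory as soon as
    \<open>i > C^(k + 1) * B\<close>.\<close>
  define B where "B = ((k + 1) * e + 1) ^ k"
  define i where "i = C ^ (k + 1) * B + 1"
  have i: "i \<ge> 1" by (simp add: i_def)
  have "(real i / real C) ^ (k + 1) \<le> (1 + real i * x) ^ (k + 1)"
    by (intro power_mono) (auto simp: x_def)
  also have "\<dots> \<le> ((1 + x) ^ i) ^ (k + 1)"
    using Bernoulli_inequality[of x i] x by (intro power_mono) auto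
  also have "\<dots> = (1 + x) ^ ((k + 1) * i)" by (simp only: power_mult[symmetric] mult.commute)
  also have "\<dots> \<le> real (M ((k + 1) * i * e))" by (rule pow)
  also have "\<dots> \<le> real (((k + 1) * i * e + 1) ^ k)" using 3 by (simp only: of_nat_le_iff)
  also have "\<dots> \<le> real ((i * ((k + 1) * e + 1)) ^ k)"
  proof -
    have "(k + 1) * i * e + 1 \<le> i * ((k + 1) * e + 1)" using i by (simp add: algebra_simps)
    then show ?thesis by (simp only: of_nat_le_iff power_mono le0)
  qed
  also have "\<dots> = real i ^ k * real B" by (simp only: B_def power_mult_distrib of_nat_mult of_nat_power)
  finally have "real i ^ (k + 1) \<le> real C ^ (k + 1) * (real i ^ k * real B)"
    using C by (simp only: power_divide) (simp add: field_simps)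
  then have "real i * real i ^ k \<le> (real C ^ (k + 1) * real B) * real i ^ k" by (simp add: mult_ac)
  then have "real i \<le> real C ^ (k + 1) * real B" using i by simp
  also have "\<dots> = real (C ^ (k + 1) * B)" by simp
  finally show False unfolding i_def by (simp only: of_nat_le_iff)
qed

text \<open>The exponents \<open>\<alpha>\<close> for which \<open>f^\<alpha>\<close> is certain to
  have degree at most \<open>s\<close> when each \<open>f i\<close> has degree at most
  \<open>d i\<close>.\<close>

definition wmonoms :: "nat \<Rightarrow> (nat \<Rightarrow> nat) \<Rightarrow> nat \<Rightarrow> (nat \<Rightarrow> nat) set" where
  "wmonoms k d s = {\<alpha> \<in> exs k. (\<Sum>i<k. \<alpha> i * d i) \<le> s}"

lemma wmonoms_subset:
  assumes d: "\<And>i. i < k \<Longrightarrow> d i \<ge> 1"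
  shows "wmonoms k d s \<subseteq> monoms k s"
proof
  fix \<alpha> assume a: "\<alpha> \<in> wmonoms k d s"
  have "(\<Sum>i<k. \<alpha> i) \<le> (\<Sum>i<k. \<alpha> i * d i)" using d by (intro sum_mono) auto
  then show "\<alpha> \<in> monoms k s" using a by (auto simp: wmonoms_def monoms_def exs_def)
qed

lemma finite_wmonoms: "(\<And>i. i < k \<Longrightarrow> d i \<ge> 1) \<Longrightarrow> finite (wmonoms k d s)"
  using wmonoms_subset finite_monoms finite_subset by metis

text \<open>Division with remainder of each exponent by \<open>d i\<close>: the quotients lie in
  \<open>wmonoms k d s\<close>, and there are as many remainder vectors as the product of the
  \<open>d i\<close>. This is where the Bezout number arises.\<close>

lemma card_monoms_le_wmonoms:
  assumes d: "\<And>i. i < k \<Longrightarrow> d i \<ge> 1"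
  shows "card (monoms k s) \<le> (\<Prod>i<k. d i) * card (wmonoms k d s)"
proof -
  let ?R = "exps {..<k} (\<lambda>i. {..<d i})"
  let ?g = "\<lambda>\<gamma>. (\<lambda>i. \<gamma> i div d i, \<lambda>i. if i < k then \<gamma> i mod d i else 0)"
  have fR: "finite ?R" by (intro finite_exps) auto
  have "inj_on ?g (monoms k s)"
  proof (rule inj_onI)
    fix \<gamma> \<delta> assume gd: "\<gamma> \<in> monoms k s" "\<delta> \<in> monoms k s" "?g \<gamma> = ?g \<delta>"
    show "\<gamma> = \<delta>"
    proof
      fix i
      show "\<gamma> i = \<delta> i"
      proof (cases "i < k")
        case True
        have "\<gamma> i div d i = \<delta> i div d i" using gd(3) by (auto dest: fun_cong)
        moreover have "\<gamma> i mod d i = \<delta> i mod d i"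
          using fun_cong[of "\<lambda>i. if i < k then \<gamma> i mod d i else 0" _ i] gd(3) True by simp metis
        ultimately show ?thesis by (metis div_mult_mod_eq)
      qed (use gd in \<open>auto simp: monoms_def\<close>)
    qed
  qed
  moreover have "?g ` monoms k s \<subseteq> wmonoms k d s \<times> ?R"
  proof
    fix h assume "h \<in> ?g ` monoms k s"
    then obtain \<gamma> where g: "\<gamma> \<in> monoms k s" "h = ?g \<gamma>" by auto
    have "(\<Sum>i<k. \<gamma> i div d i * d i) \<le> (\<Sum>i<k. \<gamma> i)" by (intro sum_mono) auto
    then have "(\<lambda>i. \<gamma> i div d i) \<in> wmonoms k d s" using g by (auto simp: wmonoms_def monoms_def exs_def)
    moreover have "(\<lambda>i. if i < k then \<gamma> i mod d i else 0) \<in> ?R"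
      using d by (force simp: exps_def)
    ultimately show "h \<in> wmonoms k d s \<times> ?R" using g by auto
  qed
  ultimately have "card (monoms k s) \<le> card (wmonoms k d s \<times> ?R)"
    using fR finite_wmonoms[OF d] by (intro card_inj_on_le[of ?g]) auto
  also have "\<dots> = (\<Prod>i<k. d i) * card (wmonoms k d s)" by (simp add: card_cartesian_product card_exps)
  finally show ?thesis .
qed

text \<open>No term of degree below \<open>r\<close> occurs. Modulo the maximal ideal at
  \<open>P\<close> times the power products of degree \<open>r\<close>, the terms of higher degree
  vanish, those at another point vanish because its \<open>h\<close> has positive order at
  \<open>P\<close>, and \<open>h P\<close> becomes 1. What remains is a relation as in
  \<open>powers_independent\<close>.\<close>

lemma (in local_parameters) multiples_independent:
  assumes fin: "finite B" "B \<subseteq> exs k \<times> Q" and c: "c \<in> B \<rightarrow> carrier L"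
    and P: "P \<in> Q" and min: "\<And>\<alpha> P. \<lbrakk>(\<alpha>, P) \<in> B; tdeg k \<alpha> < r\<rbrakk> \<Longrightarrow> c (\<alpha>, P) = \<zero>\<^bsub>L\<^esub>"
    and h: "\<And>P'. P' \<in> Q \<Longrightarrow> h P' \<in> sp (range (mpow A {..<k} y))"
      "\<And>P'. \<lbrakk>P' \<in> Q; P' \<noteq> P\<rbrakk> \<Longrightarrow> h P' \<in> sp (mpow A {..<k} y ` {\<gamma>. 1 \<le> tdeg k \<gamma>})"
      "h P \<ominus> \<one> \<in> sp (mpow A {..<k} y ` {\<gamma>. 1 \<le> tdeg k \<gamma>})"
    and rel: "(\<Oplus>b\<in>B. \<kappa> (c b) \<otimes> (mpow A {..<k} f (fst b) \<otimes> h (snd b))) = \<zero>"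
    and \<alpha>: "(\<alpha>, P) \<in> B" "tdeg k \<alpha> = r"
  shows "c (\<alpha>, P) = \<zero>\<^bsub>L\<^esub>"
proof -
  let ?R = "{ymon \<delta> \<otimes> fmon \<alpha> |\<delta> \<alpha>. 1 \<le> tdeg k \<delta> \<and> tdeg k \<alpha> = r}"
  let ?E = "{\<alpha> \<in> exs k. tdeg k \<alpha> = r}"
  \<comment> \<open>Pairs outside \<open>B\<close> get coefficient zero, so that the relation ranges
    over all exponents of degree \<open>r\<close>.\<close>
  define c' where "c' \<alpha> = (if (\<alpha>, P) \<in> B then c (\<alpha>, P) else \<zero>\<^bsub>L\<^esub>)" for \<alpha>
  have Rc: "?R \<subseteq> carrier A" by auto
  have cc: "\<And>b. b \<in> B \<Longrightarrow> c b \<in> carrier L" using c by auto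
  have c'c: "c' \<in> ?E \<rightarrow> carrier L" using cc by (auto simp: c'_def)
  have hc: "h P' \<in> carrier A" if "P' \<in> Q" for P' using h(1)[OF that] sp_closed[OF m_closed] by blast
  have G2: "fmon \<beta> \<otimes> u \<in> sp ?R" if "tdeg k \<beta> = r" "u \<in> sp (m 1)" for \<beta> u
  proof (rule sp_mult_base[OF Rc m_closed _ _ that(2)])
    fix g assume "g \<in> m 1"
    then obtain \<delta> where "1 \<le> tdeg k \<delta>" "g = ymon \<delta>" by auto
    then have "fmon \<beta> \<otimes> g \<in> ?R" using that(1)
      by (intro CollectI exI[of _ \<delta>] exI[of _ \<beta>]) (simp add: m_comm)
    then show "fmon \<beta> \<otimes> g \<in> sp ?R" by (rule sp_base[OF Rc])
  qed simp
  have G1: "fmon \<beta> \<otimes> u \<in> sp ?R" if b: "r < tdeg k \<beta>" "u \<in> sp (range ymon)" for \<beta> u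
  proof -
    obtain \<beta>' where b': "\<And>i. \<beta>' i \<le> \<beta> i" "tdeg k \<beta>' = r" using tdeg_split[of r k \<beta>] b by auto
    let ?b = "\<lambda>i. \<beta> i - \<beta>' i"
    have eq: "\<beta> = (\<lambda>i. \<beta>' i + ?b i)" using b' by auto
    have db: "1 \<le> tdeg k ?b" using b(1) b'(2) tdeg_add[of k \<beta>' ?b] eq by simp
    have uc: "u \<in> carrier A" using b(2) sp_closed[OF m_closed] by blast
    have m0: "m 0 = range ymon" by auto
    have "fmon ?b \<otimes> u \<in> sp (m (tdeg k ?b + 0))" using fmon_order b(2)[folded m0] by (rule m_mult)
    moreover have "{\<gamma>. tdeg k ?b + 0 \<le> tdeg k \<gamma>} \<subseteq> {\<gamma>. 1 \<le> tdeg k \<gamma>}" using db by auto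
    ultimately have "fmon ?b \<otimes> u \<in> sp (m 1)" using subsetD[OF sp_mono[OF image_mono]] by blast
    then have "fmon \<beta>' \<otimes> (fmon ?b \<otimes> u) \<in> sp ?R" by (rule G2[OF b'(2)])
    moreover have "fmon \<beta> = fmon \<beta>' \<otimes> fmon ?b" by (subst eq) (rule fmon_add)
    ultimately show ?thesis using uc by (simp add: m_assoc)
  qed
  define T where "T b = \<kappa> (c b) \<otimes> (fmon (fst b) \<otimes> h (snd b))" for b
  \<comment> \<open>The part of \<open>T b\<close> that survives modulo \<open>?R\<close>.\<close>
  define g where "g b = (if snd b = P \<and> tdeg k (fst b) = r then \<kappa> (c b) \<otimes> fmon (fst b) else \<zero>)" for b
  have Tc: "T b \<in> carrier A" if "b \<in> B" for b using cc[OF that] hc fin(2) that by (auto simp: T_def)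
  have gc: "g b \<in> carrier A" if "b \<in> B" for b using cc[OF that] by (auto simp: g_def)
  have Tg: "T b \<ominus> g b \<in> sp ?R" if b: "b \<in> B" for b
  proof -
    obtain \<beta> P' where bP: "b = (\<beta>, P')" by (cases b)
    have P': "P' \<in> Q" using fin(2) b bP by auto
    have cb: "c b \<in> carrier L" using cc b by blast
    have sm: "\<kappa> (c b) \<otimes> F \<in> sp ?R" if "F \<in> sp ?R" for F using sp_smult[OF Rc that cb] .
    consider "tdeg k \<beta> < r" | "r < tdeg k \<beta>" | "tdeg k \<beta> = r" "P' \<noteq> P" | "tdeg k \<beta> = r" "P' = P"
      by linarith
    then show ?thesis
    proof cases
      case 1
      then have "c b = \<zero>\<^bsub>L\<^esub>" using min b bP by simp
      then have "T b = \<zero>" "g b = \<zero>" using 1 hc[OF P'] by (simp_all add: T_def g_def bP)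
      then show ?thesis by (simp only: minus_eq minus_zero r_zero zero_closed sp_zero)
    next
      case 2
      then have "g b = \<zero>" by (simp add: g_def bP)
      moreover have "T b \<in> sp ?R"
        using sm[OF G1[OF 2 h(1)[OF P']]] by (simp only: T_def bP fst_conv snd_conv)
      ultimately show ?thesis using Tc[OF b] by (simp only: minus_eq minus_zero r_zero)
    next
      case 3
      then have "g b = \<zero>" by (simp add: g_def bP)
      moreover have "T b \<in> sp ?R"
        using sm[OF G2[OF 3(1) h(2)[OF P' 3(2)]]] by (simp only: T_def bP fst_conv snd_conv)
      ultimately show ?thesis using Tc[OF b] by (simp only: minus_eq minus_zero r_zero)
    next
      case 4
      have hP: "h P \<in> carrier A" using hc[OF P] .
      have "T b \<ominus> g b = \<kappa> (c b) \<otimes> (fmon \<beta> \<otimes> h P) \<ominus> \<kappa> (c b) \<otimes> fmon \<beta>"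
        using 4 by (simp add: T_def g_def bP)
      also have "\<dots> = \<kappa> (c b) \<otimes> (fmon \<beta> \<otimes> (h P \<ominus> \<one>))"
        using cb hP by (simp add: minus_eq r_distr r_minus)
      also have "\<dots> \<in> sp ?R" using sm[OF G2[OF 4(1) h(3)]] .
      finally show ?thesis .
    qed
  qed
  have S: "(\<Oplus>b\<in>B. T b \<ominus> g b) \<in> sp ?R" using Tg by (rule sp_finsum[OF Rc])
  have Sc: "(\<Oplus>b\<in>B. T b \<ominus> g b) \<in> carrier A" using sp_closed[OF Rc S] .
  have gsc: "(\<Oplus>b\<in>B. g b) \<in> carrier A" using gc by (intro finsum_closed) auto
  have "\<zero> = (\<Oplus>b\<in>B. T b)" using rel unfolding T_def by simp
  also have "\<dots> = (\<Oplus>b\<in>B. (T b \<ominus> g b) \<oplus> g b)"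
    using Tc gc by (intro finsum_cong') (auto simp: minus_eq a_assoc l_neg)
  also have "\<dots> = (\<Oplus>b\<in>B. T b \<ominus> g b) \<oplus> (\<Oplus>b\<in>B. g b)"
    using Tc gc by (intro finsum_addf) auto
  finally have z: "(\<Oplus>b\<in>B. T b \<ominus> g b) \<oplus> (\<Oplus>b\<in>B. g b) = \<zero>" by simp
  have "(\<Oplus>b\<in>B. g b) = \<ominus> (\<Oplus>b\<in>B. T b \<ominus> g b)"
    using z Sc gsc by (metis a_comm sum_zero_eq_neg)
  then have gR: "(\<Oplus>b\<in>B. g b) \<in> sp ?R" using sp_minus[OF Rc S] by simp
  let ?T = "{\<alpha>. (\<alpha>, P) \<in> B \<and> tdeg k \<alpha> = r}"
  have TE: "?T \<subseteq> ?E" using fin(2) by auto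
  have inj: "inj_on (\<lambda>\<alpha>. (\<alpha>, P)) ?T" by (auto simp: inj_on_def)
  have "(\<Oplus>b\<in>B. g b) = (\<Oplus>b\<in>(\<lambda>\<alpha>. (\<alpha>, P)) ` ?T. g b)"
    using fin(1) gc by (intro add.finprod_mono_neutral_cong_right) (auto simp: g_def)
  also have "\<dots> = (\<Oplus>\<alpha>\<in>?T. g (\<alpha>, P))"
    using gc inj by (intro finsum_reindex) auto
  also have "\<dots> = (\<Oplus>\<alpha>\<in>?E. \<kappa> (c' \<alpha>) \<otimes> fmon \<alpha>)"
  proof (rule add.finprod_mono_neutral_cong_left[OF finite_exs_deg TE])
    show "(\<lambda>\<alpha>. \<kappa> (c' \<alpha>) \<otimes> fmon \<alpha>) \<in> ?E \<rightarrow> carrier A" using c'c by (auto simp: Pi_def)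
  qed (auto simp: c'_def g_def)
  finally have eq: "(\<Oplus>b\<in>B. g b) = (\<Oplus>\<alpha>\<in>?E. \<kappa> (c' \<alpha>) \<otimes> fmon \<alpha>)" .
  have "\<alpha> \<in> exs k" using \<alpha> fin(2) by auto
  then have "c' \<alpha> = \<zero>\<^bsub>L\<^esub>" using \<alpha>(2) by (rule powers_independent[OF c'c gR[unfolded eq]])
  then show ?thesis using \<alpha> by (simp add: c'_def)
qed

context affine_space
begin

text \<open>The products \<open>f^\<alpha> h_P\<close> with \<open>\<alpha>\<close> in
  \<open>wmonoms k d s\<close> have degree at most \<open>s + e\<close>, where \<open>e\<close>
  bounds the degrees of the separating functions and is independent of \<open>s\<close>.
  \<open>growth_bound\<close> tolerates such a fixed displacement, which is why only separation of
  the points and no control of the \<open>h_P\<close> is asked for.\<close>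

lemma bezout:
  assumes k: "k \<ge> 1" and d: "\<And>i. i < k \<Longrightarrow> d i \<ge> 1"
    and f: "\<And>i. i < k \<Longrightarrow> f i \<in> s.sp (xmon ` monoms k (d i))"
    and el: "\<And>i. i < k \<Longrightarrow> has_eliminant k {i} f"
    and Q: "finite Q" "Q \<subseteq> D" "\<And>P i. \<lbrakk>P \<in> Q; i < k\<rbrakk> \<Longrightarrow> f i P = \<zero>"
  shows "card Q \<le> (\<Prod>i<k. d i)"
proof -
  have "\<exists>h\<in>PF. h P = \<one> \<and> (\<forall>P'\<in>Q - {P}. h P' = \<zero>)" if "P \<in> Q" for P
    using Q that by (intro separating_function) auto
  then obtain h where h: "\<And>P. P \<in> Q \<Longrightarrow> h P \<in> PF \<and> h P P = \<one> \<and> (\<forall>P'\<in>Q - {P}. h P P' = \<zero>)"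
    by metis
  have "\<exists>e. h P \<in> s.sp (xmon ` monoms k e)" if "P \<in> Q" for P using PF_degree h that by blast
  then obtain ee where ee: "\<And>P. P \<in> Q \<Longrightarrow> h P \<in> s.sp (xmon ` monoms k (ee P))" by metis
  define e where "e = Max (ee ` Q \<union> {0})"
  have he: "h P \<in> s.sp (xmon ` monoms k e)" if "P \<in> Q" for P
  proof -
    have "ee P \<le> e" unfolding e_def using that Q by (intro Max_ge) auto
    then show ?thesis using subsetD[OF s.sp_mono[OF image_mono[OF monoms_mono]] ee[OF that]] by blast
  qed
  have fPF: "f i \<in> PF" if "i < k" for i using sp_xmon_PF f that by blast
  have fc: "f \<in> {..<k} \<rightarrow> carrier A" using fPF PF_closed by auto
  have key: "card Q * card (wmonoms k d s) \<le> card (monoms k (s + e))" for s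
  proof (rule ccontr)
    assume neg: "\<not> ?thesis"
    let ?B = "wmonoms k d s \<times> Q" and ?J = "xmon ` monoms k (s + e)"
    let ?F = "\<lambda>b. mpow A {..<k} f (fst b) \<otimes>\<^bsub>A\<^esub> h (snd b)"
    have fB: "finite ?B" using finite_wmonoms[OF d] Q by auto
    have "card ?J \<le> card (monoms k (s + e))" using finite_monoms by (rule card_image_le)
    then have card: "card ?J < card ?B" using neg by (simp add: card_cartesian_product mult.commute)
    have mem: "?F b \<in> s.sp (?J \<union> {})" if b: "b \<in> ?B" for b
    proof -
      have "mpow A {..<k} f (fst b) \<in> s.sp (xmon ` monoms k (\<Sum>i\<in>{..<k}. fst b i * d i))"
        by (rule s.sp_mpow_power_products[where P = "monoms k", OF xs_carrier _ monoms_add])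
          (use f in \<open>auto simp: monoms_def\<close>)
      moreover have "(\<Sum>i\<in>{..<k}. fst b i * d i) \<le> s" using b by (auto simp: wmonoms_def)
      ultimately have m: "mpow A {..<k} f (fst b) \<in> s.sp (xmon ` monoms k s)"
        using subsetD[OF s.sp_mono[OF image_mono[OF monoms_mono]]] by blast
      have "?F b \<in> s.sp ?J"
        by (rule s.sp_mpow_mult[OF xs_carrier m he monoms_add]) (use b in auto)
      then show ?thesis by simp
    qed
    have "\<exists>c. c \<in> ?B \<rightarrow> carrier L \<and> (\<exists>b\<in>?B. c b \<noteq> \<zero>) \<and>
        (\<Oplus>\<^bsub>A\<^esub>b\<in>?B. \<kappa> (c b) \<otimes>\<^bsub>A\<^esub> ?F b) \<in> s.sp {}"
      by (rule s.exists_dependence[of "{}" ?J ?B ?F, OF empty_subsetI finite_imageI[OF finite_monoms]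
          xmon_image fB card mem])
    then obtain c where c: "c \<in> ?B \<rightarrow> carrier L" "\<exists>b\<in>?B. c b \<noteq> \<zero>"
      "(\<Oplus>\<^bsub>A\<^esub>b\<in>?B. \<kappa> (c b) \<otimes>\<^bsub>A\<^esub> ?F b) \<in> s.sp {}" by (elim exE conjE)
    have rel: "(\<Oplus>\<^bsub>A\<^esub>b\<in>?B. \<kappa> (c b) \<otimes>\<^bsub>A\<^esub> ?F b) = \<zero>\<^bsub>A\<^esub>" using s.sp_empty[OF c(3)] .
    define rk where "rk n \<longleftrightarrow> (\<exists>\<alpha> P. (\<alpha>, P) \<in> ?B \<and> c (\<alpha>, P) \<noteq> \<zero> \<and> tdeg k \<alpha> = n)" for n
    \<comment> \<open>The lowest degree with a nonzero coefficient at any point; a point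
      \<open>P\<close> where it is attained is the one whose local coordinates are used.\<close>
    define r where "r = (LEAST n. rk n)"
    obtain b where b: "b \<in> ?B" "c b \<noteq> \<zero>" using c(2) by (elim bexE)
    have "rk (tdeg k (fst b))" unfolding rk_def using b by (intro exI[of _ "fst b"] exI[of _ "snd b"]) simp
    then have "rk r" unfolding r_def by (rule LeastI)
    then obtain \<alpha> P where aP: "(\<alpha>, P) \<in> ?B" "c (\<alpha>, P) \<noteq> \<zero>" "tdeg k \<alpha> = r"
      unfolding rk_def by (elim exE conjE)
    have min: "c (\<beta>, P') = \<zero>" if "(\<beta>, P') \<in> ?B" "tdeg k \<beta> < r" for \<beta> P'
    proof (rule ccontr)
      assume "c (\<beta>, P') \<noteq> \<zero>"
      then have "rk (tdeg k \<beta>)" unfolding rk_def using that(1) by (intro exI[of _ \<beta>] exI[of _ P']) simp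
      then have "r \<le> tdeg k \<beta>" unfolding r_def by (rule Least_le)
      then show False using that by simp
    qed
    have P: "P \<in> Q" "P \<in> D" using aP Q by auto
    have hP: "h P' \<in> PF" if "P' \<in> Q" for P' using h that by blast
    interpret lp: local_parameters L A \<kappa> k "xat P" f
      using fPF Q(3)[OF P(1)] by (intro local_parametersI[OF k P(2)] el) auto
    have "c (\<alpha>, P) = \<zero>"
    proof (rule lp.multiples_independent[OF fB _ c(1) P(1) min _ _ _ rel aP(1,3)])
      show "?B \<subseteq> exs k \<times> Q" by (auto simp: wmonoms_def)
      show "h P' \<in> s.sp (range (pmon P))" if "P' \<in> Q" for P' using hP[OF that] PF_subset_pmon[OF P(2)] by blast
      show "h P' \<in> s.sp (pmon P ` {\<gamma>. 1 \<le> tdeg k \<gamma>})" if "P' \<in> Q" "P' \<noteq> P" for P'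
        using h that P by (intro order_positive P(2)) auto
      have "(h P \<ominus>\<^bsub>A\<^esub> \<one>\<^bsub>A\<^esub>) P = \<zero>"
      proof -
        interpret e: ring_hom_cring A L "\<lambda>F. F P" using P(2) by (rule eval_hom)
        show ?thesis using h[OF P(1)] PF_closed[of "h P"] P by (simp add: s.minus_eq fun_ring_simps r_neg)
      qed
      then show "h P \<ominus>\<^bsub>A\<^esub> \<one>\<^bsub>A\<^esub> \<in> s.sp (pmon P ` {\<gamma>. 1 \<le> tdeg k \<gamma>})"
        using h[OF P(1)] by (intro order_positive P(2) s.sp_diff xmon_image PF_one) auto
    qed
    then show False using aP by simp
  qed
  show ?thesis
  proof (rule growth_bound)
    show "card Q * card (wmonoms k d s) \<le> card (monoms k (s + e))" for s by (rule key)
    show "card (monoms k s) \<le> (\<Prod>i<k. d i) * card (wmonoms k d s)" for s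
      using d by (rule card_monoms_le_wmonoms)
    show "card (monoms k s) \<le> (s + 1) ^ k" for s
      using card_mono[OF finite_box monoms_subset_box, of k s] by (simp add: card_box)
    have "(\<lambda>_. 0) \<in> monoms k 0" by (auto simp: monoms_def)
    then have "0 < card (monoms k 0)" using finite_monoms card_gt_0_iff by blast
    then show "1 \<le> card (monoms k 0)" by simp
  qed
qed

end

section \<open>Random polynomials over a finite field\<close>

text \<open>Each \<open>T a\<close> permutes \<open>Y\<close>, so \<open>B\<close> and its pullback
  along \<open>T a\<close> hold for equally many \<open>f\<close>. Counting pairs
  \<open>(a, f)\<close> in both orders turns a bound over the shifts of each fixed \<open>f\<close>
  into a bound over \<open>f\<close>.\<close>

lemma averaging:
  fixes T :: "'x \<Rightarrow> 'y \<Rightarrow> 'y"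
  assumes fin: "finite X1" "finite Y" "X1 \<noteq> {}"
    and T: "\<And>a. a \<in> X1 \<Longrightarrow> inj_on (T a) Y" "\<And>a f. \<lbrakk>a \<in> X1; f \<in> Y\<rbrakk> \<Longrightarrow> T a f \<in> Y"
    and le: "\<And>f. f \<in> Y \<Longrightarrow> card {a \<in> X1. B (T a f)} * M \<le> c * card X1"
  shows "card {f \<in> Y. B f} * M \<le> c * card Y"
proof -
  have eq: "card {f \<in> Y. B f} = card {f \<in> Y. B (T a f)}" if a: "a \<in> X1" for a
  proof -
    have "T a ` Y = Y" using T a fin by (intro endo_inj_surj) auto
    then have "{f \<in> Y. B f} = T a ` {f \<in> Y. B (T a f)}" by (auto simp: image_iff)
    then show ?thesis using T(1)[OF a] by (metis (no_types, lifting) card_image inj_on_subset mem_Collect_eq subsetI)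
  qed
  have "card X1 * card {f \<in> Y. B f} = (\<Sum>a\<in>X1. card {f \<in> Y. B (T a f)})"
    using sum.cong[OF refl eq, of X1] by simp
  also have "\<dots> = (\<Sum>a\<in>X1. \<Sum>f\<in>Y. if B (T a f) then 1 else 0)"
    using fin by (intro sum.cong refl) (simp add: sum.If_cases Int_def)
  also have "\<dots> = (\<Sum>f\<in>Y. \<Sum>a\<in>X1. if B (T a f) then 1 else 0)" by (rule sum.swap)
  also have "\<dots> = (\<Sum>f\<in>Y. card {a \<in> X1. B (T a f)})"
    using fin by (intro sum.cong refl) (simp add: sum.If_cases Int_def)
  finally have "card X1 * (card {f \<in> Y. B f} * M) = (\<Sum>f\<in>Y. card {a \<in> X1. B (T a f)} * M)"
    by (simp add: sum_distrib_right mult.assoc[symmetric])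
  also have "\<dots> \<le> (\<Sum>f\<in>Y. c * card X1)" using le by (intro sum_mono)
  also have "\<dots> = card X1 * (c * card Y)" by simp
  finally show ?thesis using fin by (simp add: card_gt_0_iff)
qed

lemma (in cring) mpoly_eval_lift:
  assumes c: "\<And>\<alpha>. \<alpha> \<in> monoms k d \<Longrightarrow> h (c \<alpha>) \<in> carrier R" and x: "x \<in> {..<k} \<rightarrow> carrier R"
  shows "mpoly_eval R k (lift_poly R h k d c) x = (\<Oplus>\<alpha>\<in>monoms k d. h (c \<alpha>) \<otimes> mpow R {..<k} x \<alpha>)"
proof -
  let ?p = "lift_poly R h k d c"
  have "mpoly_eval R k ?p x = (\<Oplus>\<alpha>\<in>{\<alpha>. ?p \<alpha> \<noteq> \<zero>}. ?p \<alpha> \<otimes> mpow R {..<k} x \<alpha>)"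
    by (simp add: mpoly_eval_def mpow_def)
  also have "\<dots> = (\<Oplus>\<alpha>\<in>monoms k d. h (c \<alpha>) \<otimes> mpow R {..<k} x \<alpha>)"
    using c x finite_monoms
    by (intro add.finprod_mono_neutral_cong_left) (auto simp: lift_poly_def split: if_splits)
  finally show ?thesis .
qed

section \<open>The finite field embedded in an infinite field, and the shifts of its systems\<close>

locale finite_subfield = affine_space L k + R: field R
  for L (structure) and k and R :: "('r, 'n) ring_scheme" +
  fixes h
  assumes h: "h \<in> ring_hom R L" and fin: "finite (carrier R)"
begin

abbreviation "K \<equiv> h ` carrier R"

lemma h_hom: "ring_hom_cring R L h"
  by (intro ring_hom_cring.intro ring_hom_cring_axioms.intro h R.cring_axioms cring_axioms)

sublocale h: ring_hom_cring R L h
  by (rule h_hom)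

lemma h_inj: "inj_on h (carrier R)"
proof (rule inj_onI)
  fix a b assume ab: "a \<in> carrier R" "b \<in> carrier R" "h a = h b"
  have z: "h (a \<ominus>\<^bsub>R\<^esub> b) = \<zero>" using ab by (simp add: R.minus_eq r_neg)
  show "a = b"
  proof (rule ccontr)
    assume "a \<noteq> b"
    then have "a \<ominus>\<^bsub>R\<^esub> b \<in> carrier R" "a \<ominus>\<^bsub>R\<^esub> b \<noteq> \<zero>\<^bsub>R\<^esub>" using ab by auto
    then have "inv\<^bsub>R\<^esub> (a \<ominus>\<^bsub>R\<^esub> b) \<in> carrier R" "(a \<ominus>\<^bsub>R\<^esub> b) \<otimes>\<^bsub>R\<^esub> inv\<^bsub>R\<^esub> (a \<ominus>\<^bsub>R\<^esub> b) = \<one>\<^bsub>R\<^esub>"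
      using R.field_Units by auto
    then have "\<one> = h (a \<ominus>\<^bsub>R\<^esub> b) \<otimes> h (inv\<^bsub>R\<^esub> (a \<ominus>\<^bsub>R\<^esub> b))"
      using \<open>a \<ominus>\<^bsub>R\<^esub> b \<in> carrier R\<close> by (metis h.hom_mult h.hom_one)
    then show False using z \<open>inv\<^bsub>R\<^esub> (a \<ominus>\<^bsub>R\<^esub> b) \<in> carrier R\<close> by simp
  qed
qed

lemma card_K: "card K = card (carrier R)"
  using h_inj by (rule card_image)

definition fn :: "nat \<Rightarrow> ((nat \<Rightarrow> nat) \<Rightarrow> 'r) \<Rightarrow> (nat \<Rightarrow> 'a) \<Rightarrow> 'a" where
  "fn d c = (\<Oplus>\<^bsub>A\<^esub>\<alpha>\<in>monoms k d. \<kappa> (h (c \<alpha>)) \<otimes>\<^bsub>A\<^esub> xmon \<alpha>)"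

lemma poly_space_apply: "\<lbrakk>c \<in> poly_space R k d; \<alpha> \<in> monoms k d\<rbrakk> \<Longrightarrow> c \<alpha> \<in> carrier R"
  by (auto simp: poly_space_def)

lemma fn_sp: "c \<in> poly_space R k d \<Longrightarrow> fn d c \<in> s.sp (xmon ` monoms k d)"
  unfolding fn_def by (intro s.sp_finsum xmon_image s.sp_smult s.sp_base) (auto intro: poly_space_apply)

lemma fn_closed: "c \<in> poly_space R k d \<Longrightarrow> fn d c \<in> carrier A"
  using fn_sp s.sp_closed[OF xmon_image] by blast

lemma fn_apply:
  assumes c: "c \<in> poly_space R k d" and x: "x \<in> D"
  shows "fn d c x = mpoly_eval L k (lift_poly L h k d c) x"
proof -
  have "fn d c x = (\<Oplus>\<alpha>\<in>monoms k d. h (c \<alpha>) \<otimes> mpow L {..<k} x \<alpha>)"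
    unfolding fn_def using poly_space_apply[OF c] x by (intro eval_xsum) auto
  also have "\<dots> = mpoly_eval L k (lift_poly L h k d c) x"
    using poly_space_apply[OF c] x by (intro mpoly_eval_lift[symmetric]) (auto simp: aff_def)
  finally show ?thesis .
qed

abbreviation pspace :: "nat \<Rightarrow> (nat \<Rightarrow> nat) \<Rightarrow> (nat \<Rightarrow> (nat \<Rightarrow> nat) \<Rightarrow> 'r) set" where
  "pspace t d \<equiv> PiE {..<t} (\<lambda>i. poly_space R k (d i))"

lemma pspace_apply: "\<lbrakk>f \<in> pspace t d; i < t\<rbrakk> \<Longrightarrow> f i \<in> poly_space R k (d i)"
  by (auto simp: PiE_mem)

lemma finite_pspace: "finite (pspace t d)"
  unfolding poly_space_def using fin finite_monoms by (intro finite_PiE) auto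

lemma pspace_nonempty: "card (pspace t d) > 0"
proof -
  have "pspace t d \<noteq> {}" unfolding poly_space_def by (auto simp: PiE_eq_empty_iff)
  then show ?thesis using finite_pspace by (simp add: card_gt_0_iff)
qed

text \<open>\<open>shifted\<close> on the level of coefficients over \<open>R\<close>, where it
  permutes the sample space. The condition on \<open>l\<close> selects the pure powers of the
  variable \<open>r\<close>, including the constant monomial; \<open>inv_into\<close> brings
  coefficients from \<open>K\<close> back to \<open>R\<close>.\<close>

definition shift :: "nat \<Rightarrow> (nat \<Rightarrow> nat) \<Rightarrow> nat \<Rightarrow> (nat \<Rightarrow> nat \<Rightarrow> 'a) \<Rightarrow> (nat \<Rightarrow> (nat \<Rightarrow> nat) \<Rightarrow> 'r) \<Rightarrow> (nat \<Rightarrow> (nat \<Rightarrow> nat) \<Rightarrow> 'r)" where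
  "shift t d r a f = (\<lambda>i\<in>{..<t}. \<lambda>\<alpha>\<in>monoms k (d i).
     if \<forall>l. l \<noteq> r \<longrightarrow> \<alpha> l = 0 then f i \<alpha> \<oplus>\<^bsub>R\<^esub> inv_into (carrier R) h (a i (\<alpha> r)) else f i \<alpha>)"

lemma monoms_le: "\<alpha> \<in> monoms k e \<Longrightarrow> \<alpha> r \<le> e"
  using monoms_subset_box[of k e] by (cases "r < k") (auto simp: box_iff monoms_def)

context
  fixes t :: nat and d :: "nat \<Rightarrow> nat" and r a
  assumes r: "r < k" and a: "a \<in> PiE {..<t} (\<lambda>i. {..d i} \<rightarrow>\<^sub>E K)"
begin

lemma a_K: "\<lbrakk>i < t; j \<le> d i\<rbrakk> \<Longrightarrow> a i j \<in> K"
  using a by (meson PiE_mem atMost_iff lessThan_iff)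

lemma a_inv: "\<lbrakk>i < t; j \<le> d i\<rbrakk> \<Longrightarrow> inv_into (carrier R) h (a i j) \<in> carrier R"
  "\<lbrakk>i < t; j \<le> d i\<rbrakk> \<Longrightarrow> h (inv_into (carrier R) h (a i j)) = a i j"
  using a_K by (auto intro: inv_into_into f_inv_into_f)

lemma shift_closed:
  assumes f: "f \<in> pspace t d"
  shows "shift t d r a f \<in> pspace t d"
proof -
  have "f i \<alpha> \<oplus>\<^bsub>R\<^esub> inv_into (carrier R) h (a i (\<alpha> r)) \<in> carrier R" "f i \<alpha> \<in> carrier R"
    if "i < t" "\<alpha> \<in> monoms k (d i)" for i \<alpha>
    using that a_inv monoms_le poly_space_apply[OF pspace_apply[OF f]] by auto
  then show ?thesis by (simp add: shift_def poly_space_def PiE_iff)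
qed

lemma shift_inj: "inj_on (shift t d r a) (pspace t d)"
proof (rule inj_onI)
  fix f g assume fg: "f \<in> pspace t d" "g \<in> pspace t d" "shift t d r a f = shift t d r a g"
  show "f = g"
  proof (rule PiE_ext[OF fg(1,2)])
    fix i assume i: "i \<in> {..<t}"
    then have fi: "f i \<in> poly_space R k (d i)" "g i \<in> poly_space R k (d i)" using fg pspace_apply by auto
    show "f i = g i"
    proof (rule PiE_ext[OF fi[unfolded poly_space_def]])
      fix \<alpha> assume al: "\<alpha> \<in> monoms k (d i)"
      have c: "f i \<alpha> \<in> carrier R" "g i \<alpha> \<in> carrier R" "inv_into (carrier R) h (a i (\<alpha> r)) \<in> carrier R"
        using fi poly_space_apply al a_inv monoms_le i by auto
      have "shift t d r a f i \<alpha> = shift t d r a g i \<alpha>" using fg(3) by simp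
      then show "f i \<alpha> = g i \<alpha>" using i al c by (auto simp: shift_def split: if_splits)
    qed
  qed
qed

lemma fn_shift:
  assumes f: "f \<in> pspace t d" and i: "i < t"
  shows "fn (d i) (shift t d r a f i) = shifted (\<lambda>i. fn (d i) (f i)) d r a i"
proof -
  let ?M = "monoms k (d i)" and ?g = "inv_into (carrier R) h"
  let ?pure = "\<lambda>\<alpha>. \<forall>l. l \<noteq> r \<longrightarrow> \<alpha> l = (0::nat)"
  let ?single = "\<lambda>j l. if l = r then j else (0::nat)"
  let ?G = "\<lambda>\<alpha>. if ?pure \<alpha> then \<kappa> (a i (\<alpha> r)) \<otimes>\<^bsub>A\<^esub> xmon \<alpha> else \<zero>\<^bsub>A\<^esub>"
  have fc: "f i \<alpha> \<in> carrier R" if "\<alpha> \<in> ?M" for \<alpha> using poly_space_apply[OF pspace_apply[OF f i] that] .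
  have ac: "a i j \<in> carrier L" if "j \<le> d i" for j using a_K[OF i that] by auto
  have "fn (d i) (shift t d r a f i) = (\<Oplus>\<^bsub>A\<^esub>\<alpha>\<in>?M. \<kappa> (h (f i \<alpha>)) \<otimes>\<^bsub>A\<^esub> xmon \<alpha> \<oplus>\<^bsub>A\<^esub> ?G \<alpha>)"
    unfolding fn_def
  proof (rule s.finsum_cong')
    show "(\<lambda>\<alpha>. \<kappa> (h (f i \<alpha>)) \<otimes>\<^bsub>A\<^esub> xmon \<alpha> \<oplus>\<^bsub>A\<^esub> ?G \<alpha>) \<in> ?M \<rightarrow> carrier A"
      using fc ac monoms_le by auto
    fix \<alpha> assume al: "\<alpha> \<in> ?M"
    show "\<kappa> (h (shift t d r a f i \<alpha>)) \<otimes>\<^bsub>A\<^esub> xmon \<alpha> = \<kappa> (h (f i \<alpha>)) \<otimes>\<^bsub>A\<^esub> xmon \<alpha> \<oplus>\<^bsub>A\<^esub> ?G \<alpha>"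
    proof (cases "?pure \<alpha>")
      case True
      then have "h (shift t d r a f i \<alpha>) = h (f i \<alpha>) \<oplus> a i (\<alpha> r)"
        using al i fc a_inv[OF i monoms_le[OF al]] by (simp add: shift_def)
      then show ?thesis using True fc[OF al] ac[OF monoms_le[OF al]] by (simp add: s.l_distr)
    next
      case False
      then have "shift t d r a f i \<alpha> = f i \<alpha>" using al i by (auto simp: shift_def)
      moreover have "?G \<alpha> = \<zero>\<^bsub>A\<^esub>" using False by (simp only: if_False)
      ultimately show ?thesis using fc[OF al] by simp
    qed
  qed simp
  also have "\<dots> = fn (d i) (f i) \<oplus>\<^bsub>A\<^esub> (\<Oplus>\<^bsub>A\<^esub>\<alpha>\<in>?M. ?G \<alpha>)"
    unfolding fn_def using fc ac monoms_le by (intro s.finsum_addf) auto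
  \<comment> \<open>Only pure powers contribute, and these are indexed by their exponent
    \<open>j \<le> d i\<close>.\<close>
  also have "(\<Oplus>\<^bsub>A\<^esub>\<alpha>\<in>?M. ?G \<alpha>) = (\<Oplus>\<^bsub>A\<^esub>\<alpha>\<in>?single ` {..d i}. ?G \<alpha>)"
  proof (rule s.add.finprod_mono_neutral_cong_right[OF finite_monoms])
    show "?single ` {..d i} \<subseteq> ?M" using r by (auto simp: monoms_def)
    show "?G \<alpha> = \<zero>\<^bsub>A\<^esub>" if al: "\<alpha> \<in> ?M - ?single ` {..d i}" for \<alpha>
    proof -
      have "\<not> ?pure \<alpha>"
      proof
        assume "?pure \<alpha>"
        then have "\<alpha> = ?single (\<alpha> r)" by (intro ext) auto
        moreover have "\<alpha> r \<in> {..d i}" using al monoms_le by auto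
        ultimately show False using al by blast
      qed
      then show ?thesis by (simp only: if_False)
    qed
    show "?G \<in> ?M \<rightarrow> carrier A" using ac monoms_le by auto
  qed simp
  also have "\<dots> = (\<Oplus>\<^bsub>A\<^esub>j\<in>{..d i}. ?G (?single j))"
  proof (rule s.finsum_reindex)
    show "?G \<in> ?single ` {..d i} \<rightarrow> carrier A" using ac by auto
    show "inj_on ?single {..d i}"
    proof (rule inj_onI)
      fix j j' assume "?single j = ?single j'"
      then show "j = j'" using fun_cong[of "?single j" "?single j'" r] by simp
    qed
  qed
  also have "\<dots> = upol A (d i) (\<lambda>j. \<kappa> (a i j)) (xs r)"
    unfolding upol_def
  proof (rule s.finsum_cong')
    show "(\<lambda>j. \<kappa> (a i j) \<otimes>\<^bsub>A\<^esub> xs r [^]\<^bsub>A\<^esub> j) \<in> {..d i} \<rightarrow> carrier A" using ac xs_closed[OF r] by auto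
    fix j assume "j \<in> {..d i}"
    have "xmon (?single j) = xs r [^]\<^bsub>A\<^esub> j" using r xs_carrier by (intro s.S.mpow_single) auto
    then show "?G (?single j) = \<kappa> (a i j) \<otimes>\<^bsub>A\<^esub> xs r [^]\<^bsub>A\<^esub> j" by simp
  qed simp
  finally show ?thesis by (simp add: shifted_def)
qed

end

lemma has_eliminant_cong:
  assumes "\<And>i. i < t \<Longrightarrow> F i = G i"
  shows "has_eliminant t S F = has_eliminant t S G"
proof -
  have "ideal_gens t F = ideal_gens t G" using assms by (force simp: ideal_gens_def)
  then show ?thesis by (simp add: has_eliminant_def)
qed

text \<open>For fixed \<open>f\<close> the shifts without eliminant are counted by
  \<open>card_no_eliminant\<close>; \<open>averaging\<close> converts this into a count of
  systems.\<close>

lemma no_eliminant_bound: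
  assumes S: "S \<subseteq> {..<k}" "card S + t = k + 1" "S \<noteq> {}" and t: "t \<ge> 1"
    and E: "((k + 1) * E * \<delta> + 1) ^ k < (E + 1) ^ (k + 1)" and \<delta>: "\<delta> \<ge> 1" "\<And>i. i < t \<Longrightarrow> d i \<le> \<delta>"
  shows "card {f \<in> pspace t d. \<not> has_eliminant t S (\<lambda>i. fn (d i) (f i))} * card (carrier R) ^ Min (d ` {..<t})
    \<le> t * E * card (pspace t d)"
proof -
  obtain r where r: "r \<in> S" "r < k" using S by auto
  let ?X = "PiE {..<t} (\<lambda>i. {..d i} \<rightarrow>\<^sub>E K)"
  \<comment> \<open>A common lower bound for the sides \<open>card K ^ (d i + 1)\<close> of the
    grid.\<close>
  let ?M = "card (carrier R) ^ Min (d ` {..<t})"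
  have finK: "finite K" using fin by simp
  have K1: "card (carrier R) \<ge> 1" using fin R.one_closed by (metis One_nat_def Suc_leI card_gt_0_iff empty_iff)
  have cX: "card ?X = (\<Prod>i<t. card K ^ (d i + 1))" by (simp add: card_PiE card_funcsetE)
  have M: "?M \<le> card K ^ (d i + 1)" if "i < t" for i
  proof -
    have "Min (d ` {..<t}) \<le> d i" using that by (intro Min_le) auto
    then show ?thesis unfolding card_K using K1 by (intro power_increasing) auto
  qed
  show ?thesis
  proof (rule averaging[where T = "shift t d r" and ?X1.0 = ?X])
    show "finite ?X" using finK by (intro finite_PiE) auto
    then show "?X \<noteq> {}" using cX K1 card_K by auto
    show "finite (pspace t d)" by (rule finite_pspace)
    show "inj_on (shift t d r a) (pspace t d)" if "a \<in> ?X" for a using shift_inj[OF r(2) that] .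
    show "shift t d r a f \<in> pspace t d" if "a \<in> ?X" "f \<in> pspace t d" for a f
      using shift_closed[OF r(2) that] .
    fix f assume f: "f \<in> pspace t d"
    let ?F = "\<lambda>i. fn (d i) (f i)"
    have ec: "has_eliminant t S (\<lambda>i. fn (d i) (shift t d r a f i)) = has_eliminant t S (shifted ?F d r a)"
      if "a \<in> ?X" for a by (rule has_eliminant_cong) (rule fn_shift[OF r(2) that f])
    have "{a \<in> ?X. \<not> has_eliminant t S (\<lambda>i. fn (d i) (shift t d r a f i))} =
       {a \<in> ?X. \<not> has_eliminant t S (shifted ?F d r a)}"
      by (intro Collect_cong conj_cong refl) (simp only: ec)
    moreover have "card {a \<in> ?X. \<not> has_eliminant t S (shifted ?F d r a)} * ?M \<le> t * E * (\<Prod>i<t. card K ^ (d i + 1))"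
    proof (rule card_no_eliminant[OF S(1) r(1) S(2) _ \<delta>(1) E finK _ _ M])
      show "?F i \<in> s.sp (xmon ` box {..<k} \<delta>)" if i: "i < t" for i
      proof -
        have sub: "monoms k (d i) \<subseteq> box {..<k} \<delta>"
          using monoms_subset_box box_mono[OF \<delta>(2)[OF i]] by (rule subset_trans)
        show ?thesis by (rule subsetD[OF s.sp_mono[OF image_mono[OF sub]] fn_sp[OF pspace_apply[OF f i]]])
      qed
      show "K \<subseteq> carrier L" by auto
      show "x \<ominus> y \<in> K" if xy: "x \<in> K" "y \<in> K" for x y
      proof -
        obtain u v where u: "u \<in> carrier R" "x = h u" "v \<in> carrier R" "y = h v" using xy by auto
        then have eq: "x \<ominus> y = h (u \<ominus>\<^bsub>R\<^esub> v)" by (simp add: minus_eq R.minus_eq)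
        have "h (u \<ominus>\<^bsub>R\<^esub> v) \<in> K" using u by (intro imageI R.minus_closed)
        then show ?thesis by (simp only: eq)
      qed
    qed
    ultimately show "card {a \<in> ?X. \<not> has_eliminant t S (\<lambda>i. fn (d i) (shift t d r a f i))} * ?M \<le> t * E * card ?X"
      unfolding cX by simp
  qed
qed

text \<open>Union bound over the sets in \<open>SS\<close>. The summand 1 in the numerator makes the
  constant visibly positive.\<close>

lemma event_bound:
  assumes SS: "finite SS" "\<And>S. S \<in> SS \<Longrightarrow> S \<subseteq> {..<k} \<and> card S + t = k + 1" and t: "1 \<le> t" "t \<le> k"
    and E: "((k + 1) * E * \<delta> + 1) ^ k < (E + 1) ^ (k + 1)" and \<delta>: "\<delta> \<ge> 1" "\<And>i. i < t \<Longrightarrow> d i \<le> \<delta>"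
    and ev: "\<And>f. \<lbrakk>f \<in> pspace t d; \<And>S. S \<in> SS \<Longrightarrow> has_eliminant t S (\<lambda>i. fn (d i) (f i))\<rbrakk> \<Longrightarrow> \<not> ev f"
  shows "real (card {f \<in> pspace t d. ev f}) / real (card (pspace t d))
    \<le> real (card SS * t * E + 1) / real (card (carrier R)) ^ Min (d ` {..<t})"
proof -
  let ?q = "card (carrier R) ^ Min (d ` {..<t})"
  let ?bad = "\<lambda>S. {f \<in> pspace t d. \<not> has_eliminant t S (\<lambda>i. fn (d i) (f i))}"
  have "{f \<in> pspace t d. ev f} \<subseteq> (\<Union>S\<in>SS. ?bad S)" using ev by blast
  then have "card {f \<in> pspace t d. ev f} \<le> card (\<Union>S\<in>SS. ?bad S)"
    using SS finite_pspace by (intro card_mono) auto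
  also have "\<dots> \<le> (\<Sum>S\<in>SS. card (?bad S))" by (rule card_UN_le[OF SS(1)])
  finally have "card {f \<in> pspace t d. ev f} * ?q \<le> (\<Sum>S\<in>SS. card (?bad S) * ?q)"
    by (simp add: sum_distrib_right[symmetric])
  also have "\<dots> \<le> (\<Sum>S\<in>SS. t * E * card (pspace t d))"
  proof (rule sum_mono)
    fix S assume S: "S \<in> SS"
    then have "S \<subseteq> {..<k}" "card S + t = k + 1" "S \<noteq> {}" using SS(2)[OF S] t by auto
    then show "card (?bad S) * ?q \<le> t * E * card (pspace t d)"
      by (rule no_eliminant_bound[OF _ _ _ t(1) E \<delta>])
  qed
  also have "\<dots> \<le> (card SS * t * E + 1) * card (pspace t d)" by (simp add: algebra_simps)
  finally have "real (card {f \<in> pspace t d. ev f} * ?q) \<le> real ((card SS * t * E + 1) * card (pspace t d))"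
    by (simp only: of_nat_le_iff)
  moreover have "card (carrier R) > 0" using fin R.one_closed by (auto simp: card_gt_0_iff)
  ultimately show ?thesis using pspace_nonempty[of t d] by (simp add: field_simps)
qed

section \<open>The two events excluded by eliminants\<close>

lemma dimension_event:
  assumes t: "1 \<le> t" "t \<le> k" and f: "f \<in> pspace t d"
    and el: "\<And>S. \<lbrakk>S \<subseteq> {..<k}; card S + t = k + 1\<rbrakk> \<Longrightarrow> has_eliminant t S (\<lambda>i. fn (d i) (f i))"
  shows "\<not> zar_dim L k (zero_set L k ((\<lambda>i. lift_poly L h k (d i) (f i)) ` {..<t})) > enat (k - t)"
proof -
  let ?V = "zero_set L k ((\<lambda>i. lift_poly L h k (d i) (f i)) ` {..<t})"
  have V: "?V \<subseteq> D" by (auto simp: zero_set_def)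
  have "\<not> zar_dim L k ?V > enat (k - t + 1 - 1)"
  proof (rule zar_dim_less[OF V])
    fix S assume S: "S \<subseteq> {..<k}" "card S = k - t + 1"
    then obtain e p where p: "p \<in> s.sp (xmon ` box S e)" "p \<noteq> \<zero>\<^bsub>A\<^esub>" "p \<in> s.sp (ideal_gens t (\<lambda>i. fn (d i) (f i)))"
      using el[of S] t unfolding has_eliminant_def by auto
    have "p \<in> vanish ?V"
    proof (rule ideal_vanish[OF _ p(3) V])
      show "fn (d i) (f i) \<in> carrier A" if "i < t" for i using fn_closed pspace_apply[OF f that] by blast
      show "fn (d i) (f i) x = \<zero>" if "x \<in> ?V" "i < t" for x i
        using that fn_apply[OF pspace_apply[OF f that(2)], of x] by (auto simp: zero_set_def)
    qed
    then show "\<exists>e p. p \<in> s.sp (xmon ` box S e) \<and> p \<noteq> \<zero>\<^bsub>A\<^esub> \<and> p \<in> vanish ?V" using p by blast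
  qed simp
  then show ?thesis by simp
qed

text \<open>\<open>h\<close> embeds the rational zeros into the zeros over \<open>L\<close>, where
  the eliminants live. \<open>bezout\<close> is applied to this finite image, which may be a proper
  part of the zeros over \<open>L\<close>.\<close>

lemma points_event:
  assumes k: "1 \<le> k" and d: "\<And>i. i < k \<Longrightarrow> 0 < d i" and f: "f \<in> pspace k d"
    and el: "\<And>i. i < k \<Longrightarrow> has_eliminant k {i} (\<lambda>i. fn (d i) (f i))"
  shows "\<not> card (zero_set R k ((\<lambda>i. lift_poly R id k (d i) (f i)) ` {..<k})) > (\<Prod>i<k. d i)"
proof -
  let ?Z = "zero_set R k ((\<lambda>i. lift_poly R id k (d i) (f i)) ` {..<k})"
  let ?h = "\<lambda>x. \<lambda>i\<in>{..<k}. h (x i)"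
  have Z: "?Z \<subseteq> {..<k} \<rightarrow>\<^sub>E carrier R" by (auto simp: zero_set_def aff_def)
  have finZ: "finite ?Z" using finite_subset[OF Z] fin finite_PiE[of "{..<k}" "\<lambda>_. carrier R"] by auto
  have "inj_on ?h ?Z"
  proof (rule inj_onI)
    fix x y assume xy: "x \<in> ?Z" "y \<in> ?Z" "?h x = ?h y"
    then have xy': "x \<in> {..<k} \<rightarrow>\<^sub>E carrier R" "y \<in> {..<k} \<rightarrow>\<^sub>E carrier R" using Z by auto
    show "x = y"
    proof (rule PiE_ext[OF xy'])
      fix i assume i: "i \<in> {..<k}"
      then have "h (x i) = h (y i)" using fun_cong[OF xy(3), of i] by simp
      then show "x i = y i" using h_inj PiE_mem[OF xy'(1) i] PiE_mem[OF xy'(2) i] by (auto dest: inj_onD)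
    qed
  qed
  then have "card ?Z = card (?h ` ?Z)" by (rule card_image[symmetric])
  also have "\<dots> \<le> (\<Prod>i<k. d i)"
  proof (rule bezout[OF k _ _ el])
    show "1 \<le> d i" if "i < k" for i using d[OF that] by simp
    show "fn (d i) (f i) \<in> s.sp (xmon ` monoms k (d i))" if "i < k" for i using fn_sp pspace_apply[OF f that] by blast
    show "finite (?h ` ?Z)" using finZ by simp
    show hD: "?h ` ?Z \<subseteq> D"
    proof
      fix P assume "P \<in> ?h ` ?Z"
      then obtain x where x: "x \<in> ?Z" "P = ?h x" by auto
      then have "x i \<in> carrier R" if "i < k" for i using Z that by auto
      then show "P \<in> D" using x by (auto simp: aff_def)
    qed
    fix P i assume P: "P \<in> ?h ` ?Z" and i: "i < k"
    obtain x where x: "x \<in> ?Z" "P = ?h x" using P by auto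
    have xR: "x \<in> {..<k} \<rightarrow> carrier R" using x Z by auto
    have fi: "\<And>\<alpha>. \<alpha> \<in> monoms k (d i) \<Longrightarrow> f i \<alpha> \<in> carrier R" using poly_space_apply[OF pspace_apply[OF f i]] .
    have "\<zero>\<^bsub>R\<^esub> = mpoly_eval R k (lift_poly R id k (d i) (f i)) x" using x i by (auto simp: zero_set_def)
    also have "\<dots> = (\<Oplus>\<^bsub>R\<^esub>\<alpha>\<in>monoms k (d i). f i \<alpha> \<otimes>\<^bsub>R\<^esub> mpow R {..<k} x \<alpha>)"
      using fi xR by (subst R.mpoly_eval_lift) auto
    finally have "h \<zero>\<^bsub>R\<^esub> = h (\<Oplus>\<^bsub>R\<^esub>\<alpha>\<in>monoms k (d i). f i \<alpha> \<otimes>\<^bsub>R\<^esub> mpow R {..<k} x \<alpha>)" by simp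
    also have "\<dots> = (\<Oplus>\<alpha>\<in>monoms k (d i). (h \<circ> (\<lambda>\<alpha>. f i \<alpha> \<otimes>\<^bsub>R\<^esub> mpow R {..<k} x \<alpha>)) \<alpha>)"
      using fi xR by (intro h.hom_finsum) auto
    also have "\<dots> = (\<Oplus>\<alpha>\<in>monoms k (d i). h (f i \<alpha>) \<otimes> mpow L {..<k} P \<alpha>)"
    proof (rule finsum_cong')
      have PL: "P \<in> {..<k} \<rightarrow> carrier L" using xR x(2) by (auto simp: Pi_def)
      show "(\<lambda>\<alpha>. h (f i \<alpha>) \<otimes> mpow L {..<k} P \<alpha>) \<in> monoms k (d i) \<rightarrow> carrier L" using fi PL by auto
      fix \<alpha> assume al: "\<alpha> \<in> monoms k (d i)"
      have "mpow L {..<k} (\<lambda>i. h (x i)) \<alpha> = mpow L {..<k} P \<alpha>"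
        using PL x(2) by (intro mpow_cong) auto
      then show "(h \<circ> (\<lambda>\<alpha>. f i \<alpha> \<otimes>\<^bsub>R\<^esub> mpow R {..<k} x \<alpha>)) \<alpha> = h (f i \<alpha>) \<otimes> mpow L {..<k} P \<alpha>"
        using fi[OF al] xR h.hom_mpow[OF xR, of \<alpha>] by simp
    qed simp
    also have "\<dots> = mpoly_eval L k (lift_poly L h k (d i) (f i)) P"
      using fi hD P by (intro mpoly_eval_lift[symmetric]) (auto simp: aff_def)
    also have "\<dots> = fn (d i) (f i) P" using fn_apply[OF pspace_apply[OF f i]] hD P by auto
    finally show "fn (d i) (f i) P = \<zero>" by simp
  qed
  finally show ?thesis by simp
qed

end

lemma algebraic_closure_finite_subfield:
  assumes "field R" "finite (carrier R)" "h \<in> ring_hom R L" "algebraic_closure L (h ` carrier R)"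
  shows "finite_subfield L R h"
proof -
  interpret algebraic_closure L "h ` carrier R" by fact
  show ?thesis
    using assms infinite_carrier
    by (intro finite_subfield.intro affine_space.intro affine_space_axioms.intro finite_subfield_axioms.intro)
       (auto intro: field_axioms)
qed

theorem theorem4p3:
  fixes k t :: nat and d :: "nat \<Rightarrow> nat"
  assumes "1 \<le> t" and "t \<le> k" and "\<forall>i<t. 0 < d i"
  shows "(\<exists>C>0. \<forall>(R :: 'a ring) (L :: 'b ring) h.
            field R \<and> finite (carrier R) \<and> h \<in> ring_hom R L \<and> algebraic_closure L (h ` carrier R) \<longrightarrow>
            real (card {f \<in> PiE {..<t} (\<lambda>i. poly_space R k (d i)).
                   zar_dim L k (zero_set L k ((\<lambda>i. lift_poly L h k (d i) (f i)) ` {..<t})) > enat (k - t)})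
              / real (card (PiE {..<t} (\<lambda>i. poly_space R k (d i))))
            \<le> C / real (card (carrier R)) ^ Min (d ` {..<t}))
       \<and> (t = k \<longrightarrow>
          (\<exists>C>0. \<forall>(R :: 'a ring).
            field R \<and> finite (carrier R) \<longrightarrow>
            real (card {f \<in> PiE {..<k} (\<lambda>i. poly_space R k (d i)).
                   card (zero_set R k ((\<lambda>i. lift_poly R id k (d i) (f i)) ` {..<k})) > (\<Prod>i<k. d i)})
              / real (card (PiE {..<k} (\<lambda>i. poly_space R k (d i))))
            \<le> C / real (card (carrier R)) ^ Min (d ` {..<k})))"
proof -
  \<comment> \<open>Bounds the degrees of the \<open>f i\<close> and, thanks to the summand 1, also
    that of the coordinates \<open>X_s\<close> in the relation \<open>Q\<close>.\<close>
  define \<delta> where "\<delta> = (\<Sum>i<t. d i) + 1"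
  \<comment> \<open>Since \<open>(k + 1) * E * \<delta> + 1 \<le> (E + 1) * ((k + 1) * \<delta> +
    1)\<close>, the \<open>k\<close>-th power is at most \<open>(E + 1) ^ k * E\<close>. As
    \<open>E\<close> depends only on \<open>k\<close> and the \<open>d i\<close>, the final
    constants do not involve the field.\<close>
  define E where "E = ((k + 1) * \<delta> + 1) ^ k"
  have \<delta>: "\<delta> \<ge> 1" by (simp add: \<delta>_def)
  have d\<delta>: "d i \<le> \<delta>" if "i < t" for i
  proof -
    have "d i \<le> (\<Sum>i<t. d i)" using that by (intro member_le_sum) auto
    then show ?thesis by (simp add: \<delta>_def)
  qed
  have "((k + 1) * E * \<delta> + 1) ^ k \<le> ((E + 1) * ((k + 1) * \<delta> + 1)) ^ k"
    by (intro power_mono) (auto simp: algebra_simps)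
  also have "\<dots> = (E + 1) ^ k * E" by (simp only: power_mult_distrib E_def)
  also have "\<dots> < (E + 1) ^ (k + 1)" by simp
  finally have E: "((k + 1) * E * \<delta> + 1) ^ k < (E + 1) ^ (k + 1)" .
  let ?S1 = "{S. S \<subseteq> {..<k} \<and> card S + t = k + 1}"
  have fS1: "finite ?S1" by (rule finite_subset[of _ "Pow {..<k}"]) auto
  \<comment> \<open>For \<open>t = k\<close> the sets of \<open>k - t + 1\<close> variables are the
    singletons.\<close>
  let ?S2 = "(\<lambda>i. {i}) ` {..<k}"
  show ?thesis
  proof (rule conjI, goal_cases)
    case 1
    show ?case
    proof (intro exI[of _ "real (card ?S1 * t * E + 1)"] conjI allI impI; (elim conjE)?)
      fix R :: "'a ring" and L :: "'b ring" and h
      assume "field R" "finite (carrier R)" "h \<in> ring_hom R L" "algebraic_closure L (h ` carrier R)"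
      then interpret finite_subfield L k R h by (rule algebraic_closure_finite_subfield)
      show "real (card {f \<in> pspace t d. zar_dim L k (zero_set L k ((\<lambda>i. lift_poly L h k (d i) (f i)) ` {..<t})) > enat (k - t)})
                / real (card (pspace t d)) \<le> real (card ?S1 * t * E + 1) / real (card (carrier R)) ^ Min (d ` {..<t})"
      proof (rule event_bound[OF fS1 _ assms(1,2) E \<delta> d\<delta>])
        fix f assume "f \<in> pspace t d" "\<And>S. S \<in> ?S1 \<Longrightarrow> has_eliminant t S (\<lambda>i. fn (d i) (f i))"
        then show "\<not> zar_dim L k (zero_set L k ((\<lambda>i. lift_poly L h k (d i) (f i)) ` {..<t})) > enat (k - t)"
          using assms(1,2) by (intro dimension_event) auto
      qed auto
    qed (rule of_nat_0_less_iff[THEN iffD2], simp)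
  next
    case 2
    show ?case
    proof (intro impI exI[of _ "real (card ?S2 * k * E + 1)"] conjI allI; (elim conjE)?)
      fix R :: "'a ring"
      assume tk: "t = k" and R: "field R" "finite (carrier R)"
      interpret R: field R by fact
      \<comment> \<open>The second statement mentions \<open>R\<close> only, so a concrete algebraic
        closure is supplied, with the constants as embedding.\<close>
      interpret finite_subfield R.alg_closure k R "R.indexed_const"
        using R R.alg_closureE by (intro algebraic_closure_finite_subfield)
      show "real (card {f \<in> pspace k d. card (zero_set R k ((\<lambda>i. lift_poly R id k (d i) (f i)) ` {..<k})) > (\<Prod>i<k. d i)})
                / real (card (pspace k d)) \<le> real (card ?S2 * k * E + 1) / real (card (carrier R)) ^ Min (d ` {..<k})"
      proof (rule event_bound[OF _ _ assms(1,2)[unfolded tk] E \<delta> d\<delta>[unfolded tk]])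
        fix f assume "f \<in> pspace k d" "\<And>S. S \<in> ?S2 \<Longrightarrow> has_eliminant k S (\<lambda>i. fn (d i) (f i))"
        then show "\<not> card (zero_set R k ((\<lambda>i. lift_poly R id k (d i) (f i)) ` {..<k})) > (\<Prod>i<k. d i)"
          using assms tk by (intro points_event) auto
      qed (use assms tk in auto)
    qed (rule of_nat_0_less_iff[THEN iffD2], simp)
  qed
qed

end
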